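(* The square formed by the functors $\mathcal O\colon\mathbb{MS}4\to\mathbb{MHA}$, $\rho\colon\mathbf{DF}_{\mathsf{MS4}}\to\mathbf{DF}_{\mathsf{MIPC}}$ and the duality functors $(-)_*,(-)^*$ between $\mathbb{MS}4$ and $\mathbf{DF}_{\mathsf{MS4}}$ and between $\mathbb{MHA}$ and $\mathbf{DF}_{\mathsf{MIPC}}$ commutes up to natural isomorphism; that is, $\rho\circ(-)_*$ is naturally isomorphic to $(-)_*\circ\mathcal O$ (as contravariant functors $\mathbb{MS}4\to\mathbf{DF}_{\mathsf{MIPC}}$), and $(-)^*\circ\rho$ is naturally isomorphic to $\mathcal O\circ(-)^*$ (as contravariant functors $\mathbf{DF}_{\mathsf{MS4}}\to\mathbb{MHA}$).
   Context: Algebras. A monadic Heyting algebra is a tuple $(H,\forall,\exists)$ where $H$ is a Heyting algebra and $\forall,\exists$ are unary functions on $H$ satisfying, for all $a,b\in H$: $\forall(a\wedge b)=\forall a\wedge\forall b$, $\forall a\le a$, $\forall a\le\forall\forall a$, $\exists(a\vee b)=\exists a\vee\exists b$, $a\le\exists a$, $\exists\exists a\le\exists a$, $\exists a\wedge\exists b\le\exists(\exists a\wedge b)$, $\exists\forall a=\forall a$, $\exists a=\forall\exists a$. An $\mathsf{MS4}$-algebra is a tuple $(B,\Box,\forall)$ where $B$ is a boolean algebra, $(B,\Box)$ is an $\mathsf{S4}$-algebra ($\Box1=1$, $\Box(a\wedge b)=\Box a\wedge\Box b$, $\Box a\le a$, $\Box a\le\Box\Box a$), $(B,\forall)$ is an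 $\mathsf{S5}$-algebra (the same identities for $\forall$ and $\neg\forall a\le\forall\neg\forall a$), and $\Box\forall a\le\forall\Box a$; put $\exists a=\neg\forall\neg a$. $\mathbb{MHA}$ and $\mathbb{MS}4$ are the corresponding categories of algebras and homomorphisms. $\mathcal O(B,\Box,\forall)=(H,\forall_H,\exists_H)$, where $H=\{a\in B:\Box a=a\}$ is the Heyting algebra of open elements (a bounded sublattice of $B$ with $a\to_H b=\Box(\neg a\vee b)$), $\forall_Ha=\Box\forall a$, $\exists_Ha=\exists a$; on morphisms $\mathcal O(h)$ is the restriction of $h$. Frames. For a relation $R$, $R[S]$ and $R^{-1}[S]$ are the image and inverse image; $S$ is an $R$-upset if $R[S]\subseteq S$; for a quasi-order $R$, $xE_Ry$ iff $xRy$ and $yRx$. A relation $R$ on a Stone space $X$ is continuous if $R[x]$ is closed for each $x$ and $R^{-1}[U]$ is clopen for each clopen $U$. A descriptive $\mathsf{MIPC}$-frame is $(X,R,Q)$ with $X$ a Stone space, $R$ a continuous partial order, $Q$ a continuous quasi-order, such that $Q[U]$ is a clopen $R$-upset for each clopen $R$-upset $U$; $R\subseteq Q$; and $xQy$ implies there is $z$ with $xRz$ and $zE_Qy$. A morphism $f\colon(X_1,R_1,Q_1)\to(X_2,R_2,Q_2)$ is a continuous map with $R_2[f(x)]=fR_1[x]$, $Q_2[f(x)]=fQ_1[x]$, and $Q_2^{-1}[f(x)]=R_2^{-1}fQ_1^{-1}[x]$ for all $x$. The category is $\mathbf{DF}_{\mathsf{MIPC}}$. A descriptive $\mathsf{MS4}$-frame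 is $(Y,R,E)$ with $Y$ a Stone space, $R$ a continuous quasi-order, $E$ a continuous equivalence relation, such that $xEy$ and $yRz$ imply there is $u$ with $xRu$ and $uEz$. A morphism is a continuous map $f$ with $R_2[f(y)]=fR_1[y]$ and $E_2[f(y)]=fE_1[y]$ for all $y$. The category is $\mathbf{DF}_{\mathsf{MS4}}$. Duality functors (contravariant). For $\mathfrak F=(X,R,Q)\in\mathbf{DF}_{\mathsf{MIPC}}$, $\mathfrak F^*$ is the Heyting algebra of clopen $R$-upsets with $\forall U=X\setminus Q^{-1}[X\setminus U]$, $\exists U=Q[U]$. For $\mathfrak A=(H,\forall,\exists)$, $\mathfrak A_*=(X,R,Q)$, where $X$ is the set of prime filters of $H$ with topology generated by the basis $\{s(a)\setminus s(b):a,b\in H\}$, $s(a)=\{x\in X:a\in x\}$, $R$ is inclusion, and $xQy$ iff $x\cap H_0\subseteq y$ with $H_0=\{\forall a:a\in H\}$. For $\mathfrak G=(Y,R,E)\in\mathbf{DF}_{\mathsf{MS4}}$, $\mathfrak G^*$ is the boolean algebra of clopen subsets of $Y$ with $\Box U=Y\setminus R^{-1}[Y\setminus U]$, $\forall U=Y\setminus E[Y\setminus U]$. For $\mathfrak B=(B,\Box,\forall)$, $\mathfrak B_*=(Y,R,E)$, where $Y$ is the Stone space of ultrafilters of $B$, $xRy$ iff $\Box^{-1}x\subseteq y$, and $xEy$ iff $x\cap B_0=y\cap B_0$ with $B_0=\{\forall a:a\in B\}$. On morphisms, $f^*=f^{-1}$ and $h_*=h^{-1}$ in all cases. These functors are dual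 equivalences. Skeleton functor $\rho$. For $\mathfrak G=(Y,R,E)\in\mathbf{DF}_{\mathsf{MS4}}$, $\rho(\mathfrak G)=(X,R',Q')$, where $X=Y/E_R$ is the quotient space with quotient map $\pi\colon Y\to X$, $\pi(x)R'\pi(y)$ iff $xRy$, and $\pi(x)Q'\pi(y)$ iff $xQy$, where $Q=E\circ R$ (i.e. $xQy$ iff there is $z$ with $xRz$ and $zEy$). For a morphism $f\colon\mathfrak G_1\to\mathfrak G_2$, $\rho(f)(\pi_1(x))=\pi_2(f(x))$. *)

theory Defs
  imports "HOL-Analysis.Analysis" "HOL-Algebra.Lattice"
begin

section \<open>Algebras\<close>

text \<open>
  Algebras are records over the ordered sets of HOL-Algebra, so that lattice operations and bounds
  are those of the library. Only the values of an operation on the carrier are relevant.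
\<close>

record 'a heyting = "'a gorder" +
  imp :: "'a \<Rightarrow> 'a \<Rightarrow> 'a"

record 'a mha = "'a heyting" +
  mha_all :: "'a \<Rightarrow> 'a"
  mha_ex :: "'a \<Rightarrow> 'a"

record 'a boolean = "'a gorder" +
  neg :: "'a \<Rightarrow> 'a"

record 'a ms4 = "'a boolean" +
  box :: "'a \<Rightarrow> 'a"
  ms4_all :: "'a \<Rightarrow> 'a"

locale heyting_algebra = Lattice.bounded_lattice H
  for H :: "('a, 'm) heyting_scheme" (structure) +
  assumes imp_closed: "\<lbrakk>a \<in> carrier H; b \<in> carrier H\<rbrakk> \<Longrightarrow> imp H a b \<in> carrier H"
    and residuation: "\<lbrakk>a \<in> carrier H; b \<in> carrier H; c \<in> carrier H\<rbrakk> \<Longrightarrow>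
      c \<sqsubseteq> imp H a b \<longleftrightarrow> c \<sqinter> a \<sqsubseteq> b"

locale monadic_heyting_algebra = heyting_algebra H
  for H :: "('a, 'm) mha_scheme" (structure) +
  assumes all_closed: "a \<in> carrier H \<Longrightarrow> mha_all H a \<in> carrier H"
    and ex_closed: "a \<in> carrier H \<Longrightarrow> mha_ex H a \<in> carrier H"
    and all_meet: "\<lbrakk>a \<in> carrier H; b \<in> carrier H\<rbrakk> \<Longrightarrow>
      mha_all H (a \<sqinter> b) = mha_all H a \<sqinter> mha_all H b"
    and all_decr: "a \<in> carrier H \<Longrightarrow> mha_all H a \<sqsubseteq> a"
    and all_trans: "a \<in> carrier H \<Longrightarrow> mha_all H a \<sqsubseteq> mha_all H (mha_all H a)"
    and ex_join: "\<lbrakk>a \<in> carrier H; b \<in> carrier H\<rbrakk> \<Longrightarrow>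
      mha_ex H (a \<squnion> b) = mha_ex H a \<squnion> mha_ex H b"
    and ex_incr: "a \<in> carrier H \<Longrightarrow> a \<sqsubseteq> mha_ex H a"
    and ex_trans: "a \<in> carrier H \<Longrightarrow> mha_ex H (mha_ex H a) \<sqsubseteq> mha_ex H a"
    and ex_meet: "\<lbrakk>a \<in> carrier H; b \<in> carrier H\<rbrakk> \<Longrightarrow>
      mha_ex H a \<sqinter> mha_ex H b \<sqsubseteq> mha_ex H (mha_ex H a \<sqinter> b)"
    and ex_all: "a \<in> carrier H \<Longrightarrow> mha_ex H (mha_all H a) = mha_all H a"
    and all_ex: "a \<in> carrier H \<Longrightarrow> mha_ex H a = mha_all H (mha_ex H a)"

locale boolean_alg = Lattice.bounded_lattice B
  for B :: "('a, 'm) boolean_scheme" (structure) +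
  assumes distrib: "\<lbrakk>a \<in> carrier B; b \<in> carrier B; c \<in> carrier B\<rbrakk> \<Longrightarrow>
      a \<sqinter> (b \<squnion> c) = (a \<sqinter> b) \<squnion> (a \<sqinter> c)"
    and neg_closed: "a \<in> carrier B \<Longrightarrow> neg B a \<in> carrier B"
    and meet_neg: "a \<in> carrier B \<Longrightarrow> a \<sqinter> neg B a = \<bottom>"
    and join_neg: "a \<in> carrier B \<Longrightarrow> a \<squnion> neg B a = \<top>"

locale ms4_algebra = boolean_alg B
  for B :: "('a, 'm) ms4_scheme" (structure) +
  assumes box_closed: "a \<in> carrier B \<Longrightarrow> box B a \<in> carrier B"
    and box_top: "box B \<top> = \<top>"
    and box_meet: "\<lbrakk>a \<in> carrier B; b \<in> carrier B\<rbrakk> \<Longrightarrow> box B (a \<sqinter> b) = box B a \<sqinter> box B b"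
    and box_decr: "a \<in> carrier B \<Longrightarrow> box B a \<sqsubseteq> a"
    and box_trans: "a \<in> carrier B \<Longrightarrow> box B a \<sqsubseteq> box B (box B a)"
    and all_closed: "a \<in> carrier B \<Longrightarrow> ms4_all B a \<in> carrier B"
    and all_top: "ms4_all B \<top> = \<top>"
    and all_meet: "\<lbrakk>a \<in> carrier B; b \<in> carrier B\<rbrakk> \<Longrightarrow>
      ms4_all B (a \<sqinter> b) = ms4_all B a \<sqinter> ms4_all B b"
    and all_decr: "a \<in> carrier B \<Longrightarrow> ms4_all B a \<sqsubseteq> a"
    and all_trans: "a \<in> carrier B \<Longrightarrow> ms4_all B a \<sqsubseteq> ms4_all B (ms4_all B a)"
    and all_sym: "a \<in> carrier B \<Longrightarrow> neg B (ms4_all B a) \<sqsubseteq> ms4_all B (neg B (ms4_all B a))"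
    and box_all: "a \<in> carrier B \<Longrightarrow> box B (ms4_all B a) \<sqsubseteq> ms4_all B (box B a)"

definition ms4_ex :: "('a, 'm) ms4_scheme \<Rightarrow> 'a \<Rightarrow> 'a" where
  "ms4_ex B a = neg B (ms4_all B (neg B a))"

definition lattice_filter :: "('a, 'm) gorder_scheme \<Rightarrow> 'a set \<Rightarrow> bool" where
  "lattice_filter L F \<longleftrightarrow> F \<subseteq> carrier L \<and> \<top>\<^bsub>L\<^esub> \<in> F \<and>
    (\<forall>a\<in>F. \<forall>b\<in>F. a \<sqinter>\<^bsub>L\<^esub> b \<in> F) \<and> (\<forall>a\<in>F. \<forall>b\<in>carrier L. a \<sqsubseteq>\<^bsub>L\<^esub> b \<longrightarrow> b \<in> F)"

definition proper_filter :: "('a, 'm) gorder_scheme \<Rightarrow> 'a set \<Rightarrow> bool" where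
  "proper_filter L F \<longleftrightarrow> lattice_filter L F \<and> F \<noteq> carrier L"

definition prime_filter :: "('a, 'm) gorder_scheme \<Rightarrow> 'a set \<Rightarrow> bool" where
  "prime_filter L F \<longleftrightarrow> proper_filter L F \<and>
    (\<forall>a\<in>carrier L. \<forall>b\<in>carrier L. a \<squnion>\<^bsub>L\<^esub> b \<in> F \<longrightarrow> a \<in> F \<or> b \<in> F)"

definition ultrafilter :: "('a, 'm) gorder_scheme \<Rightarrow> 'a set \<Rightarrow> bool" where
  "ultrafilter L F \<longleftrightarrow> proper_filter L F \<and> (\<forall>G. proper_filter L G \<longrightarrow> F \<subseteq> G \<longrightarrow> G = F)"


section \<open>Descriptive frames\<close>

record 'x mipc_frame =
  mipc_space :: "'x topology"
  mipc_R :: "('x \<times> 'x) set"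
  mipc_Q :: "('x \<times> 'x) set"

record 'y ms4_frame =
  ms4_space :: "'y topology"
  ms4_R :: "('y \<times> 'y) set"
  ms4_E :: "('y \<times> 'y) set"

definition clopen_in :: "'x topology \<Rightarrow> 'x set \<Rightarrow> bool" where
  "clopen_in T U \<longleftrightarrow> closedin T U \<and> openin T U"

text \<open>The last condition says that the clopen sets form a basis.\<close>

definition Stone_space :: "'x topology \<Rightarrow> bool" where
  "Stone_space T \<longleftrightarrow> compact_space T \<and> Hausdorff_space T \<and> neighbourhood_base_of (clopen_in T) T"

definition continuous_relation :: "'x topology \<Rightarrow> ('x \<times> 'x) set \<Rightarrow> bool" where
  "continuous_relation T R \<longleftrightarrow> R \<subseteq> topspace T \<times> topspace T \<and>
    (\<forall>x\<in>topspace T. closedin T (R `` {x})) \<and>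
    (\<forall>U. clopen_in T U \<longrightarrow> clopen_in T (R\<inverse> `` U))"

definition clopen_upset :: "'x topology \<Rightarrow> ('x \<times> 'x) set \<Rightarrow> 'x set \<Rightarrow> bool" where
  "clopen_upset T R U \<longleftrightarrow> clopen_in T U \<and> R `` U \<subseteq> U"

definition sym_part :: "('x \<times> 'x) set \<Rightarrow> ('x \<times> 'x) set" where
  "sym_part R = R \<inter> R\<inverse>"

locale descriptive_mipc_frame =
  fixes F :: "'x mipc_frame"
  assumes Stone: "Stone_space (mipc_space F)"
    and R_order: "partial_order_on (topspace (mipc_space F)) (mipc_R F)"
    and R_continuous: "continuous_relation (mipc_space F) (mipc_R F)"
    and Q_order: "preorder_on (topspace (mipc_space F)) (mipc_Q F)"
    and Q_continuous: "continuous_relation (mipc_space F) (mipc_Q F)"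
    and Q_upset: "clopen_upset (mipc_space F) (mipc_R F) U \<Longrightarrow>
      clopen_upset (mipc_space F) (mipc_R F) (mipc_Q F `` U)"
    and R_sub_Q: "mipc_R F \<subseteq> mipc_Q F"
    and Q_factor: "(x, y) \<in> mipc_Q F \<Longrightarrow> \<exists>z. (x, z) \<in> mipc_R F \<and> (z, y) \<in> sym_part (mipc_Q F)"

locale descriptive_ms4_frame =
  fixes G :: "'y ms4_frame"
  assumes Stone: "Stone_space (ms4_space G)"
    and R_order: "preorder_on (topspace (ms4_space G)) (ms4_R G)"
    and R_continuous: "continuous_relation (ms4_space G) (ms4_R G)"
    and E_equiv: "equiv (topspace (ms4_space G)) (ms4_E G)"
    and E_continuous: "continuous_relation (ms4_space G) (ms4_E G)"
    and commute: "\<lbrakk>(x, y) \<in> ms4_E G; (y, z) \<in> ms4_R G\<rbrakk> \<Longrightarrow>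
      \<exists>u. (x, u) \<in> ms4_R G \<and> (u, z) \<in> ms4_E G"


section \<open>Concrete categories, functors and natural isomorphisms\<close>

text \<open>
  An arrow between structured sets carries its source and target together with a function that is
  extensional (\<open>undefined\<close>) outside the underlying set of the source; hence equality of arrows is
  equality in HOL. Source and target may be structures over different types.
\<close>

record ('o, 'p, 'x, 'y) arrow =
  src :: 'o
  tgt :: 'p
  app :: "'x \<Rightarrow> 'y"

text \<open>
  A concrete category whose objects are structures on subsets of one type.
\<close>

record ('o, 'x) concrete_category =
  Ob :: "'o set"
  Und :: "'o \<Rightarrow> 'x set"
  Arr :: "('o, 'o, 'x, 'x) arrow set"

definition id_arr :: "('o \<Rightarrow> 'x set) \<Rightarrow> 'o \<Rightarrow> ('o, 'o, 'x, 'x) arrow" where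
  "id_arr und A = \<lparr>src = A, tgt = A, app = (\<lambda>x\<in>und A. x)\<rparr>"

definition comp_arr :: "('o \<Rightarrow> 'x set) \<Rightarrow> ('p, 'q, 'y, 'z) arrow \<Rightarrow> ('o, 'p, 'x, 'y) arrow \<Rightarrow>
    ('o, 'q, 'x, 'z) arrow" where
  "comp_arr und g f = \<lparr>src = src f, tgt = tgt g, app = compose (und (src f)) (app g) (app f)\<rparr>"

definition contravariant_functor :: "('o, 'a) concrete_category \<Rightarrow> ('p, 'x) concrete_category \<Rightarrow>
    ('o \<Rightarrow> 'p) \<Rightarrow> (('o, 'o, 'a, 'a) arrow \<Rightarrow> ('p, 'p, 'x, 'x) arrow) \<Rightarrow> bool" where
  "contravariant_functor C D Fo Fa \<longleftrightarrow>
    (\<forall>A\<in>Ob C. Fo A \<in> Ob D) \<and>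
    (\<forall>h\<in>Arr C. Fa h \<in> Arr D \<and> src (Fa h) = Fo (tgt h) \<and> tgt (Fa h) = Fo (src h)) \<and>
    (\<forall>A\<in>Ob C. Fa (id_arr (Und C) A) = id_arr (Und D) (Fo A)) \<and>
    (\<forall>h\<in>Arr C. \<forall>k\<in>Arr C. tgt h = src k \<longrightarrow>
      Fa (comp_arr (Und C) k h) = comp_arr (Und D) (Fa h) (Fa k))"

text \<open>
  The two functors take values in copies \<open>D\<close> and \<open>D'\<close> of the same category, consisting of the
  structures over two possibly different types; \<open>M\<close> and \<open>M'\<close> are the sets of all morphisms of that
  category from objects of \<open>D\<close> to objects of \<open>D'\<close> and back.
\<close>

definition isomorphisms :: "('o \<Rightarrow> 'x set) \<Rightarrow> ('p \<Rightarrow> 'y set) \<Rightarrow>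
    ('o, 'p, 'x, 'y) arrow set \<Rightarrow> ('p, 'o, 'y, 'x) arrow set \<Rightarrow> ('o, 'p, 'x, 'y) arrow set" where
  "isomorphisms und und' M M' = {f \<in> M. \<exists>g\<in>M'. src g = tgt f \<and> tgt g = src f \<and>
    comp_arr und g f = id_arr und (src f) \<and> comp_arr und' f g = id_arr und' (tgt f)}"

definition naturally_isomorphic :: "('o, 'a) concrete_category \<Rightarrow>
    ('p, 'x) concrete_category \<Rightarrow> ('q, 'y) concrete_category \<Rightarrow>
    ('p, 'q, 'x, 'y) arrow set \<Rightarrow> ('q, 'p, 'y, 'x) arrow set \<Rightarrow>
    ('o \<Rightarrow> 'p) \<Rightarrow> (('o, 'o, 'a, 'a) arrow \<Rightarrow> ('p, 'p, 'x, 'x) arrow) \<Rightarrow>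
    ('o \<Rightarrow> 'q) \<Rightarrow> (('o, 'o, 'a, 'a) arrow \<Rightarrow> ('q, 'q, 'y, 'y) arrow) \<Rightarrow> bool" where
  "naturally_isomorphic C D D' M M' Fo Fa Go Ga \<longleftrightarrow>
    contravariant_functor C D Fo Fa \<and> contravariant_functor C D' Go Ga \<and>
    (\<exists>\<eta>. (\<forall>A\<in>Ob C. \<eta> A \<in> isomorphisms (Und D) (Und D') M M' \<and>
              src (\<eta> A) = Fo A \<and> tgt (\<eta> A) = Go A) \<and>
         (\<forall>h\<in>Arr C. comp_arr (Und D) (\<eta> (src h)) (Fa h) = comp_arr (Und D) (Ga h) (\<eta> (tgt h))))"


section \<open>The four categories\<close>

definition lattice_hom :: "('a, 'm) gorder_scheme \<Rightarrow> ('b, 'n) gorder_scheme \<Rightarrow> ('a \<Rightarrow> 'b) \<Rightarrow> bool" where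
  "lattice_hom A B h \<longleftrightarrow> h \<in> carrier A \<rightarrow>\<^sub>E carrier B \<and>
    h \<bottom>\<^bsub>A\<^esub> = \<bottom>\<^bsub>B\<^esub> \<and> h \<top>\<^bsub>A\<^esub> = \<top>\<^bsub>B\<^esub> \<and>
    (\<forall>a\<in>carrier A. \<forall>b\<in>carrier A. h (a \<sqinter>\<^bsub>A\<^esub> b) = h a \<sqinter>\<^bsub>B\<^esub> h b \<and> h (a \<squnion>\<^bsub>A\<^esub> b) = h a \<squnion>\<^bsub>B\<^esub> h b)"

definition mha_hom :: "'a mha \<Rightarrow> 'b mha \<Rightarrow> ('a \<Rightarrow> 'b) \<Rightarrow> bool" where
  "mha_hom A B h \<longleftrightarrow> lattice_hom A B h \<and>
    (\<forall>a\<in>carrier A. \<forall>b\<in>carrier A. h (imp A a b) = imp B (h a) (h b)) \<and>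
    (\<forall>a\<in>carrier A. h (mha_all A a) = mha_all B (h a) \<and> h (mha_ex A a) = mha_ex B (h a))"

definition ms4_hom :: "'a ms4 \<Rightarrow> 'b ms4 \<Rightarrow> ('a \<Rightarrow> 'b) \<Rightarrow> bool" where
  "ms4_hom A B h \<longleftrightarrow> lattice_hom A B h \<and>
    (\<forall>a\<in>carrier A. h (neg A a) = neg B (h a) \<and> h (box A a) = box B (h a) \<and>
      h (ms4_all A a) = ms4_all B (h a))"

definition mipc_mor :: "'x mipc_frame \<Rightarrow> 'y mipc_frame \<Rightarrow> ('x \<Rightarrow> 'y) \<Rightarrow> bool" where
  "mipc_mor F1 F2 f \<longleftrightarrow>
    f \<in> extensional (topspace (mipc_space F1)) \<and>
    continuous_map (mipc_space F1) (mipc_space F2) f \<and>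
    (\<forall>x\<in>topspace (mipc_space F1).
      mipc_R F2 `` {f x} = f ` (mipc_R F1 `` {x}) \<and>
      mipc_Q F2 `` {f x} = f ` (mipc_Q F1 `` {x}) \<and>
      (mipc_Q F2)\<inverse> `` {f x} = (mipc_R F2)\<inverse> `` (f ` ((mipc_Q F1)\<inverse> `` {x})))"

definition ms4_mor :: "'x ms4_frame \<Rightarrow> 'y ms4_frame \<Rightarrow> ('x \<Rightarrow> 'y) \<Rightarrow> bool" where
  "ms4_mor G1 G2 f \<longleftrightarrow>
    f \<in> extensional (topspace (ms4_space G1)) \<and>
    continuous_map (ms4_space G1) (ms4_space G2) f \<and>
    (\<forall>y\<in>topspace (ms4_space G1).
      ms4_R G2 `` {f y} = f ` (ms4_R G1 `` {y}) \<and>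
      ms4_E G2 `` {f y} = f ` (ms4_E G1 `` {y}))"

definition mha_arrows :: "('a mha, 'b mha, 'a, 'b) arrow set" where
  "mha_arrows = {h. monadic_heyting_algebra (src h) \<and> monadic_heyting_algebra (tgt h) \<and>
    mha_hom (src h) (tgt h) (app h)}"

definition ms4_arrows :: "('a ms4, 'b ms4, 'a, 'b) arrow set" where
  "ms4_arrows = {h. ms4_algebra (src h) \<and> ms4_algebra (tgt h) \<and> ms4_hom (src h) (tgt h) (app h)}"

definition mipc_frame_arrows :: "('x mipc_frame, 'y mipc_frame, 'x, 'y) arrow set" where
  "mipc_frame_arrows = {f. descriptive_mipc_frame (src f) \<and> descriptive_mipc_frame (tgt f) \<and>
    mipc_mor (src f) (tgt f) (app f)}"

definition ms4_frame_arrows :: "('x ms4_frame, 'y ms4_frame, 'x, 'y) arrow set" where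
  "ms4_frame_arrows = {f. descriptive_ms4_frame (src f) \<and> descriptive_ms4_frame (tgt f) \<and>
    ms4_mor (src f) (tgt f) (app f)}"

definition MHA :: "('a mha, 'a) concrete_category" where
  "MHA = \<lparr>Ob = {H. monadic_heyting_algebra H}, Und = carrier, Arr = mha_arrows\<rparr>"

definition MS4 :: "('a ms4, 'a) concrete_category" where
  "MS4 = \<lparr>Ob = {B. ms4_algebra B}, Und = carrier, Arr = ms4_arrows\<rparr>"

definition DF_MIPC :: "('x mipc_frame, 'x) concrete_category" where
  "DF_MIPC = \<lparr>Ob = {F. descriptive_mipc_frame F}, Und = (\<lambda>F. topspace (mipc_space F)),
    Arr = mipc_frame_arrows\<rparr>"

definition DF_MS4 :: "('y ms4_frame, 'y) concrete_category" where
  "DF_MS4 = \<lparr>Ob = {G. descriptive_ms4_frame G}, Und = (\<lambda>G. topspace (ms4_space G)),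
    Arr = ms4_frame_arrows\<rparr>"


section \<open>The functors\<close>

text \<open>
  Notation: \<open>\<O>\<close> is \<open>opens\<close>, \<open>\<rho>\<close> is \<open>skel\<close>, \<open>(-)\<^sub>*\<close> is \<open>mha_dual\<close> and \<open>ms4_dual\<close>, and \<open>(-)\<^sup>*\<close> is
  \<open>mipc_alg\<close> and \<open>ms4_alg\<close>; the suffix \<open>_arr\<close> marks the action on arrows.
\<close>

text \<open>
  The open elements carry the order of \<open>B\<close>; they form a bounded sublattice of \<open>B\<close>,
  so the lattice operations of the restricted order are those of \<open>B\<close>.
\<close>

definition opens :: "'a ms4 \<Rightarrow> 'a mha" where
  "opens B = \<lparr>carrier = {a \<in> carrier B. box B a = a}, eq = (=), le = le B,
    imp = (\<lambda>a b. box B (neg B a \<squnion>\<^bsub>B\<^esub> b)),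
    mha_all = (\<lambda>a. box B (ms4_all B a)), mha_ex = (\<lambda>a. ms4_ex B a)\<rparr>"

definition opens_arr :: "('a ms4, 'b ms4, 'a, 'b) arrow \<Rightarrow> ('a mha, 'b mha, 'a, 'b) arrow" where
  "opens_arr h = \<lparr>src = opens (src h), tgt = opens (tgt h),
    app = restrict (app h) (carrier (opens (src h)))\<rparr>"

definition prime_filters_of :: "'a mha \<Rightarrow> 'a \<Rightarrow> 'a set set" where
  "prime_filters_of H a = {x. prime_filter H x \<and> a \<in> x}"

definition mha_dual :: "'a mha \<Rightarrow> 'a set mipc_frame" where
  "mha_dual H = \<lparr>
    mipc_space = topology_generated_by
      {prime_filters_of H a - prime_filters_of H b |a b. a \<in> carrier H \<and> b \<in> carrier H},
    mipc_R = {(x, y). prime_filter H x \<and> prime_filter H y \<and> x \<subseteq> y},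
    mipc_Q = {(x, y). prime_filter H x \<and> prime_filter H y \<and> x \<inter> mha_all H ` carrier H \<subseteq> y}\<rparr>"

definition mha_dual_arr ::
    "('a mha, 'b mha, 'a, 'b) arrow \<Rightarrow> ('b set mipc_frame, 'a set mipc_frame, 'b set, 'a set) arrow" where
  "mha_dual_arr h = \<lparr>src = mha_dual (tgt h), tgt = mha_dual (src h),
    app = (\<lambda>x\<in>topspace (mipc_space (mha_dual (tgt h))). app h -` x \<inter> carrier (src h))\<rparr>"

definition ultrafilters_of :: "'a ms4 \<Rightarrow> 'a \<Rightarrow> 'a set set" where
  "ultrafilters_of B a = {x. ultrafilter B x \<and> a \<in> x}"

definition ms4_dual :: "'a ms4 \<Rightarrow> 'a set ms4_frame" where
  "ms4_dual B = \<lparr>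
    ms4_space = topology_generated_by (ultrafilters_of B ` carrier B),
    ms4_R = {(x, y). ultrafilter B x \<and> ultrafilter B y \<and> box B -` x \<inter> carrier B \<subseteq> y},
    ms4_E = {(x, y). ultrafilter B x \<and> ultrafilter B y \<and>
      x \<inter> ms4_all B ` carrier B = y \<inter> ms4_all B ` carrier B}\<rparr>"

definition ms4_dual_arr ::
    "('a ms4, 'b ms4, 'a, 'b) arrow \<Rightarrow> ('b set ms4_frame, 'a set ms4_frame, 'b set, 'a set) arrow" where
  "ms4_dual_arr h = \<lparr>src = ms4_dual (tgt h), tgt = ms4_dual (src h),
    app = (\<lambda>x\<in>topspace (ms4_space (ms4_dual (tgt h))). app h -` x \<inter> carrier (src h))\<rparr>"

text \<open>
  The implication of clopen upsets is \<open>\<box>(\<not>U \<union> V)\<close>, with \<open>\<box>\<close> given by \<open>R\<close>.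
\<close>

definition mipc_alg :: "'x mipc_frame \<Rightarrow> 'x set mha" where
  "mipc_alg F = (let X = topspace (mipc_space F); R = mipc_R F; Q = mipc_Q F in
    \<lparr>carrier = {U. clopen_upset (mipc_space F) R U}, eq = (=), le = (\<subseteq>),
     imp = (\<lambda>U V. X - R\<inverse> `` (U - V)),
     mha_all = (\<lambda>U. X - Q\<inverse> `` (X - U)), mha_ex = (\<lambda>U. Q `` U)\<rparr>)"

definition mipc_alg_arr ::
    "('x mipc_frame, 'y mipc_frame, 'x, 'y) arrow \<Rightarrow> ('y set mha, 'x set mha, 'y set, 'x set) arrow" where
  "mipc_alg_arr f = \<lparr>src = mipc_alg (tgt f), tgt = mipc_alg (src f),
    app = (\<lambda>U\<in>carrier (mipc_alg (tgt f)). app f -` U \<inter> topspace (mipc_space (src f)))\<rparr>"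

definition ms4_alg :: "'y ms4_frame \<Rightarrow> 'y set ms4" where
  "ms4_alg G = (let Y = topspace (ms4_space G); R = ms4_R G; E = ms4_E G in
    \<lparr>carrier = {U. clopen_in (ms4_space G) U}, eq = (=), le = (\<subseteq>),
     neg = (\<lambda>U. Y - U),
     box = (\<lambda>U. Y - R\<inverse> `` (Y - U)), ms4_all = (\<lambda>U. Y - E `` (Y - U))\<rparr>)"

definition ms4_alg_arr ::
    "('x ms4_frame, 'y ms4_frame, 'x, 'y) arrow \<Rightarrow> ('y set ms4, 'x set ms4, 'y set, 'x set) arrow" where
  "ms4_alg_arr f = \<lparr>src = ms4_alg (tgt f), tgt = ms4_alg (src f),
    app = (\<lambda>U\<in>carrier (ms4_alg (tgt f)). app f -` U \<inter> topspace (ms4_space (src f)))\<rparr>"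

definition quotient_topology :: "'x topology \<Rightarrow> ('x \<Rightarrow> 'y) \<Rightarrow> 'y topology" where
  "quotient_topology T p =
    topology (\<lambda>U. U \<subseteq> p ` topspace T \<and> openin T {x \<in> topspace T. p x \<in> U})"

lemma openin_quotient_topology:
  "openin (quotient_topology T p) U \<longleftrightarrow> U \<subseteq> p ` topspace T \<and> openin T {x \<in> topspace T. p x \<in> U}"
proof -
  have "istopology (\<lambda>U. U \<subseteq> p ` topspace T \<and> openin T {x \<in> topspace T. p x \<in> U})"
    unfolding istopology_def
  proof (intro conjI allI impI)
    fix S U
    assume S: "S \<subseteq> p ` topspace T \<and> openin T {x \<in> topspace T. p x \<in> S}"
      and U: "U \<subseteq> p ` topspace T \<and> openin T {x \<in> topspace T. p x \<in> U}"
    show "S \<inter> U \<subseteq> p ` topspace T" using S by blast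
    have "{x \<in> topspace T. p x \<in> S \<inter> U} = {x \<in> topspace T. p x \<in> S} \<inter> {x \<in> topspace T. p x \<in> U}"
      by blast
    then show "openin T {x \<in> topspace T. p x \<in> S \<inter> U}" using S U by (simp add: openin_Int)
  next
    fix K
    assume K: "\<forall>S\<in>K. S \<subseteq> p ` topspace T \<and> openin T {x \<in> topspace T. p x \<in> S}"
    then show "\<Union>K \<subseteq> p ` topspace T" by blast
    have "{x \<in> topspace T. p x \<in> \<Union>K} = (\<Union>S\<in>K. {x \<in> topspace T. p x \<in> S})" by blast
    then show "openin T {x \<in> topspace T. p x \<in> \<Union>K}" using K by auto
  qed
  then show ?thesis by (simp add: quotient_topology_def topology_inverse')
qed

lemma topspace_quotient_topology: "topspace (quotient_topology T p) = p ` topspace T"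
proof
  show "topspace (quotient_topology T p) \<subseteq> p ` topspace T"
    using openin_topspace[of "quotient_topology T p"] by (simp only: openin_quotient_topology)
  have "{x \<in> topspace T. p x \<in> p ` topspace T} = topspace T" by blast
  then have "openin (quotient_topology T p) (p ` topspace T)"
    by (simp add: openin_quotient_topology)
  then show "p ` topspace T \<subseteq> topspace (quotient_topology T p)" by (rule openin_subset)
qed

lemma quotient_map_quotient_topology: "quotient_map T (quotient_topology T p) p"
  by (simp add: quotient_map_def topspace_quotient_topology openin_quotient_topology)

definition skel_proj :: "'y ms4_frame \<Rightarrow> 'y \<Rightarrow> 'y set" where
  "skel_proj G x = sym_part (ms4_R G) `` {x}"

text \<open>
  The relational product \<open>R O E\<close> of HOL goes along \<open>R\<close> first; it is written \<open>E \<circ> R\<close> in functional order.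
\<close>

definition skel :: "'y ms4_frame \<Rightarrow> 'y set mipc_frame" where
  "skel G = \<lparr>
    mipc_space = quotient_topology (ms4_space G) (skel_proj G),
    mipc_R = {(skel_proj G x, skel_proj G y) |x y. (x, y) \<in> ms4_R G},
    mipc_Q = {(skel_proj G x, skel_proj G y) |x y. (x, y) \<in> ms4_R G O ms4_E G}\<rparr>"

text \<open>
  On a class \<open>c\<close>, \<open>\<rho>(f)\<close> is the common value of \<open>\<pi>\<^sub>2(f(x))\<close> for \<open>x \<in> c\<close>.
\<close>

definition skel_arr ::
    "('x ms4_frame, 'y ms4_frame, 'x, 'y) arrow \<Rightarrow> ('x set mipc_frame, 'y set mipc_frame, 'x set, 'y set) arrow" where
  "skel_arr f = \<lparr>src = skel (src f), tgt = skel (tgt f),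
    app = (\<lambda>c\<in>topspace (mipc_space (skel (src f))).
      the_elem ((\<lambda>x. skel_proj (tgt f) (app f x)) ` c))\<rparr>"

end

theory Submission
  imports Defs
begin

text \<open>
  Both halves rest on one observation. An MS4-frame \<open>(Y, R, E)\<close> is, with \<open>Q = E \<circ> R\<close>, already an
  MIPC-frame in every respect except that \<open>R\<close> is only a preorder (\<open>quasi_mipc_frame_unreduced\<close>). The
  skeleton merely collapses \<open>R\<close> to a partial order. The clopen \<open>R\<close>-upsets of \<open>Y\<close> correspond
  to those of the collapsed space, because an \<open>R\<close>-upset is a union of \<open>E\<^sub>R\<close>-classes.

  \<^bold>\<open>Uniqueness of the collapse.\<close> A surjection \<open>p\<close> from a preordered frame that is a topological
  quotient map, reflects both relations and identifies the points of each \<open>E\<^sub>R\<close>-class (locale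
  \<open>mipc_quotient\<close>) makes its target a descriptive MIPC-frame, and morphisms descend along two such surjections (\<open>mipc_mor_descends\<close>). So any two
  quotients of this kind of the same frame are isomorphic. The projection onto the skeleton is one of
  them. For an MS4-algebra \<open>B\<close> with algebra of open elements \<open>H\<close>, the map \<open>y \<mapsto> y \<inter> H\<close> from ultrafilters
  of \<open>B\<close> to prime filters of \<open>H\<close> is another (\<open>mipc_quotient_trace\<close>). This gives the isomorphism
  \<open>\<rho>(B\<^sub>*) \<cong> \<O>(B)\<^sub>*\<close>, together with the fact that \<open>\<O>(B)\<^sub>*\<close> is a descriptive MIPC-frame at all: only this
  instance of the duality for monadic Heyting algebras enters.

  \<^bold>\<open>Algebras of clopen upsets.\<close> The clopen upsets of a preordered frame form a monadic Heyting
  algebra, and preimages along morphisms are homomorphisms (\<open>mha_hom_preimage\<close>). Both \<open>\<rho>(G)\<^sup>*\<close> and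
  \<open>\<O>(G\<^sup>*)\<close> are algebras of this kind, over the skeleton and over \<open>G\<close> itself, and the preimage along the
  projection onto the skeleton is the isomorphism between them.

  \<^bold>\<open>Ultrafilters.\<close> Everything about the space of ultrafilters (compactness, continuity of the dual
  relations, the frame condition, the back condition for morphisms, surjectivity of the trace map
  and the description of \<open>Q\<close>) comes from one separation principle: a filter disjoint from a nonempty
  set closed under joins extends to an ultrafilter that is still disjoint from it (\<open>ultrafilter_avoiding\<close>).
\<close>

section \<open>Clopen sets in Stone spaces\<close>

lemma clopen_in_subset: "clopen_in T U \<Longrightarrow> U \<subseteq> topspace T"
  by (simp add: clopen_in_def closedin_subset)

lemma clopen_in_empty: "clopen_in T {}"
  and clopen_in_topspace: "clopen_in T (topspace T)"
  and clopen_in_Int: "clopen_in T U \<Longrightarrow> clopen_in T V \<Longrightarrow> clopen_in T (U \<inter> V)"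
  and clopen_in_Un: "clopen_in T U \<Longrightarrow> clopen_in T V \<Longrightarrow> clopen_in T (U \<union> V)"
  and clopen_in_Diff: "clopen_in T U \<Longrightarrow> clopen_in T V \<Longrightarrow> clopen_in T (U - V)"
  by (auto simp: clopen_in_def closedin_diff)

lemma clopen_in_compl: "clopen_in T U \<Longrightarrow> clopen_in T (topspace T - U)"
  by (simp add: clopen_in_Diff clopen_in_topspace)

lemma clopen_in_preimage:
  assumes "continuous_map S T f" "clopen_in T U"
  shows "clopen_in S {x \<in> topspace S. f x \<in> U}"
  using assms by (auto simp: clopen_in_def openin_continuous_map_preimage closedin_continuous_map_preimage)

lemma closedin_quotient:
  assumes "quotient_map S T f" "U \<subseteq> topspace T"
  shows "closedin T U \<longleftrightarrow> closedin S {x \<in> topspace S. f x \<in> U}"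
  using assms by (simp add: quotient_map_closedin)

lemma clopen_in_quotient:
  assumes "quotient_map S T f"
  shows "clopen_in T U \<longleftrightarrow> U \<subseteq> topspace T \<and> clopen_in S {x \<in> topspace S. f x \<in> U}"
proof (cases "U \<subseteq> topspace T")
  case True
  then show ?thesis
    using assms closedin_quotient[OF assms True] by (simp add: clopen_in_def quotient_map_def)
next
  case False
  then show ?thesis using clopen_in_subset by blast
qed

text \<open>
  Clopen sets separating points suffice: for a neighbourhood \<open>W\<close> of \<open>x\<close>, finitely many clopen sets
  missing \<open>x\<close> cover the compact complement of \<open>W\<close>, and the complement of their union is a clopen
  neighbourhood of \<open>x\<close> inside \<open>W\<close>.
\<close>

lemma Stone_space_if_clopens_separate:
  assumes compact: "compact_space T"
    and separate: "\<And>x y. \<lbrakk>x \<in> topspace T; y \<in> topspace T; x \<noteq> y\<rbrakk> \<Longrightarrow> \<exists>U. clopen_in T U \<and> x \<in> U \<and> y \<notin> U"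
  shows "Stone_space T"
  unfolding Stone_space_def
proof (intro conjI compact)
  show "Hausdorff_space T"
    unfolding Hausdorff_space_def
  proof (intro allI impI)
    fix x y assume xy: "x \<in> topspace T \<and> y \<in> topspace T \<and> x \<noteq> y"
    then obtain U where "clopen_in T U" "x \<in> U" "y \<notin> U" using separate by blast
    then show "\<exists>U V. openin T U \<and> openin T V \<and> x \<in> U \<and> y \<in> V \<and> disjnt U V"
      using xy by (intro exI[of _ U] exI[of _ "topspace T - U"]) (auto simp: clopen_in_def disjnt_def)
  qed
  show "neighbourhood_base_of (clopen_in T) T"
  proof (subst open_neighbourhood_base_of)
    show "\<forall>S. clopen_in T S \<longrightarrow> openin T S" by (simp add: clopen_in_def)
    show "\<forall>W x. openin T W \<and> x \<in> W \<longrightarrow> (\<exists>U. clopen_in T U \<and> x \<in> U \<and> U \<subseteq> W)"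
    proof (intro allI impI)
      fix W x assume W: "openin T W \<and> x \<in> W"
      then have x: "x \<in> topspace T" using openin_subset by blast
      have "compactin T (topspace T - W)"
        using W by (intro closedin_compact_space[OF compact]) (simp add: closedin_diff)
      moreover have "topspace T - W \<subseteq> \<Union>{V. clopen_in T V \<and> x \<notin> V}"
        using separate x W by blast
      ultimately obtain C where C: "finite C" "C \<subseteq> {V. clopen_in T V \<and> x \<notin> V}" "topspace T - W \<subseteq> \<Union>C"
        by (metis (no_types, lifting) clopen_in_def compactinD mem_Collect_eq)
      from C(1,2) have "clopen_in T (\<Union>C)"
        by (induction C rule: finite_induct) (auto simp: clopen_in_empty clopen_in_Un intro: clopen_in_def)
      then have "clopen_in T (topspace T - \<Union>C)" by (rule clopen_in_compl)
      then show "\<exists>U. clopen_in T U \<and> x \<in> U \<and> U \<subseteq> W" using C x by blast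
    qed
  qed
qed

lemma Stone_space_clopen_separation:
  assumes "Stone_space T" "closedin T C" "closedin T D" "C \<inter> D = {}"
  obtains U where "clopen_in T U" "C \<subseteq> U" "U \<inter> D = {}"
proof -
  have "compactin T C"
    using assms by (simp add: Stone_space_def closedin_compact_space)
  moreover have "C \<subseteq> \<Union>{U. clopen_in T U \<and> U \<inter> D = {}}"
  proof
    fix x assume "x \<in> C"
    then have "x \<in> topspace T - D" "openin T (topspace T - D)"
      using assms closedin_subset by fastforce+
    moreover have "\<forall>S. clopen_in T S \<longrightarrow> openin T S" by (simp add: clopen_in_def)
    ultimately obtain U where "clopen_in T U" "x \<in> U" "U \<subseteq> topspace T - D"
      using assms(1) unfolding Stone_space_def by (metis open_neighbourhood_base_of)
    then show "x \<in> \<Union>{U. clopen_in T U \<and> U \<inter> D = {}}" by blast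
  qed
  ultimately obtain K where K: "finite K" "K \<subseteq> {U. clopen_in T U \<and> U \<inter> D = {}}" "C \<subseteq> \<Union>K"
    by (metis (no_types, lifting) clopen_in_def compactinD mem_Collect_eq)
  from K(1,2) have "clopen_in T (\<Union>K)"
    by (induction K rule: finite_induct) (auto simp: clopen_in_empty clopen_in_Un)
  moreover have "\<Union>K \<inter> D = {}" using K(2) by blast
  ultimately show thesis using K(3) by (intro that)
qed

section \<open>Frames with a preorder in place of the partial order\<close>

text \<open>
  The axioms of a descriptive MIPC-frame with antisymmetry of \<open>R\<close> dropped. The underlying data stay a
  record of MIPC-frames, so that the notion of morphism applies to preordered frames unchanged.
\<close>

locale quasi_mipc_frame =
  fixes F :: "'x mipc_frame"
  assumes Stone: "Stone_space (mipc_space F)"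
    and R_preorder: "preorder_on (topspace (mipc_space F)) (mipc_R F)"
    and R_continuous: "continuous_relation (mipc_space F) (mipc_R F)"
    and Q_preorder: "preorder_on (topspace (mipc_space F)) (mipc_Q F)"
    and Q_continuous: "continuous_relation (mipc_space F) (mipc_Q F)"
    and Q_upset: "clopen_upset (mipc_space F) (mipc_R F) U \<Longrightarrow>
      clopen_upset (mipc_space F) (mipc_R F) (mipc_Q F `` U)"
    and R_sub_Q: "mipc_R F \<subseteq> mipc_Q F"
    and Q_factor: "(x, y) \<in> mipc_Q F \<Longrightarrow> \<exists>z. (x, z) \<in> mipc_R F \<and> (z, y) \<in> sym_part (mipc_Q F)"
begin

abbreviation "X \<equiv> topspace (mipc_space F)"

lemma R_carrier: "mipc_R F \<subseteq> X \<times> X" and Q_carrier: "mipc_Q F \<subseteq> X \<times> X"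
  using R_continuous Q_continuous by (auto simp: continuous_relation_def)

lemma R_refl: "x \<in> X \<Longrightarrow> (x, x) \<in> mipc_R F" and Q_refl: "x \<in> X \<Longrightarrow> (x, x) \<in> mipc_Q F"
  using R_preorder Q_preorder by (auto simp: preorder_on_def refl_on_def)

lemma R_trans: "(x, y) \<in> mipc_R F \<Longrightarrow> (y, z) \<in> mipc_R F \<Longrightarrow> (x, z) \<in> mipc_R F"
  and Q_trans: "(x, y) \<in> mipc_Q F \<Longrightarrow> (y, z) \<in> mipc_Q F \<Longrightarrow> (x, z) \<in> mipc_Q F"
  using R_preorder Q_preorder by (auto simp: preorder_on_def intro: transD)

lemma R_inverse_clopen: "clopen_in (mipc_space F) U \<Longrightarrow> clopen_in (mipc_space F) ((mipc_R F)\<inverse> `` U)"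
  and Q_inverse_clopen: "clopen_in (mipc_space F) U \<Longrightarrow> clopen_in (mipc_space F) ((mipc_Q F)\<inverse> `` U)"
  using R_continuous Q_continuous by (auto simp: continuous_relation_def)

text \<open>
  The Priestley separation property. Since \<open>R[x]\<close> is closed and misses \<open>y\<close>, there is a clopen
  neighbourhood \<open>V\<close> of \<open>y\<close> disjoint from it. The complement of the clopen downset \<open>R\<inverse>[V]\<close>
  is the required upset.
\<close>

lemma clopen_upset_separation:
  assumes x: "x \<in> X" and y: "y \<in> X" and xy: "(x, y) \<notin> mipc_R F"
  obtains U where "clopen_upset (mipc_space F) (mipc_R F) U" "x \<in> U" "y \<notin> U"
proof -
  have "openin (mipc_space F) (X - mipc_R F `` {x})"
    using R_continuous x by (simp add: continuous_relation_def closedin_def)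
  moreover have "y \<in> X - mipc_R F `` {x}" using y xy by blast
  moreover have "\<forall>S. clopen_in (mipc_space F) S \<longrightarrow> openin (mipc_space F) S" by (simp add: clopen_in_def)
  ultimately obtain V where V: "clopen_in (mipc_space F) V" "y \<in> V" "V \<subseteq> X - mipc_R F `` {x}"
    using Stone unfolding Stone_space_def by (metis open_neighbourhood_base_of)
  show thesis
  proof (rule that)
    show "clopen_upset (mipc_space F) (mipc_R F) (X - (mipc_R F)\<inverse> `` V)"
      unfolding clopen_upset_def
      using R_inverse_clopen[OF V(1)] R_carrier by (auto intro: clopen_in_compl R_trans)
    show "x \<in> X - (mipc_R F)\<inverse> `` V" using V x by blast
    show "y \<notin> X - (mipc_R F)\<inverse> `` V" using V R_refl y by blast
  qed
qed

end

lemma (in descriptive_mipc_frame) quasi_mipc_frame: "quasi_mipc_frame F"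
  using Stone R_order R_continuous Q_order Q_continuous Q_upset R_sub_Q Q_factor
  by unfold_locales (auto simp: partial_order_on_def)

text \<open>
  The identity is a morphism because \<open>R\<inverse>[Q\<inverse>[x]] = Q\<inverse>[x]\<close>, so the third morphism condition holds.
\<close>

lemma quasi_mipc_frame_id_mor:
  assumes "quasi_mipc_frame F"
  shows "mipc_mor F F (\<lambda>x\<in>topspace (mipc_space F). x)"
proof -
  interpret quasi_mipc_frame F by (rule assms)
  have r: "(\<lambda>x\<in>X. x) ` A = A" if "A \<subseteq> X" for A using that by force
  show ?thesis
    unfolding mipc_mor_def
  proof (intro conjI ballI)
    show "continuous_map (mipc_space F) (mipc_space F) (\<lambda>x\<in>X. x)"
      by (rule continuous_map_eq[OF continuous_map_id]) simp
    fix x assume x: "x \<in> X"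
    have sub: "mipc_R F `` {x} \<subseteq> X" "mipc_Q F `` {x} \<subseteq> X" "(mipc_Q F)\<inverse> `` {x} \<subseteq> X"
      using R_carrier Q_carrier by auto
    have "(mipc_R F)\<inverse> `` ((mipc_Q F)\<inverse> `` {x}) = (mipc_Q F)\<inverse> `` {x}"
      using Q_trans R_sub_Q R_refl Q_carrier by blast
    moreover have "(\<lambda>x\<in>X. x) x = x" using x by simp
    ultimately show "mipc_R F `` {(\<lambda>x\<in>X. x) x} = (\<lambda>x\<in>X. x) ` (mipc_R F `` {x})"
      "mipc_Q F `` {(\<lambda>x\<in>X. x) x} = (\<lambda>x\<in>X. x) ` (mipc_Q F `` {x})"
      "(mipc_Q F)\<inverse> `` {(\<lambda>x\<in>X. x) x} = (mipc_R F)\<inverse> `` ((\<lambda>x\<in>X. x) ` ((mipc_Q F)\<inverse> `` {x}))"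
      by (simp_all only: r[OF sub(1)] r[OF sub(2)] r[OF sub(3)])
  qed simp
qed

section \<open>Quotients collapsing the preorder\<close>

lemma Image_reflecting:
  assumes "p ` X = X'" "S \<subseteq> X \<times> X" "S' \<subseteq> X' \<times> X'" "A \<subseteq> X"
    and "\<And>x y. x \<in> X \<Longrightarrow> y \<in> X \<Longrightarrow> (p x, p y) \<in> S' \<longleftrightarrow> (x, y) \<in> S"
  shows "S' `` (p ` A) = p ` (S `` A)"
proof
  show "S' `` (p ` A) \<subseteq> p ` (S `` A)"
  proof
    fix z assume "z \<in> S' `` (p ` A)"
    then obtain a where a: "a \<in> A" "(p a, z) \<in> S'" by blast
    then obtain y where "y \<in> X" "z = p y" using assms(1,3) by blast
    then show "z \<in> p ` (S `` A)" using a assms(4,5) by blast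
  qed
  show "p ` (S `` A) \<subseteq> S' `` (p ` A)" using assms by blast
qed

lemma preimage_Image_reflecting:
  assumes "p ` X = X'" "S \<subseteq> X \<times> X" "S' \<subseteq> X' \<times> X'"
    and "\<And>x y. x \<in> X \<Longrightarrow> y \<in> X \<Longrightarrow> (p x, p y) \<in> S' \<longleftrightarrow> (x, y) \<in> S"
  shows "{x \<in> X. p x \<in> S' `` U} = S `` {x \<in> X. p x \<in> U}"
proof
  show "{x \<in> X. p x \<in> S' `` U} \<subseteq> S `` {x \<in> X. p x \<in> U}"
  proof
    fix x assume "x \<in> {x \<in> X. p x \<in> S' `` U}"
    then obtain v where v: "x \<in> X" "v \<in> U" "(v, p x) \<in> S'" by blast
    then obtain y where "y \<in> X" "v = p y" using assms(1,3) by blast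
    then show "x \<in> S `` {x \<in> X. p x \<in> U}" using v assms(4) by blast
  qed
  show "S `` {x \<in> X. p x \<in> U} \<subseteq> {x \<in> X. p x \<in> S' `` U}" using assms(2,4) by blast
qed

text \<open>
  The map \<open>p\<close> presents \<open>F'\<close> as the collapse of \<open>F\<close>. By reflection and reflexivity of \<open>R\<close>, points with the
  same image lie in one class of \<open>R \<inter> R\<inverse>\<close>; the kernel condition is the converse, and it makes \<open>R\<close> on
  \<open>F'\<close> antisymmetric. Reflection is assumed instead of \<open>R\<close> on \<open>F'\<close> being
  the image of \<open>R\<close>, since it can be checked directly when \<open>F'\<close> is given in advance.
\<close>

locale mipc_quotient = quasi_mipc_frame F for F :: "'x mipc_frame" +
  fixes F' :: "'y mipc_frame" and p :: "'x \<Rightarrow> 'y"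
  assumes quot: "quotient_map (mipc_space F) (mipc_space F') p"
    and R'_carrier: "mipc_R F' \<subseteq> topspace (mipc_space F') \<times> topspace (mipc_space F')"
    and Q'_carrier: "mipc_Q F' \<subseteq> topspace (mipc_space F') \<times> topspace (mipc_space F')"
    and R'_iff: "\<lbrakk>x \<in> topspace (mipc_space F); y \<in> topspace (mipc_space F)\<rbrakk> \<Longrightarrow>
      (p x, p y) \<in> mipc_R F' \<longleftrightarrow> (x, y) \<in> mipc_R F"
    and Q'_iff: "\<lbrakk>x \<in> topspace (mipc_space F); y \<in> topspace (mipc_space F)\<rbrakk> \<Longrightarrow>
      (p x, p y) \<in> mipc_Q F' \<longleftrightarrow> (x, y) \<in> mipc_Q F"
    and kernel: "\<lbrakk>(x, y) \<in> mipc_R F; (y, x) \<in> mipc_R F\<rbrakk> \<Longrightarrow> p x = p y"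
begin

abbreviation "X' \<equiv> topspace (mipc_space F')"
abbreviation "pre U \<equiv> {x \<in> X. p x \<in> U}"

lemma surj: "p ` X = X'"
  using quot by (rule quotient_imp_surjective_map)

lemma R'_image: "A \<subseteq> X \<Longrightarrow> mipc_R F' `` (p ` A) = p ` (mipc_R F `` A)"
  and Q'_image: "A \<subseteq> X \<Longrightarrow> mipc_Q F' `` (p ` A) = p ` (mipc_Q F `` A)"
  and R'_inverse_image: "A \<subseteq> X \<Longrightarrow> (mipc_R F')\<inverse> `` (p ` A) = p ` ((mipc_R F)\<inverse> `` A)"
  and Q'_inverse_image: "A \<subseteq> X \<Longrightarrow> (mipc_Q F')\<inverse> `` (p ` A) = p ` ((mipc_Q F)\<inverse> `` A)"
  by (rule Image_reflecting[OF surj]; use R'_carrier Q'_carrier R_carrier Q_carrier R'_iff Q'_iff in auto)+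

lemma X'E: assumes "u \<in> X'" obtains x where "x \<in> X" "u = p x"
  using assms surj by blast

lemma pairE:
  assumes "(u, v) \<in> S" "S \<subseteq> X' \<times> X'"
  obtains x y where "x \<in> X" "y \<in> X" "u = p x" "v = p y"
proof -
  have "u \<in> X'" "v \<in> X'" using assms by blast+
  then show thesis using that by (blast elim: X'E)
qed

lemma pre_R: "x \<in> X \<Longrightarrow> pre (mipc_R F' `` {p x}) = mipc_R F `` {x}"
  and pre_Q: "x \<in> X \<Longrightarrow> pre (mipc_Q F' `` {p x}) = mipc_Q F `` {x}"
  using R_carrier Q_carrier by (auto simp: R'_iff Q'_iff)

lemma pre_R_image: "pre (mipc_R F' `` U) = mipc_R F `` pre U"
  and pre_Q_image: "pre (mipc_Q F' `` U) = mipc_Q F `` pre U"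
  and pre_R_inverse: "pre ((mipc_R F')\<inverse> `` U) = (mipc_R F)\<inverse> `` pre U"
  and pre_Q_inverse: "pre ((mipc_Q F')\<inverse> `` U) = (mipc_Q F)\<inverse> `` pre U"
  by (rule preimage_Image_reflecting[OF surj]; use R'_carrier Q'_carrier R_carrier Q_carrier R'_iff Q'_iff in auto)+

lemma p_image_pre: "U \<subseteq> X' \<Longrightarrow> p ` pre U = U"
  using surj by auto

lemma subset_if_pre_subset: "U \<subseteq> X' \<Longrightarrow> pre U \<subseteq> pre V \<Longrightarrow> U \<subseteq> V"
  by (rule subsetI, frule (1) subsetD, erule X'E) blast

lemma clopen'_iff: "clopen_in (mipc_space F') U \<longleftrightarrow> U \<subseteq> X' \<and> clopen_in (mipc_space F) (pre U)"
  using quot by (rule clopen_in_quotient)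

lemma clopen_upset'_iff:
  "clopen_upset (mipc_space F') (mipc_R F') U \<longleftrightarrow>
    U \<subseteq> X' \<and> clopen_upset (mipc_space F) (mipc_R F) (pre U)"
proof -
  have "mipc_R F' `` U \<subseteq> X'" using R'_carrier by blast
  then have "mipc_R F' `` U \<subseteq> U \<longleftrightarrow> pre (mipc_R F' `` U) \<subseteq> pre U"
    using subset_if_pre_subset by blast
  then show ?thesis by (auto simp: clopen_upset_def clopen'_iff pre_R_image)
qed

text \<open>
  Upsets are saturated: if \<open>p x = p y\<close> and \<open>y \<in> U\<close>, then \<open>y R x\<close> by reflection, so \<open>x \<in> U\<close>. Hence the
  clopen upsets of \<open>F\<close> and of \<open>F'\<close> correspond.
\<close>

lemma pre_p_image:
  assumes "clopen_upset (mipc_space F) (mipc_R F) U"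
  shows "pre (p ` U) = U"
proof
  show "U \<subseteq> pre (p ` U)" using assms by (auto simp: clopen_upset_def dest: clopen_in_subset)
  show "pre (p ` U) \<subseteq> U"
  proof
    fix x assume "x \<in> pre (p ` U)"
    then obtain y where y: "y \<in> U" "p x = p y" "x \<in> X" by blast
    then have "y \<in> X" using assms by (auto simp: clopen_upset_def dest: clopen_in_subset)
    then have "(y, x) \<in> mipc_R F" using R'_iff[of y x] R'_iff[of y y] y R_refl by auto
    then show "x \<in> U" using assms y by (auto simp: clopen_upset_def)
  qed
qed

lemma p_image_clopen_upset:
  assumes "clopen_upset (mipc_space F) (mipc_R F) U"
  shows "clopen_upset (mipc_space F') (mipc_R F') (p ` U)"
proof -
  have "U \<subseteq> X" using assms by (auto simp: clopen_upset_def dest: clopen_in_subset)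
  then have "p ` U \<subseteq> X'" using surj by blast
  then show ?thesis using assms by (simp only: clopen_upset'_iff pre_p_image[OF assms])
qed

text \<open>
  If \<open>x\<close> and \<open>y\<close> have different images, then one of \<open>x R y\<close>, \<open>y R x\<close> fails. A separating clopen upset
  of \<open>F\<close> is saturated and so separates the images.
\<close>

lemma Stone': "Stone_space (mipc_space F')"
proof (rule Stone_space_if_clopens_separate)
  have "compactin (mipc_space F') (p ` X)"
    using Stone quot unfolding Stone_space_def compact_space_def
    by (metis image_compactin quotient_imp_continuous_map)
  then show "compact_space (mipc_space F')" by (simp add: surj compact_space_def)
next
  fix u v assume uv: "u \<in> X'" "v \<in> X'" "u \<noteq> v"
  then obtain x y where xy: "x \<in> X" "u = p x" "y \<in> X" "v = p y" by (blast elim: X'E)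
  have sep: "\<exists>U. clopen_in (mipc_space F') U \<and> p a \<in> U \<and> p b \<notin> U"
    if ab: "a \<in> X" "b \<in> X" "(a, b) \<notin> mipc_R F" for a b
  proof -
    obtain U where U: "clopen_upset (mipc_space F) (mipc_R F) U" "a \<in> U" "b \<notin> U"
      using clopen_upset_separation[OF ab] by blast
    then have "p b \<notin> p ` U" using pre_p_image[OF U(1)] ab(2) by blast
    then show ?thesis using U p_image_clopen_upset[OF U(1)] by (auto simp: clopen_upset_def)
  qed
  show "\<exists>U. clopen_in (mipc_space F') U \<and> u \<in> U \<and> v \<notin> U"
  proof (cases "(x, y) \<in> mipc_R F")
    case True
    then have "(y, x) \<notin> mipc_R F" using kernel uv(3) xy by blast
    then obtain U where "clopen_in (mipc_space F') U" "v \<in> U" "u \<notin> U" using sep xy by blast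
    then show ?thesis using uv by (intro exI[of _ "X' - U"]) (auto intro: clopen_in_compl)
  qed (use sep xy in blast)
qed

text \<open>
  Each axiom transfers because preimages under \<open>p\<close> commute with images along the relations.
\<close>

theorem descriptive: "descriptive_mipc_frame F'"
proof
  show "Stone_space (mipc_space F')" by (rule Stone')
  have trans': "trans (mipc_R F')" "trans (mipc_Q F')"
  proof (safe intro!: transI)
    fix u v w assume uv: "(u, v) \<in> mipc_R F'" and vw: "(v, w) \<in> mipc_R F'"
    obtain x y where "x \<in> X" "y \<in> X" "u = p x" "v = p y" using uv R'_carrier by (rule pairE)
    moreover obtain z where "z \<in> X" "w = p z" using vw R'_carrier by (rule pairE)
    ultimately show "(u, w) \<in> mipc_R F'" using uv vw R'_iff R_trans by blast
  next
    fix u v w assume uv: "(u, v) \<in> mipc_Q F'" and vw: "(v, w) \<in> mipc_Q F'"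
    obtain x y where "x \<in> X" "y \<in> X" "u = p x" "v = p y" using uv Q'_carrier by (rule pairE)
    moreover obtain z where "z \<in> X" "w = p z" using vw Q'_carrier by (rule pairE)
    ultimately show "(u, w) \<in> mipc_Q F'" using uv vw Q'_iff Q_trans by blast
  qed
  have "antisym (mipc_R F')"
  proof (rule antisymI)
    fix u v assume uv: "(u, v) \<in> mipc_R F'" "(v, u) \<in> mipc_R F'"
    obtain x y where "x \<in> X" "y \<in> X" "u = p x" "v = p y" using uv(1) R'_carrier by (rule pairE)
    then show "u = v" using uv R'_iff kernel by blast
  qed
  moreover have "refl_on X' (mipc_R F')" "refl_on X' (mipc_Q F')"
    using R'_iff Q'_iff R_refl Q_refl by (auto simp: refl_on_def elim!: X'E)
  ultimately show "partial_order_on X' (mipc_R F')" "preorder_on X' (mipc_Q F')"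
    using trans' R'_carrier Q'_carrier by (auto simp: partial_order_on_def preorder_on_def)
  have "closedin (mipc_space F') (mipc_R F' `` {u}) \<and> closedin (mipc_space F') (mipc_Q F' `` {u})"
    if "u \<in> X'" for u
  proof -
    obtain x where x: "x \<in> X" "u = p x" using \<open>u \<in> X'\<close> by (rule X'E)
    have "mipc_R F' `` {u} \<subseteq> X'" "mipc_Q F' `` {u} \<subseteq> X'" using R'_carrier Q'_carrier by auto
    moreover have "closedin (mipc_space F) (pre (mipc_R F' `` {u}))"
      "closedin (mipc_space F) (pre (mipc_Q F' `` {u}))"
      using x R_continuous Q_continuous unfolding x(2) pre_R[OF x(1)] pre_Q[OF x(1)]
      by (simp_all add: continuous_relation_def)
    ultimately show ?thesis by (simp only: closedin_quotient[OF quot])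
  qed
  moreover have "clopen_in (mipc_space F') ((mipc_R F')\<inverse> `` U) \<and> clopen_in (mipc_space F') ((mipc_Q F')\<inverse> `` U)"
    if "clopen_in (mipc_space F') U" for U
    using that R'_carrier Q'_carrier R_inverse_clopen Q_inverse_clopen
    unfolding clopen'_iff pre_R_inverse pre_Q_inverse by blast
  ultimately show "continuous_relation (mipc_space F') (mipc_R F')"
    "continuous_relation (mipc_space F') (mipc_Q F')"
    using R'_carrier Q'_carrier by (auto simp: continuous_relation_def)
  show "clopen_upset (mipc_space F') (mipc_R F') (mipc_Q F' `` U)"
    if "clopen_upset (mipc_space F') (mipc_R F') U" for U
    using that Q_upset Q'_carrier unfolding clopen_upset'_iff pre_Q_image by blast
  show "mipc_R F' \<subseteq> mipc_Q F'"
  proof (rule subrelI)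
    fix u v assume uv: "(u, v) \<in> mipc_R F'"
    obtain x y where "x \<in> X" "y \<in> X" "u = p x" "v = p y" using uv R'_carrier by (rule pairE)
    then show "(u, v) \<in> mipc_Q F'" using uv R'_iff Q'_iff R_sub_Q by blast
  qed
  show "\<exists>z. (u, z) \<in> mipc_R F' \<and> (z, v) \<in> sym_part (mipc_Q F')" if uv: "(u, v) \<in> mipc_Q F'" for u v
  proof -
    obtain x y where xy: "x \<in> X" "y \<in> X" "u = p x" "v = p y"
      using uv Q'_carrier by (rule pairE)
    then have "(x, y) \<in> mipc_Q F" using uv Q'_iff by blast
    then obtain z where "(x, z) \<in> mipc_R F" "(z, y) \<in> sym_part (mipc_Q F)" using Q_factor by blast
    moreover then have "z \<in> X" using R_carrier by blast
    ultimately show ?thesis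
      using xy R'_iff Q'_iff by (intro exI[of _ "p z"]) (auto simp: sym_part_def)
  qed
qed

text \<open>
  The third morphism condition reduces to \<open>R\<inverse>[Q\<inverse>[x]] = Q\<inverse>[x]\<close>, as \<open>p\<close> commutes with inverse images
  along \<open>R\<close> and \<open>Q\<close>.
\<close>

theorem morphism: "mipc_mor F F' (restrict p X)"
  unfolding mipc_mor_def
proof (intro conjI ballI)
  show "continuous_map (mipc_space F) (mipc_space F') (restrict p X)"
    using quotient_imp_continuous_map[OF quot] by (rule continuous_map_eq) simp
next
  fix x assume x: "x \<in> X"
  have sub: "mipc_R F `` A \<subseteq> X" "mipc_Q F `` A \<subseteq> X" "(mipc_Q F)\<inverse> `` A \<subseteq> X" for A
    using R_carrier Q_carrier by auto
  have r: "restrict p X ` A = p ` A" if "A \<subseteq> X" for A using that by (auto simp: image_def)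
  show "mipc_R F' `` {restrict p X x} = restrict p X ` (mipc_R F `` {x})"
    "mipc_Q F' `` {restrict p X x} = restrict p X ` (mipc_Q F `` {x})"
    using x R'_image[of "{x}"] Q'_image[of "{x}"] r sub by simp_all
  have "(mipc_R F)\<inverse> `` ((mipc_Q F)\<inverse> `` {x}) = (mipc_Q F)\<inverse> `` {x}"
    using Q_trans R_sub_Q R_refl Q_carrier by blast
  then show "(mipc_Q F')\<inverse> `` {restrict p X x} = (mipc_R F')\<inverse> `` (restrict p X ` ((mipc_Q F)\<inverse> `` {x}))"
    using x Q'_inverse_image[of "{x}"] r sub R'_inverse_image[of "(mipc_Q F)\<inverse> `` {x}"] by simp
qed simp

end

text \<open>
  With \<open>f\<close> an identity this yields mutually inverse morphisms between any two quotients of one frame;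
  with \<open>p\<^sub>1\<close> and \<open>p\<^sub>2\<close> projections onto skeletons it yields the action of \<open>\<rho>\<close> on morphisms.
\<close>

lemma mipc_mor_descends:
  assumes 1: "mipc_quotient F1 F1' p1" and 2: "mipc_quotient F2 F2' p2"
    and f: "mipc_mor F1 F2 f"
    and ext: "g \<in> extensional (topspace (mipc_space F1'))"
    and g: "\<And>x. x \<in> topspace (mipc_space F1) \<Longrightarrow> g (p1 x) = p2 (f x)"
  shows "mipc_mor F1' F2' g"
proof -
  interpret p1: mipc_quotient F1 F1' p1 by (rule 1)
  interpret p2: mipc_quotient F2 F2' p2 by (rule 2)
  have gp: "g ` p1 ` A = p2 ` f ` A" if "A \<subseteq> p1.X" for A
    using that g by (force simp: image_image)
  have fX: "f x \<in> p2.X" if "x \<in> p1.X" for x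
    using f that by (auto simp: mipc_mor_def continuous_map_def)
  have sub: "mipc_R F1 `` A \<subseteq> p1.X" "mipc_Q F1 `` A \<subseteq> p1.X" "(mipc_Q F1)\<inverse> `` A \<subseteq> p1.X" for A
    using p1.R_carrier p1.Q_carrier by auto
  have "continuous_map (mipc_space F1) (mipc_space F2') (p2 \<circ> f)"
    using f quotient_imp_continuous_map[OF p2.quot] by (auto simp: mipc_mor_def intro: continuous_map_compose)
  then have "continuous_map (mipc_space F1) (mipc_space F2') (g \<circ> p1)"
    by (rule continuous_map_eq) (simp add: g)
  then have cont: "continuous_map (mipc_space F1') (mipc_space F2') g"
    by (rule continuous_compose_quotient_map[OF p1.quot])
  show ?thesis
    unfolding mipc_mor_def
  proof (intro conjI ballI ext cont)
    fix u assume "u \<in> p1.X'"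
    then obtain x where x: "x \<in> p1.X" "u = p1 x" by (rule p1.X'E)
    have fx: "mipc_R F2 `` {f x} = f ` (mipc_R F1 `` {x})" "mipc_Q F2 `` {f x} = f ` (mipc_Q F1 `` {x})"
      "(mipc_Q F2)\<inverse> `` {f x} = (mipc_R F2)\<inverse> `` (f ` ((mipc_Q F1)\<inverse> `` {x}))"
      using f x by (auto simp: mipc_mor_def)
    show "mipc_R F2' `` {g u} = g ` (mipc_R F1' `` {u})"
      using p1.R'_image[of "{x}"] p2.R'_image[of "{f x}"] fX x fx sub by (simp add: g gp)
    show "mipc_Q F2' `` {g u} = g ` (mipc_Q F1' `` {u})"
      using p1.Q'_image[of "{x}"] p2.Q'_image[of "{f x}"] fX x fx sub by (simp add: g gp)
    have "f ` ((mipc_Q F1)\<inverse> `` {x}) \<subseteq> p2.X" using fX sub by blast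
    then show "(mipc_Q F2')\<inverse> `` {g u} = (mipc_R F2')\<inverse> `` (g ` ((mipc_Q F1')\<inverse> `` {u}))"
      using p1.Q'_inverse_image[of "{x}"] p2.Q'_inverse_image[of "{f x}"] fX x fx sub
        p2.R'_inverse_image[of "f ` ((mipc_Q F1)\<inverse> `` {x})"] by (simp add: g gp)
  qed
qed

section \<open>The skeleton of an MS4-frame\<close>

text \<open>
  The MIPC-frame \<open>(Y, R, E \<circ> R)\<close> before \<open>R\<close> is collapsed to a partial order.
\<close>

definition unreduced :: "'y ms4_frame \<Rightarrow> 'y mipc_frame" where
  "unreduced G = \<lparr>mipc_space = ms4_space G, mipc_R = ms4_R G, mipc_Q = ms4_R G O ms4_E G\<rparr>"

lemma unreduced_simps [simp]:
  "mipc_space (unreduced G) = ms4_space G" "mipc_R (unreduced G) = ms4_R G"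
  "mipc_Q (unreduced G) = ms4_R G O ms4_E G"
  by (simp_all add: unreduced_def)

context descriptive_ms4_frame
begin

abbreviation "Y \<equiv> topspace (ms4_space G)"

lemma R_carrier: "ms4_R G \<subseteq> Y \<times> Y" and E_carrier: "ms4_E G \<subseteq> Y \<times> Y"
  using R_continuous E_continuous by (auto simp: continuous_relation_def)

lemma R_refl: "x \<in> Y \<Longrightarrow> (x, x) \<in> ms4_R G" and E_refl: "x \<in> Y \<Longrightarrow> (x, x) \<in> ms4_E G"
  using R_order E_equiv by (auto simp: preorder_on_def equiv_def refl_on_def)

lemma R_trans: "(x, y) \<in> ms4_R G \<Longrightarrow> (y, z) \<in> ms4_R G \<Longrightarrow> (x, z) \<in> ms4_R G"
  and E_trans: "(x, y) \<in> ms4_E G \<Longrightarrow> (y, z) \<in> ms4_E G \<Longrightarrow> (x, z) \<in> ms4_E G"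
  using R_order E_equiv by (auto simp: preorder_on_def equiv_def intro: transD)

lemma E_sym: "(x, y) \<in> ms4_E G \<Longrightarrow> (y, x) \<in> ms4_E G"
  using E_equiv by (auto simp: equiv_def intro: symD)

lemma E_converse: "(ms4_E G)\<inverse> = ms4_E G"
  using E_sym by auto

lemma R_inverse_clopen: "clopen_in (ms4_space G) U \<Longrightarrow> clopen_in (ms4_space G) ((ms4_R G)\<inverse> `` U)"
  and E_clopen: "clopen_in (ms4_space G) U \<Longrightarrow> clopen_in (ms4_space G) (ms4_E G `` U)"
  using R_continuous E_continuous by (auto simp: continuous_relation_def E_converse)

text \<open>
  For compact Hausdorff spaces this is the closedness of images along closed relations; here it
  follows from \<open>E\<close> being symmetric and continuous. If \<open>y \<notin> E[C]\<close>, then \<open>C\<close> and \<open>E[y]\<close> are disjoint closed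
  sets, and a clopen \<open>U\<close> between them gives a clopen set \<open>E[U] \<supseteq> E[C]\<close> without \<open>y\<close>. It is needed for
  \<open>Q[x] = E[R[x]]\<close> to be closed.
\<close>

lemma E_image_closed:
  assumes C: "closedin (ms4_space G) C"
  shows "closedin (ms4_space G) (ms4_E G `` C)"
proof -
  let ?K = "{ms4_E G `` U |U. clopen_in (ms4_space G) U \<and> C \<subseteq> U}"
  have K: "ms4_E G `` Y \<in> ?K" using closedin_subset[OF C] clopen_in_topspace by blast
  have "ms4_E G `` C = \<Inter>?K"
  proof
    show "ms4_E G `` C \<subseteq> \<Inter>?K" by blast
    show "\<Inter>?K \<subseteq> ms4_E G `` C"
    proof
      fix y assume y: "y \<in> \<Inter>?K"
      then have "y \<in> ms4_E G `` Y" using K by (rule InterD)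
      then have "y \<in> Y" using E_carrier by blast
      show "y \<in> ms4_E G `` C"
      proof (rule ccontr)
        assume "y \<notin> ms4_E G `` C"
        then have disj: "C \<inter> ms4_E G `` {y} = {}" using E_sym by blast
        have "closedin (ms4_space G) (ms4_E G `` {y})"
          using E_continuous \<open>y \<in> Y\<close> by (simp add: continuous_relation_def)
        then obtain U where "clopen_in (ms4_space G) U" "C \<subseteq> U" "U \<inter> ms4_E G `` {y} = {}"
          by (rule Stone_space_clopen_separation[OF Stone C _ disj])
        moreover from this have "y \<in> ms4_E G `` U" using y by blast
        ultimately show False using E_sym by blast
      qed
    qed
  qed
  moreover have "?K \<noteq> {}" using K by blast
  moreover have "\<And>S. S \<in> ?K \<Longrightarrow> closedin (ms4_space G) S" using E_clopen by (auto simp: clopen_in_def)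
  ultimately show ?thesis using closedin_Inter[of ?K "ms4_space G"] by simp
qed

lemma Q_image_upset: 
  assumes "ms4_R G `` U \<subseteq> U" "U \<subseteq> Y"
  shows "(ms4_R G O ms4_E G) `` U = ms4_E G `` U"
  using assms R_refl by blast

text \<open>
  The commutation condition of MS4-frames is used twice: it makes \<open>E \<circ> R\<close> transitive, and it makes
  \<open>E[U]\<close> an upset for every upset \<open>U\<close>. On upsets \<open>Q[U] = E[U]\<close>, so \<open>Q\<close> preserves clopen upsets.
\<close>

lemma quasi_mipc_frame_unreduced: "quasi_mipc_frame (unreduced G)"
proof (unfold_locales, simp_all only: unreduced_simps)
  let ?R = "ms4_R G" let ?Q = "ms4_R G O ms4_E G"
  show "Stone_space (ms4_space G)" "preorder_on Y ?R" "continuous_relation (ms4_space G) ?R"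
    by (fact Stone R_order R_continuous)+
  have "trans ?Q"
  proof (rule transI)
    fix x y v assume "(x, y) \<in> ?Q" "(y, v) \<in> ?Q"
    then obtain z w where zw: "(x, z) \<in> ?R" "(z, y) \<in> ms4_E G" "(y, w) \<in> ?R" "(w, v) \<in> ms4_E G" by blast
    then obtain u where "(z, u) \<in> ?R" "(u, w) \<in> ms4_E G" using commute by blast
    then show "(x, v) \<in> ?Q" using zw R_trans E_trans by blast
  qed
  then show "preorder_on Y ?Q"
    using R_carrier E_carrier R_refl E_refl unfolding preorder_on_def refl_on_def by blast
  show "continuous_relation (ms4_space G) ?Q"
    unfolding continuous_relation_def
  proof (intro conjI ballI allI impI)
    show "?Q \<subseteq> Y \<times> Y" using R_carrier E_carrier by blast
    show "closedin (ms4_space G) (?Q `` {x})" if "x \<in> Y" for x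
      using that R_continuous E_image_closed by (simp add: continuous_relation_def relcomp_Image)
    show "clopen_in (ms4_space G) (?Q\<inverse> `` U)" if "clopen_in (ms4_space G) U" for U
      using that E_clopen R_inverse_clopen by (simp add: converse_relcomp E_converse relcomp_Image)
  qed
  show "clopen_upset (ms4_space G) ?R (?Q `` U)" if "clopen_upset (ms4_space G) ?R U" for U
  proof -
    have U: "clopen_in (ms4_space G) U" "?R `` U \<subseteq> U"
      using that by (simp_all add: clopen_upset_def)
    have "U \<subseteq> Y" by (rule clopen_in_subset[OF U(1)])
    have "?R `` (ms4_E G `` U) \<subseteq> ms4_E G `` U"
    proof
      fix z assume "z \<in> ?R `` (ms4_E G `` U)"
      then obtain x y where "x \<in> U" "(x, y) \<in> ms4_E G" "(y, z) \<in> ?R" by blast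
      then show "z \<in> ms4_E G `` U" using commute U(2) by blast
    qed
    then show ?thesis using U \<open>U \<subseteq> Y\<close> E_clopen by (simp add: clopen_upset_def Q_image_upset)
  qed
  show "?R \<subseteq> ?Q" using R_carrier E_refl by blast
  show "\<exists>z. (x, z) \<in> ?R \<and> (z, y) \<in> sym_part ?Q" if "(x, y) \<in> ?Q" for x y
  proof -
    obtain z where z: "(x, z) \<in> ?R" "(z, y) \<in> ms4_E G" using \<open>(x, y) \<in> ?Q\<close> by blast
    then have "z \<in> Y" "y \<in> Y" using E_carrier by auto
    then have "(z, y) \<in> ?Q" "(y, z) \<in> ?Q" using z R_refl E_sym by blast+
    then show ?thesis using z by (auto simp: sym_part_def)
  qed
qed

lemma skel_proj_eq_iff:
  assumes "x \<in> Y" "y \<in> Y"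
  shows "skel_proj G x = skel_proj G y \<longleftrightarrow> (x, y) \<in> ms4_R G \<and> (y, x) \<in> ms4_R G"
proof
  assume "skel_proj G x = skel_proj G y"
  moreover have "x \<in> skel_proj G x" using assms R_refl by (simp add: skel_proj_def sym_part_def)
  ultimately show "(x, y) \<in> ms4_R G \<and> (y, x) \<in> ms4_R G" by (auto simp: skel_proj_def sym_part_def)
qed (auto simp: skel_proj_def sym_part_def intro: R_trans)

lemma skel_proj_self: "x \<in> Y \<Longrightarrow> x \<in> skel_proj G x"
  using R_refl by (simp add: skel_proj_def sym_part_def)

lemma topspace_skel: "topspace (mipc_space (skel G)) = skel_proj G ` Y"
  by (simp add: skel_def topspace_quotient_topology)

lemma mipc_quotient_skel: "mipc_quotient (unreduced G) (skel G) (skel_proj G)"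
proof (rule mipc_quotient.intro[OF quasi_mipc_frame_unreduced], unfold_locales)
  have R: "(skel_proj G x, skel_proj G y) \<in> mipc_R (skel G) \<longleftrightarrow> (x, y) \<in> ms4_R G"
    if xy: "x \<in> Y" "y \<in> Y" for x y
  proof
    assume "(skel_proj G x, skel_proj G y) \<in> mipc_R (skel G)"
    then obtain x' y' where *: "(x', y') \<in> ms4_R G" "skel_proj G x = skel_proj G x'" "skel_proj G y = skel_proj G y'"
      by (auto simp: skel_def)
    moreover then have "x' \<in> Y" "y' \<in> Y" using R_carrier by auto
    ultimately show "(x, y) \<in> ms4_R G" using xy skel_proj_eq_iff R_trans by metis
  qed (auto simp: skel_def)
  have Q: "(skel_proj G x, skel_proj G y) \<in> mipc_Q (skel G) \<longleftrightarrow> (x, y) \<in> ms4_R G O ms4_E G"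
    if xy: "x \<in> Y" "y \<in> Y" for x y
  proof
    interpret q: quasi_mipc_frame "unreduced G" by (rule quasi_mipc_frame_unreduced)
    assume "(skel_proj G x, skel_proj G y) \<in> mipc_Q (skel G)"
    then obtain x' y' where *: "(x', y') \<in> mipc_Q (unreduced G)" "skel_proj G x = skel_proj G x'" "skel_proj G y = skel_proj G y'"
      by (auto simp: skel_def)
    moreover then have "x' \<in> Y" "y' \<in> Y" using q.Q_carrier by auto
    ultimately have "(x, x') \<in> ms4_R G" "(y', y) \<in> ms4_R G" using xy skel_proj_eq_iff by metis+
    then have "(x, y) \<in> mipc_Q (unreduced G)"
      using *(1) q.R_sub_Q q.Q_trans by (metis subsetD unreduced_simps(2))
    then show "(x, y) \<in> ms4_R G O ms4_E G" by simp
  qed (auto simp: skel_def)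
  show "quotient_map (mipc_space (unreduced G)) (mipc_space (skel G)) (skel_proj G)"
    by (simp add: skel_def quotient_map_quotient_topology)
  show "mipc_R (skel G) \<subseteq> topspace (mipc_space (skel G)) \<times> topspace (mipc_space (skel G))"
    "mipc_Q (skel G) \<subseteq> topspace (mipc_space (skel G)) \<times> topspace (mipc_space (skel G))"
    unfolding topspace_skel using R_carrier E_carrier by (auto simp: skel_def)
  show "skel_proj G x = skel_proj G y"
    if "(x, y) \<in> mipc_R (unreduced G)" "(y, x) \<in> mipc_R (unreduced G)" for x y
    using that R_carrier skel_proj_eq_iff[of x y] by auto
  show "(skel_proj G x, skel_proj G y) \<in> mipc_R (skel G) \<longleftrightarrow> (x, y) \<in> mipc_R (unreduced G)"
    "(skel_proj G x, skel_proj G y) \<in> mipc_Q (skel G) \<longleftrightarrow> (x, y) \<in> mipc_Q (unreduced G)"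
    if "x \<in> topspace (mipc_space (unreduced G))" "y \<in> topspace (mipc_space (unreduced G))" for x y
    using that R Q by simp_all
qed

end

text \<open>
  The condition on \<open>Q\<inverse>\<close> holds since \<open>Q\<inverse>[x] = R\<inverse>[E[x]]\<close> by symmetry of \<open>E\<close>, and
  \<open>R\<inverse>[f[R\<inverse>[A]]] = R\<inverse>[f[A]]\<close> for every \<open>A\<close>, since \<open>f\<close> preserves \<open>R\<close>.
\<close>

lemma ms4_mor_unreduced:
  assumes G1: "descriptive_ms4_frame G1" and G2: "descriptive_ms4_frame G2" and f: "ms4_mor G1 G2 f"
  shows "mipc_mor (unreduced G1) (unreduced G2) f"
  unfolding mipc_mor_def unreduced_simps
proof (intro conjI ballI)
  interpret G1: descriptive_ms4_frame G1 by (rule G1)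
  interpret G2: descriptive_ms4_frame G2 by (rule G2)
  show "f \<in> extensional G1.Y" "continuous_map (ms4_space G1) (ms4_space G2) f"
    using f by (auto simp: ms4_mor_def)
  have R: "ms4_R G2 `` f ` A = f ` (ms4_R G1 `` A)" and E: "ms4_E G2 `` f ` A = f ` (ms4_E G1 `` A)"
    if "A \<subseteq> G1.Y" for A
    using that f unfolding ms4_mor_def by (auto simp: set_eq_iff) (blast dest: subsetD)+
  fix x assume x: "x \<in> G1.Y"
  show "ms4_R G2 `` {f x} = f ` (ms4_R G1 `` {x})" using f x by (simp add: ms4_mor_def)
  show "(ms4_R G2 O ms4_E G2) `` {f x} = f ` ((ms4_R G1 O ms4_E G1) `` {x})"
    using R[of "{x}"] E[of "ms4_R G1 `` {x}"] x G1.R_carrier by (auto simp: relcomp_Image)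
  have E1: "ms4_E G2 `` {f x} = f ` (ms4_E G1 `` {x})" using f x by (simp add: ms4_mor_def)
  have forth: "(f a, f b) \<in> ms4_R G2" if "(a, b) \<in> ms4_R G1" for a b
    using that R[of "{a}"] G1.R_carrier by blast
  show "(ms4_R G2 O ms4_E G2)\<inverse> `` {f x} = (ms4_R G2)\<inverse> `` f ` ((ms4_R G1 O ms4_E G1)\<inverse> `` {x})"
    unfolding converse_relcomp G1.E_converse G2.E_converse relcomp_Image E1
  proof
    have "ms4_E G1 `` {x} \<subseteq> (ms4_R G1)\<inverse> `` (ms4_E G1 `` {x})"
      using G1.R_refl G1.E_carrier by blast
    then show "(ms4_R G2)\<inverse> `` f ` (ms4_E G1 `` {x}) \<subseteq> (ms4_R G2)\<inverse> `` f ` ((ms4_R G1)\<inverse> `` (ms4_E G1 `` {x}))"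
      by blast
    show "(ms4_R G2)\<inverse> `` f ` ((ms4_R G1)\<inverse> `` (ms4_E G1 `` {x})) \<subseteq> (ms4_R G2)\<inverse> `` f ` (ms4_E G1 `` {x})"
      using forth G2.R_trans by blast
  qed
qed

section \<open>Functors\<close>

definition covariant_functor :: "('o, 'a) concrete_category \<Rightarrow> ('p, 'x) concrete_category \<Rightarrow>
    ('o \<Rightarrow> 'p) \<Rightarrow> (('o, 'o, 'a, 'a) arrow \<Rightarrow> ('p, 'p, 'x, 'x) arrow) \<Rightarrow> bool" where
  "covariant_functor C D Fo Fa \<longleftrightarrow>
    (\<forall>A\<in>Ob C. Fo A \<in> Ob D) \<and>
    (\<forall>h\<in>Arr C. Fa h \<in> Arr D \<and> src (Fa h) = Fo (src h) \<and> tgt (Fa h) = Fo (tgt h)) \<and>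
    (\<forall>A\<in>Ob C. Fa (id_arr (Und C) A) = id_arr (Und D) (Fo A)) \<and>
    (\<forall>h\<in>Arr C. \<forall>k\<in>Arr C. tgt h = src k \<longrightarrow>
      Fa (comp_arr (Und C) k h) = comp_arr (Und D) (Fa k) (Fa h))"

lemma comp_arr_eqI:
  assumes "src f = src f'" "tgt g = tgt g'"
    and "\<And>x. x \<in> und (src f) \<Longrightarrow> app g (app f x) = app g' (app f' x)"
  shows "comp_arr und g f = comp_arr und g' f'"
  using assms by (auto simp: comp_arr_def compose_def intro: restrict_ext)

lemma comp_arr_eq_idI:
  assumes "src f = A" "tgt g = A" and "\<And>x. x \<in> und A \<Longrightarrow> app g (app f x) = x"
  shows "comp_arr und g f = id_arr und A"
  using assms by (auto simp: comp_arr_def id_arr_def compose_def intro: restrict_ext)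

lemma covariant_comp_contravariant:
  assumes "contravariant_functor C D Fo Fa" "covariant_functor D D' Go Ga"
  shows "contravariant_functor C D' (Go \<circ> Fo) (Ga \<circ> Fa)"
  using assms unfolding contravariant_functor_def covariant_functor_def by simp

lemma contravariant_comp_covariant:
  assumes "covariant_functor C D Fo Fa" "contravariant_functor D D' Go Ga"
  shows "contravariant_functor C D' (Go \<circ> Fo) (Ga \<circ> Fa)"
  using assms unfolding contravariant_functor_def covariant_functor_def by simp

text \<open>
  The value on a class is well defined because \<open>f\<close> preserves \<open>R\<close>, hence also \<open>E\<^sub>R\<close>.
\<close>

lemma skel_arr_app:
  assumes f: "f \<in> ms4_frame_arrows" and x: "x \<in> topspace (ms4_space (src f))"
  shows "app (skel_arr f) (skel_proj (src f) x) = skel_proj (tgt f) (app f x)"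
proof -
  interpret G1: descriptive_ms4_frame "src f" using f by (simp add: ms4_frame_arrows_def)
  interpret G2: descriptive_ms4_frame "tgt f" using f by (simp add: ms4_frame_arrows_def)
  have m: "ms4_mor (src f) (tgt f) (app f)" using f by (simp add: ms4_frame_arrows_def)
  have forth: "(app f a, app f b) \<in> ms4_R (tgt f)" if "(a, b) \<in> ms4_R (src f)" for a b
  proof -
    have "ms4_R (tgt f) `` {app f a} = app f ` (ms4_R (src f) `` {a})"
      using m that G1.R_carrier by (auto simp: ms4_mor_def)
    then show ?thesis using that by blast
  qed
  have "skel_proj (tgt f) (app f y) = skel_proj (tgt f) (app f x)" if "y \<in> skel_proj (src f) x" for y
  proof -
    have *: "(x, y) \<in> ms4_R (src f)" "(y, x) \<in> ms4_R (src f)"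
      using that by (auto simp: skel_proj_def sym_part_def)
    then have "(app f x, app f y) \<in> ms4_R (tgt f)" "(app f y, app f x) \<in> ms4_R (tgt f)" using forth by auto
    moreover then have "app f x \<in> G2.Y" "app f y \<in> G2.Y" using G2.R_carrier by auto
    ultimately show ?thesis using G2.skel_proj_eq_iff by blast
  qed
  then have "(\<lambda>y. skel_proj (tgt f) (app f y)) ` skel_proj (src f) x =
      (\<lambda>y. skel_proj (tgt f) (app f x)) ` skel_proj (src f) x"
    by (rule image_cong[OF refl])
  also have "\<dots> = {skel_proj (tgt f) (app f x)}"
    by (rule image_constant[OF G1.skel_proj_self[OF x]])
  finally have "(\<lambda>y. skel_proj (tgt f) (app f y)) ` skel_proj (src f) x = {skel_proj (tgt f) (app f x)}" .
  then show ?thesis using x by (simp add: skel_arr_def G1.topspace_skel)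
qed

lemma covariant_functor_skel: "covariant_functor DF_MS4 DF_MIPC skel skel_arr"
  unfolding covariant_functor_def
proof (intro conjI ballI impI)
  fix G :: "'a ms4_frame" assume "G \<in> Ob DF_MS4"
  then interpret descriptive_ms4_frame G by (simp add: DF_MS4_def)
  show "skel G \<in> Ob DF_MIPC"
    using mipc_quotient.descriptive[OF mipc_quotient_skel] by (simp add: DF_MIPC_def)
  have "id_arr (\<lambda>G. topspace (ms4_space G)) G \<in> ms4_frame_arrows"
    using R_carrier E_carrier descriptive_ms4_frame_axioms continuous_map_id
    by (auto simp: id_arr_def ms4_frame_arrows_def ms4_mor_def intro: continuous_map_eq[OF continuous_map_id])
  from skel_arr_app[OF this]
  have *: "app (skel_arr (id_arr (\<lambda>G. topspace (ms4_space G)) G)) c = c" if "c \<in> skel_proj G ` Y" for c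
    using that by (auto simp: id_arr_def)
  have "app (skel_arr (id_arr (\<lambda>G. topspace (ms4_space G)) G)) = (\<lambda>c\<in>skel_proj G ` Y. c)"
  proof (rule extensionalityI)
    show "app (skel_arr (id_arr (\<lambda>G. topspace (ms4_space G)) G)) \<in> extensional (skel_proj G ` Y)"
      by (simp add: skel_arr_def id_arr_def topspace_skel)
  qed (simp_all add: *)
  then show "skel_arr (id_arr (Und DF_MS4) G) = id_arr (Und DF_MIPC) (skel G)"
    by (simp add: DF_MS4_def DF_MIPC_def id_arr_def topspace_skel) (simp add: skel_arr_def)
next
  fix f :: "('a ms4_frame, 'a ms4_frame, 'a, 'a) arrow" assume "f \<in> Arr DF_MS4"
  then have f: "f \<in> ms4_frame_arrows" by (simp add: DF_MS4_def)
  interpret G1: descriptive_ms4_frame "src f" using f by (simp add: ms4_frame_arrows_def)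
  interpret G2: descriptive_ms4_frame "tgt f" using f by (simp add: ms4_frame_arrows_def)
  have m: "ms4_mor (src f) (tgt f) (app f)" using f by (simp add: ms4_frame_arrows_def)
  have "mipc_mor (skel (src f)) (skel (tgt f)) (app (skel_arr f))"
  proof (rule mipc_mor_descends[OF G1.mipc_quotient_skel G2.mipc_quotient_skel])
    show "mipc_mor (unreduced (src f)) (unreduced (tgt f)) (app f)"
      by (rule ms4_mor_unreduced[OF G1.descriptive_ms4_frame_axioms G2.descriptive_ms4_frame_axioms m])
  qed (simp add: skel_arr_def, simp add: skel_arr_app[OF f])
  then show "skel_arr f \<in> Arr DF_MIPC"
    using mipc_quotient.descriptive[OF G1.mipc_quotient_skel]
      mipc_quotient.descriptive[OF G2.mipc_quotient_skel]
    by (simp add: DF_MIPC_def mipc_frame_arrows_def) (simp add: skel_arr_def)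
  show "src (skel_arr f) = skel (src f)" "tgt (skel_arr f) = skel (tgt f)" by (simp_all add: skel_arr_def)
next
  fix f g :: "('a ms4_frame, 'a ms4_frame, 'a, 'a) arrow"
  assume "f \<in> Arr DF_MS4" "g \<in> Arr DF_MS4" and fg: "tgt f = src g"
  then have f: "f \<in> ms4_frame_arrows" and g: "g \<in> ms4_frame_arrows" by (simp_all add: DF_MS4_def)
  interpret G1: descriptive_ms4_frame "src f" using f by (simp add: ms4_frame_arrows_def)
  have fY: "app f x \<in> topspace (ms4_space (src g))" if "x \<in> G1.Y" for x
    using that f fg by (auto simp: ms4_frame_arrows_def ms4_mor_def continuous_map_def)
  let ?gf = "comp_arr (\<lambda>G. topspace (ms4_space G)) g f"
  have mf: "ms4_mor (src f) (src g) (app f)" and mg: "ms4_mor (src g) (tgt g) (app g)"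
    using f g fg by (auto simp: ms4_frame_arrows_def)
  have "ms4_mor (src f) (tgt g) (compose G1.Y (app g) (app f))"
    unfolding ms4_mor_def
  proof (intro conjI ballI)
    show "continuous_map (ms4_space (src f)) (ms4_space (tgt g)) (compose G1.Y (app g) (app f))"
      using mf mg by (auto simp: ms4_mor_def compose_def intro: continuous_map_eq[OF continuous_map_compose])
    fix x assume x: "x \<in> G1.Y"
    have c: "compose G1.Y (app g) (app f) ` A = app g ` app f ` A" if "A \<subseteq> G1.Y" for A
      using that by (auto simp: compose_def image_def)
    have "ms4_R (src f) `` {x} \<subseteq> G1.Y" "ms4_E (src f) `` {x} \<subseteq> G1.Y"
      using G1.R_carrier G1.E_carrier by auto
    then show "ms4_R (tgt g) `` {compose G1.Y (app g) (app f) x} = compose G1.Y (app g) (app f) ` (ms4_R (src f) `` {x})"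
      "ms4_E (tgt g) `` {compose G1.Y (app g) (app f) x} = compose G1.Y (app g) (app f) ` (ms4_E (src f) `` {x})"
      using mf mg x fY by (simp_all add: c) (simp_all add: compose_def ms4_mor_def)
  qed simp
  then have gf: "?gf \<in> ms4_frame_arrows"
    using f g by (simp add: comp_arr_def ms4_frame_arrows_def)
  have *: "app (skel_arr ?gf) c = app (skel_arr g) (app (skel_arr f) c)" if c: "c \<in> skel_proj (src f) ` G1.Y" for c
  proof -
    obtain x where x: "x \<in> G1.Y" "c = skel_proj (src f) x" using c by blast
    have "app (skel_arr ?gf) c = skel_proj (tgt g) (app g (app f x))"
      using skel_arr_app[OF gf] x by (simp add: comp_arr_def compose_def)
    then show ?thesis
      using skel_arr_app[OF f x(1)] skel_arr_app[OF g fY[OF x(1)]] x fg by simp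
  qed
  have "app (skel_arr ?gf) = compose (skel_proj (src f) ` G1.Y) (app (skel_arr g)) (app (skel_arr f))"
  proof (rule extensionalityI)
    show "app (skel_arr ?gf) \<in> extensional (skel_proj (src f) ` G1.Y)"
      by (simp add: skel_arr_def comp_arr_def G1.topspace_skel)
  qed (simp_all add: * compose_def)
  then show "skel_arr (comp_arr (Und DF_MS4) g f) = comp_arr (Und DF_MIPC) (skel_arr g) (skel_arr f)"
    by (simp add: DF_MS4_def DF_MIPC_def comp_arr_def) (simp add: skel_arr_def G1.topspace_skel)
qed

section \<open>Algebras of clopen upsets\<close>

context partial_order
begin

lemma join_eqI: "least L z (Upper L {x, y}) \<Longrightarrow> x \<squnion> y = z"
  unfolding join_def sup_def by (rule some_equality) (auto intro: least_unique)

lemma meet_eqI: "greatest L z (Lower L {x, y}) \<Longrightarrow> x \<sqinter> y = z"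
  unfolding meet_def inf_def by (rule some_equality) (auto intro: greatest_unique)

lemma top_eqI: "greatest L z (carrier L) \<Longrightarrow> \<top> = z"
  unfolding top_def by (rule some_equality) (auto intro: greatest_unique)

lemma bottom_eqI: "least L z (carrier L) \<Longrightarrow> \<bottom> = z"
  unfolding bottom_def by (rule some_equality) (auto intro: least_unique)

end

text \<open>
  A bounded lattice of sets under inclusion. The library derives meets and joins from the order by
  choice, so that the set operations have to be identified with them.
\<close>

locale set_lattice =
  fixes L :: "('x set, 'm) gorder_scheme" (structure) and X :: "'x set"
  assumes eq: "eq L = (=)" and le: "le L = (\<subseteq>)"
    and empty: "{} \<in> carrier L" and full: "X \<in> carrier L"
    and subset: "U \<in> carrier L \<Longrightarrow> U \<subseteq> X"
    and Int: "\<lbrakk>U \<in> carrier L; V \<in> carrier L\<rbrakk> \<Longrightarrow> U \<inter> V \<in> carrier L"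
    and Un: "\<lbrakk>U \<in> carrier L; V \<in> carrier L\<rbrakk> \<Longrightarrow> U \<union> V \<in> carrier L"
begin

lemma partial_order: "partial_order L"
  by unfold_locales (auto simp: eq le)

lemma least_Un: "\<lbrakk>U \<in> carrier L; V \<in> carrier L\<rbrakk> \<Longrightarrow> least L (U \<union> V) (Upper L {U, V})"
  and greatest_Int: "\<lbrakk>U \<in> carrier L; V \<in> carrier L\<rbrakk> \<Longrightarrow> greatest L (U \<inter> V) (Lower L {U, V})"
  and least_empty: "least L {} (carrier L)"
  and greatest_full: "greatest L X (carrier L)"
  using empty full subset by (auto simp: least_def greatest_def Upper_def Lower_def le Int Un)

lemma bounded_lattice: "Lattice.bounded_lattice L"
proof -
  interpret partial_order L by (rule partial_order)
  show ?thesis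
    by unfold_locales (use least_Un greatest_Int least_empty greatest_full in blast)+
qed

lemma join_eq: "\<lbrakk>U \<in> carrier L; V \<in> carrier L\<rbrakk> \<Longrightarrow> U \<squnion> V = U \<union> V"
  and meet_eq: "\<lbrakk>U \<in> carrier L; V \<in> carrier L\<rbrakk> \<Longrightarrow> U \<sqinter> V = U \<inter> V"
  and top_eq: "\<top> = X" and bottom_eq: "\<bottom> = {}"
  by (rule partial_order.join_eqI[OF partial_order least_Un] partial_order.meet_eqI[OF partial_order greatest_Int]
      partial_order.top_eqI[OF partial_order greatest_full] partial_order.bottom_eqI[OF partial_order least_empty]; assumption)+

end

text \<open>
  The record \<open>H\<close> is described only up to the values of its operations on the carrier, so that both
  \<open>\<rho>(G)\<^sup>*\<close> and \<open>\<O>(G\<^sup>*)\<close> are instances although their operations are given by different terms.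
\<close>

locale upset_algebra = quasi_mipc_frame F for F :: "'x mipc_frame" +
  fixes H :: "'x set mha"
  assumes carrier: "carrier H = {U. clopen_upset (mipc_space F) (mipc_R F) U}"
    and eq: "eq H = (=)" and le: "le H = (\<subseteq>)"
    and imp: "\<lbrakk>U \<in> carrier H; V \<in> carrier H\<rbrakk> \<Longrightarrow>
      imp H U V = topspace (mipc_space F) - (mipc_R F)\<inverse> `` (U - V)"
    and all: "U \<in> carrier H \<Longrightarrow>
      mha_all H U = topspace (mipc_space F) - (mipc_Q F)\<inverse> `` (topspace (mipc_space F) - U)"
    and ex: "U \<in> carrier H \<Longrightarrow> mha_ex H U = mipc_Q F `` U"
begin

lemma carrierI: "clopen_in (mipc_space F) U \<Longrightarrow> mipc_R F `` U \<subseteq> U \<Longrightarrow> U \<in> carrier H"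
  and carrierD: "U \<in> carrier H \<Longrightarrow> clopen_in (mipc_space F) U" "U \<in> carrier H \<Longrightarrow> mipc_R F `` U \<subseteq> U"
  by (simp_all add: carrier clopen_upset_def)

lemma carrier_subset: "U \<in> carrier H \<Longrightarrow> U \<subseteq> X"
  using carrierD(1) clopen_in_subset by blast

lemma imp_carrier:
  assumes "U \<in> carrier H" "V \<in> carrier H"
  shows "imp H U V \<in> carrier H"
  unfolding imp[OF assms]
proof (rule carrierI)
  show "clopen_in (mipc_space F) (X - (mipc_R F)\<inverse> `` (U - V))"
    using assms by (intro clopen_in_compl R_inverse_clopen clopen_in_Diff carrierD)
  show "mipc_R F `` (X - (mipc_R F)\<inverse> `` (U - V)) \<subseteq> X - (mipc_R F)\<inverse> `` (U - V)"
    using R_trans R_carrier by blast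
qed

lemma all_carrier:
  assumes "U \<in> carrier H"
  shows "mha_all H U \<in> carrier H"
  unfolding all[OF assms]
proof (rule carrierI)
  show "clopen_in (mipc_space F) (X - (mipc_Q F)\<inverse> `` (X - U))"
    using assms by (intro clopen_in_compl Q_inverse_clopen carrierD)
  show "mipc_R F `` (X - (mipc_Q F)\<inverse> `` (X - U)) \<subseteq> X - (mipc_Q F)\<inverse> `` (X - U)"
    using Q_trans R_sub_Q R_carrier by blast
qed

lemma ex_carrier: "U \<in> carrier H \<Longrightarrow> mha_ex H U \<in> carrier H"
  using Q_upset by (simp add: ex) (simp add: carrier)

sublocale set_lattice H X
proof (unfold_locales)
  show "eq H = (=)" "le H = (\<subseteq>)" by (fact eq le)+
  show "{} \<in> carrier H" by (simp add: carrierI clopen_in_empty)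
  show "X \<in> carrier H" using R_carrier by (auto intro: carrierI clopen_in_topspace)
  show "U \<subseteq> X" if "U \<in> carrier H" for U using that by (rule carrier_subset)
  show "U \<inter> V \<in> carrier H" "U \<union> V \<in> carrier H" if "U \<in> carrier H" "V \<in> carrier H" for U V
    using carrierD[OF that(1)] carrierD[OF that(2)]
    by (auto intro!: carrierI clopen_in_Int clopen_in_Un)
qed

lemma all_iff: "U \<in> carrier H \<Longrightarrow> x \<in> mha_all H U \<longleftrightarrow> x \<in> X \<and> mipc_Q F `` {x} \<subseteq> U"
  using Q_carrier by (auto simp: all)

lemma all_Q_upset: "U \<in> carrier H \<Longrightarrow> mipc_Q F `` mha_all H U \<subseteq> mha_all H U"
  using Q_trans Q_carrier unfolding all by blast

lemma ex_all_if_Q_upset: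
  assumes "U \<in> carrier H" "mipc_Q F `` U \<subseteq> U"
  shows "mha_ex H U = U" "mha_all H U = U"
  using assms(2) carrier_subset[OF assms(1)] Q_refl unfolding ex[OF assms(1)] all[OF assms(1)] by blast+

theorem monadic_heyting_algebra: "monadic_heyting_algebra H"
proof -
  interpret Lattice.bounded_lattice H by (rule bounded_lattice)
  note ops = le meet_eq join_eq Int Un all_carrier ex_carrier imp_carrier
  show ?thesis
  proof
    fix U V assume U: "U \<in> carrier H" and V: "V \<in> carrier H"
    show "imp H U V \<in> carrier H" "mha_all H U \<in> carrier H" "mha_ex H U \<in> carrier H"
      using U V by (simp_all add: ops)
    have U': "U \<subseteq> X" "mipc_R F `` U \<subseteq> U" and V': "V \<subseteq> X" "mipc_R F `` V \<subseteq> V"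
      using U V carrier_subset carrierD by auto
    show "W \<sqsubseteq>\<^bsub>H\<^esub> imp H U V \<longleftrightarrow> W \<sqinter>\<^bsub>H\<^esub> U \<sqsubseteq>\<^bsub>H\<^esub> V" if W: "W \<in> carrier H" for W
    proof -
      have "W \<subseteq> X" "mipc_R F `` W \<subseteq> W" using W carrier_subset carrierD by auto
      then have "W \<subseteq> X - (mipc_R F)\<inverse> `` (U - V) \<longleftrightarrow> W \<inter> U \<subseteq> V" using R_refl by blast
      then show ?thesis using U V W by (simp add: ops imp)
    qed
    show "mha_all H (U \<sqinter>\<^bsub>H\<^esub> V) = mha_all H U \<sqinter>\<^bsub>H\<^esub> mha_all H V"
      using U V by (auto simp: ops all_iff)
    show "mha_all H U \<sqsubseteq>\<^bsub>H\<^esub> U" using U' Q_refl unfolding le all[OF U] by blast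
    show "mha_all H U \<sqsubseteq>\<^bsub>H\<^esub> mha_all H (mha_all H U)"
      using ex_all_if_Q_upset(2)[OF all_carrier[OF U] all_Q_upset[OF U]] by (simp add: ops)
    show "mha_ex H (mha_all H U) = mha_all H U"
      by (rule ex_all_if_Q_upset(1)[OF all_carrier[OF U] all_Q_upset[OF U]])
    have Q: "mipc_Q F `` mha_ex H U \<subseteq> mha_ex H U" using U Q_trans by (auto simp: ex)
    show "mha_ex H (mha_ex H U) \<sqsubseteq>\<^bsub>H\<^esub> mha_ex H U" "mha_ex H U = mha_all H (mha_ex H U)"
      using ex_all_if_Q_upset[OF ex_carrier[OF U] Q] by (simp_all add: ops)
    show "mha_ex H (U \<squnion>\<^bsub>H\<^esub> V) = mha_ex H U \<squnion>\<^bsub>H\<^esub> mha_ex H V"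
      using U V Un[OF U V] ex_carrier[OF U] ex_carrier[OF V] by (simp add: join_eq ex Image_Un)
    show "U \<sqsubseteq>\<^bsub>H\<^esub> mha_ex H U" using U' Q_refl unfolding le ex[OF U] by blast
    \<comment> \<open>The factorization of \<open>Q\<close> moves the witness in \<open>V\<close> along \<open>R\<close> to a point \<open>Q\<close>-equivalent to \<open>y\<close>; it stays in the upset \<open>V\<close>.\<close>
    have "mipc_Q F `` U \<inter> mipc_Q F `` V \<subseteq> mipc_Q F `` (mipc_Q F `` U \<inter> V)"
    proof
      fix y assume "y \<in> mipc_Q F `` U \<inter> mipc_Q F `` V"
      then obtain u v where uv: "u \<in> U" "(u, y) \<in> mipc_Q F" "v \<in> V" "(v, y) \<in> mipc_Q F" by blast
      then obtain z where "(v, z) \<in> mipc_R F" "(z, y) \<in> mipc_Q F" "(y, z) \<in> mipc_Q F"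
        using Q_factor by (auto simp: sym_part_def)
      then show "y \<in> mipc_Q F `` (mipc_Q F `` U \<inter> V)" using uv V' Q_trans by blast
    qed
    moreover have "mipc_Q F `` U \<inter> V \<in> carrier H" using ex_carrier[OF U] V Int by (simp add: ex[OF U])
    ultimately show "mha_ex H U \<sqinter>\<^bsub>H\<^esub> mha_ex H V \<sqsubseteq>\<^bsub>H\<^esub> mha_ex H (mha_ex H U \<sqinter>\<^bsub>H\<^esub> V)"
      using U V ex_carrier[OF U] ex_carrier[OF V] by (simp add: le meet_eq ex)
  qed
qed

end

text \<open>
  Each operation of the algebra matches one morphism condition: implication corresponds to the
  condition on \<open>R\<close>, \<open>\<forall>\<close> to the one on \<open>Q\<close>, and \<open>\<exists>\<close> to the one on \<open>Q\<inverse>\<close>, where points need to be lifted only up to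
  \<open>R\<close> because the sets in question are upsets.
\<close>

theorem mha_hom_preimage:
  assumes 1: "upset_algebra F1 H1" and 2: "upset_algebra F2 H2" and f: "mipc_mor F1 F2 f"
  shows "mha_hom H2 H1 (\<lambda>U\<in>carrier H2. f -` U \<inter> topspace (mipc_space F1))"
proof -
  interpret H1: upset_algebra F1 H1 by (rule 1)
  interpret H2: upset_algebra F2 H2 by (rule 2)
  let ?h = "\<lambda>U. f -` U \<inter> H1.X"
  have R: "mipc_R F2 `` {f x} = f ` (mipc_R F1 `` {x})" and Q: "mipc_Q F2 `` {f x} = f ` (mipc_Q F1 `` {x})"
    and Q': "(mipc_Q F2)\<inverse> `` {f x} = (mipc_R F2)\<inverse> `` (f ` ((mipc_Q F1)\<inverse> `` {x}))"
    if "x \<in> H1.X" for x using f that by (auto simp: mipc_mor_def)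
  have fX: "f x \<in> H2.X" if "x \<in> H1.X" for x using f that by (auto simp: mipc_mor_def continuous_map_def)
  have h_eq: "?h U = {x \<in> H1.X. f x \<in> U}" for U by blast
  have closed: "?h U \<in> carrier H1" if U: "U \<in> carrier H2" for U
  proof (rule H1.carrierI)
    show "clopen_in (mipc_space F1) (?h U)"
      unfolding h_eq using f H2.carrierD(1)[OF U] by (intro clopen_in_preimage) (auto simp: mipc_mor_def)
    show "mipc_R F1 `` ?h U \<subseteq> ?h U"
      using R H2.carrierD(2)[OF U] H1.R_carrier by blast
  qed
  show ?thesis
    unfolding mha_hom_def lattice_hom_def
  proof (intro conjI ballI)
    show "restrict ?h (carrier H2) \<in> carrier H2 \<rightarrow>\<^sub>E carrier H1" using closed by auto
    show "restrict ?h (carrier H2) \<bottom>\<^bsub>H2\<^esub> = \<bottom>\<^bsub>H1\<^esub>"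
      by (simp add: H1.bottom_eq H2.bottom_eq H2.empty)
    show "restrict ?h (carrier H2) \<top>\<^bsub>H2\<^esub> = \<top>\<^bsub>H1\<^esub>"
      using fX by (auto simp: H1.top_eq H2.top_eq H2.full)
    fix U assume U: "U \<in> carrier H2"
    have "x \<in> ?h (mha_all H2 U) \<longleftrightarrow> x \<in> mha_all H1 (?h U)" for x
    proof (cases "x \<in> H1.X")
      case True
      have "f ` (mipc_Q F1 `` {x}) \<subseteq> U \<longleftrightarrow> mipc_Q F1 `` {x} \<subseteq> ?h U" using H1.Q_carrier by blast
      then show ?thesis
        using True fX[OF True] Q[OF True]
        by (simp only: H2.all_iff[OF U] H1.all_iff[OF closed[OF U]] vimage_eq Int_iff simp_thms)
    qed (simp add: H1.all_iff[OF closed[OF U]])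
    then have "?h (mha_all H2 U) = mha_all H1 (?h U)" by blast
    then show "restrict ?h (carrier H2) (mha_all H2 U) = mha_all H1 (restrict ?h (carrier H2) U)"
      using U H2.all_carrier[OF U] by simp
    have "?h (mipc_Q F2 `` U) = mipc_Q F1 `` ?h U"
    proof
      show "?h (mipc_Q F2 `` U) \<subseteq> mipc_Q F1 `` ?h U"
      proof
        fix x assume "x \<in> ?h (mipc_Q F2 `` U)"
        then obtain u where u: "x \<in> H1.X" "u \<in> U" "(u, f x) \<in> mipc_Q F2" by blast
        then have "u \<in> (mipc_R F2)\<inverse> `` (f ` ((mipc_Q F1)\<inverse> `` {x}))" using Q' by blast
        then obtain w where "(w, x) \<in> mipc_Q F1" "(u, f w) \<in> mipc_R F2" by blast
        moreover from this have "f w \<in> U" "w \<in> H1.X" using u H2.carrierD(2)[OF U] H1.Q_carrier by auto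
        ultimately show "x \<in> mipc_Q F1 `` ?h U" by blast
      qed
      show "mipc_Q F1 `` ?h U \<subseteq> ?h (mipc_Q F2 `` U)" using Q H1.Q_carrier by blast
    qed
    then show "restrict ?h (carrier H2) (mha_ex H2 U) = mha_ex H1 (restrict ?h (carrier H2) U)"
      using U H2.ex_carrier[OF U] closed[OF U] by (simp add: H2.ex H1.ex)
    fix V assume V: "V \<in> carrier H2"
    show "restrict ?h (carrier H2) (U \<sqinter>\<^bsub>H2\<^esub> V) = restrict ?h (carrier H2) U \<sqinter>\<^bsub>H1\<^esub> restrict ?h (carrier H2) V"
      using U V closed by (auto simp: H2.meet_eq H1.meet_eq H2.Int)
    show "restrict ?h (carrier H2) (U \<squnion>\<^bsub>H2\<^esub> V) = restrict ?h (carrier H2) U \<squnion>\<^bsub>H1\<^esub> restrict ?h (carrier H2) V"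
      using U V closed by (auto simp: H2.join_eq H1.join_eq H2.Un)
    have "?h (H2.X - (mipc_R F2)\<inverse> `` (U - V)) = H1.X - (mipc_R F1)\<inverse> `` (?h U - ?h V)"
    proof (rule Set.set_eqI)
      fix x
      show "x \<in> ?h (H2.X - (mipc_R F2)\<inverse> `` (U - V)) \<longleftrightarrow> x \<in> H1.X - (mipc_R F1)\<inverse> `` (?h U - ?h V)"
      proof (cases "x \<in> H1.X")
        case True
        have "f x \<in> (mipc_R F2)\<inverse> `` (U - V) \<longleftrightarrow> (\<exists>z \<in> mipc_R F2 `` {f x}. z \<in> U - V)" by blast
        also have "\<dots> \<longleftrightarrow> (\<exists>y \<in> mipc_R F1 `` {x}. f y \<in> U - V)" unfolding R[OF True] by blast
        also have "\<dots> \<longleftrightarrow> x \<in> (mipc_R F1)\<inverse> `` (?h U - ?h V)" using H1.R_carrier by blast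
        finally show ?thesis using True fX by blast
      qed blast
    qed
    then show "restrict ?h (carrier H2) (imp H2 U V) = imp H1 (restrict ?h (carrier H2) U) (restrict ?h (carrier H2) V)"
      using U V H2.imp_carrier[OF U V] closed by (simp add: H2.imp H1.imp)
  qed
qed

lemma mha_hom_inverse:
  assumes A: "monadic_heyting_algebra A" and h: "mha_hom A B h"
    and g: "g \<in> carrier B \<rightarrow>\<^sub>E carrier A"
    and gh: "\<And>a. a \<in> carrier A \<Longrightarrow> g (h a) = a" and hg: "\<And>b. b \<in> carrier B \<Longrightarrow> h (g b) = b"
  shows "mha_hom B A g"
proof -
  interpret A: monadic_heyting_algebra A by (rule A)
  note hD = h[unfolded mha_hom_def lattice_hom_def]
  have gc: "g b \<in> carrier A" if "b \<in> carrier B" for b using g that by auto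
  show ?thesis
    unfolding mha_hom_def lattice_hom_def
  proof (intro conjI ballI g)
    show "g \<bottom>\<^bsub>B\<^esub> = \<bottom>\<^bsub>A\<^esub>" "g \<top>\<^bsub>B\<^esub> = \<top>\<^bsub>A\<^esub>"
      using hD gh[OF A.bottom_closed] gh[OF A.top_closed] by auto
    fix a assume a: "a \<in> carrier B"
    show "g (mha_all B a) = mha_all A (g a)"
      using hD gh[OF A.all_closed[OF gc[OF a]]] hg[OF a] gc[OF a] by auto
    show "g (mha_ex B a) = mha_ex A (g a)"
      using hD gh[OF A.ex_closed[OF gc[OF a]]] hg[OF a] gc[OF a] by auto
    fix b assume b: "b \<in> carrier B"
    show "g (a \<sqinter>\<^bsub>B\<^esub> b) = g a \<sqinter>\<^bsub>A\<^esub> g b"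
      using hD gh[OF A.meet_closed[OF gc[OF a] gc[OF b]]] hg[OF a] gc[OF a] hg[OF b] gc[OF b] by auto
    show "g (a \<squnion>\<^bsub>B\<^esub> b) = g a \<squnion>\<^bsub>A\<^esub> g b"
      using hD gh[OF A.join_closed[OF gc[OF a] gc[OF b]]] hg[OF a] gc[OF a] hg[OF b] gc[OF b] by auto
    show "g (imp B a b) = imp A (g a) (g b)"
      using hD gh[OF A.imp_closed[OF gc[OF a] gc[OF b]]] hg[OF a] gc[OF a] hg[OF b] gc[OF b] by auto
  qed
qed

lemma (in descriptive_mipc_frame) upset_algebra_mipc_alg: "upset_algebra F (mipc_alg F)"
proof -
  interpret quasi_mipc_frame F by (rule quasi_mipc_frame)
  show ?thesis by unfold_locales (simp_all add: mipc_alg_def Let_def)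
qed

text \<open>
  A clopen set \<open>U\<close> satisfies \<open>\<box>U = U\<close> iff it is an upset, and on upsets \<open>\<box>\<forall>\<close> and \<open>\<exists>\<close> are the operations of
  \<open>Q = E \<circ> R\<close>: the complement of \<open>\<box>\<forall>U\<close> is \<open>R\<inverse>[E[Y - U]] = Q\<inverse>[Y - U]\<close>, and \<open>\<exists>U = E[U] = Q[U]\<close>.
\<close>

lemma (in descriptive_ms4_frame) upset_algebra_opens: "upset_algebra (unreduced G) (opens (ms4_alg G))"
proof -
  interpret q: quasi_mipc_frame "unreduced G" by (rule quasi_mipc_frame_unreduced)
  let ?R = "ms4_R G" let ?Q = "ms4_R G O ms4_E G"
  have "Y - ?R\<inverse> `` (Y - U) = U \<longleftrightarrow> ?R `` U \<subseteq> U" if "U \<subseteq> Y" for U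
  proof -
    have "Y - ?R\<inverse> `` (Y - U) \<subseteq> U" using R_refl by blast
    moreover have "U \<subseteq> Y - ?R\<inverse> `` (Y - U) \<longleftrightarrow> ?R `` U \<subseteq> U" using that R_carrier by blast
    ultimately show ?thesis unfolding set_eq_subset by simp
  qed
  then have "clopen_in (ms4_space G) U \<and> Y - ?R\<inverse> `` (Y - U) = U \<longleftrightarrow> clopen_upset (ms4_space G) ?R U" for U
    using clopen_in_subset[of "ms4_space G" U] unfolding clopen_upset_def by blast
  then have carrier: "carrier (opens (ms4_alg G)) = {U. clopen_upset (ms4_space G) ?R U}"
    by (simp add: opens_def ms4_alg_def Let_def)
  show ?thesis
  proof (unfold_locales, simp_all only: unreduced_simps)
    show "carrier (opens (ms4_alg G)) = {U. clopen_upset (ms4_space G) ?R U}" by (rule carrier)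
    show "eq (opens (ms4_alg G)) = (=)" "le (opens (ms4_alg G)) = (\<subseteq>)"
      by (simp_all add: opens_def ms4_alg_def Let_def)
    fix U assume "U \<in> carrier (opens (ms4_alg G))"
    then have U: "clopen_in (ms4_space G) U" "?R `` U \<subseteq> U" by (simp_all add: carrier clopen_upset_def)
    then have UY: "U \<subseteq> Y" using clopen_in_subset by blast
    have "Y - (Y - ms4_E G `` (Y - U)) = ms4_E G `` (Y - U)" using E_carrier by blast
    then show "mha_all (opens (ms4_alg G)) U = Y - ?Q\<inverse> `` (Y - U)"
      by (simp add: opens_def ms4_alg_def Let_def converse_relcomp E_converse relcomp_Image)
    have "Y - (Y - ms4_E G `` (Y - (Y - U))) = ms4_E G `` U" using E_carrier UY by (simp add: double_diff) blast
    then show "mha_ex (opens (ms4_alg G)) U = ?Q `` U"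
      using Q_image_upset[OF U(2) UY] by (simp add: opens_def ms4_ex_def ms4_alg_def Let_def)
    fix V assume "V \<in> carrier (opens (ms4_alg G))"
    then have V: "clopen_in (ms4_space G) V" by (simp add: carrier clopen_upset_def)
    interpret alg: set_lattice "ms4_alg G" Y
      by unfold_locales (auto simp: ms4_alg_def Let_def clopen_in_empty clopen_in_topspace
          clopen_in_Int clopen_in_Un dest: clopen_in_subset)
    have "(Y - U) \<squnion>\<^bsub>ms4_alg G\<^esub> V = (Y - U) \<union> V"
      by (rule alg.join_eq) (simp_all add: ms4_alg_def Let_def V U clopen_in_compl)
    moreover have "Y - ((Y - U) \<union> V) = U - V" using UY by blast
    ultimately show "imp (opens (ms4_alg G)) U V = Y - ?R\<inverse> `` (U - V)"
      by (simp add: opens_def) (simp add: ms4_alg_def Let_def)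
  qed
qed

section \<open>Preimage functors\<close>

lemma covariant_functor_arr: "covariant_functor C D Fo Fa \<Longrightarrow> f \<in> Arr C \<Longrightarrow> Fa f \<in> Arr D"
  by (simp add: covariant_functor_def)

lemma contravariant_functor_arr: "contravariant_functor C D Fo Fa \<Longrightarrow> f \<in> Arr C \<Longrightarrow> Fa f \<in> Arr D"
  by (simp add: contravariant_functor_def)

text \<open>
  The record of a concrete category does not by itself tie the functions of its arrows to the underlying
  sets of their endpoints.
\<close>

definition concrete :: "('o, 'x) concrete_category \<Rightarrow> bool" where
  "concrete C \<longleftrightarrow> (\<forall>f\<in>Arr C. src f \<in> Ob C \<and> tgt f \<in> Ob C \<and> app f \<in> Und C (src f) \<rightarrow> Und C (tgt f))"

lemma concrete_categories: "concrete MHA" "concrete MS4" "concrete DF_MIPC" "concrete DF_MS4"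
  by (auto simp: concrete_def MHA_def MS4_def DF_MIPC_def DF_MS4_def mha_arrows_def ms4_arrows_def
      mipc_frame_arrows_def ms4_frame_arrows_def mha_hom_def ms4_hom_def lattice_hom_def
      mipc_mor_def ms4_mor_def continuous_map_def)

lemma concreteD: "concrete C \<Longrightarrow> f \<in> Arr C \<Longrightarrow> app f \<in> Und C (src f) \<rightarrow> Und C (tgt f)"
  by (simp add: concrete_def)

text \<open>
  The functors in question act on arrows by preimage, so that identities and compositions are preserved
  for one and the same reason. The elements of \<open>Fo A\<close> are subsets of \<open>S A\<close>, which is the whole
  underlying set of \<open>A\<close> except for \<open>(-)\<^sub>* \<circ> \<O>\<close>, where it consists of the open elements.
\<close>

lemma contravariant_functor_preimage:
  assumes C: "concrete C" and D: "concrete D"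
    and objects: "\<And>A. A \<in> Ob C \<Longrightarrow> Fo A \<in> Ob D"
    and arrows: "\<And>f. f \<in> Arr C \<Longrightarrow> Fa f \<in> Arr D"
    and Fa: "\<And>f. Fa f = \<lparr>src = Fo (tgt f), tgt = Fo (src f),
      app = (\<lambda>U\<in>Und D (Fo (tgt f)). app f -` U \<inter> S (src f))\<rparr>"
    and S: "\<And>A. A \<in> Ob C \<Longrightarrow> S A \<subseteq> Und C A"
    and app_S: "\<And>f. f \<in> Arr C \<Longrightarrow> app f ` S (src f) \<subseteq> S (tgt f)"
    and points: "\<And>A U. A \<in> Ob C \<Longrightarrow> U \<in> Und D (Fo A) \<Longrightarrow> U \<subseteq> S A"
  shows "contravariant_functor C D Fo Fa"
  unfolding contravariant_functor_def
proof (intro conjI ballI impI)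
  fix A assume A: "A \<in> Ob C"
  show "Fo A \<in> Ob D" using A by (rule objects)
  have "(\<lambda>x\<in>Und C A. x) -` U \<inter> S A = U" if "U \<in> Und D (Fo A)" for U
    using S[OF A] points[OF A that] by auto
  then show "Fa (id_arr (Und C) A) = id_arr (Und D) (Fo A)"
    by (auto simp: id_arr_def Fa intro!: restrict_ext)
next
  fix f assume f: "f \<in> Arr C"
  show "Fa f \<in> Arr D" using f by (rule arrows)
  show "src (Fa f) = Fo (tgt f)" "tgt (Fa f) = Fo (src f)" by (simp_all add: Fa)
next
  fix f g assume f: "f \<in> Arr C" and g: "g \<in> Arr C" and fg: "tgt f = src g"
  have "app (Fa g) U \<in> Und D (Fo (src g))" if "U \<in> Und D (Fo (tgt g))" for U
  proof -
    have "app (Fa g) \<in> Und D (Fo (tgt g)) \<rightarrow> Und D (Fo (src g))"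
      using D arrows[OF g] unfolding concrete_def by (metis Fa arrow.select_convs(1,2))
    then show ?thesis using that by (rule funcset_mem)
  qed
  then have g_closed: "app g -` U \<inter> S (src g) \<in> Und D (Fo (src g))" if "U \<in> Und D (Fo (tgt g))" for U
    using that by (simp add: Fa)
  have "S (src f) \<subseteq> Und C (src f)" using C f S by (simp add: concrete_def)
  then have "compose (Und C (src f)) (app g) (app f) -` U \<inter> S (src f) =
      app f -` (app g -` U \<inter> S (src g)) \<inter> S (src f)" for U
    using app_S[OF f] fg by (auto simp: compose_def)
  then show "Fa (comp_arr (Und C) g f) = comp_arr (Und D) (Fa f) (Fa g)"
    using fg g_closed by (auto simp: comp_arr_def Fa compose_def intro!: restrict_ext)
qed

section \<open>Clopen upsets of the skeleton\<close>

lemma (in descriptive_mipc_frame) mha_mipc_alg: "monadic_heyting_algebra (mipc_alg F)"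
  using upset_algebra_mipc_alg by (rule upset_algebra.monadic_heyting_algebra)

lemma (in descriptive_ms4_frame) mha_opens_ms4_alg: "monadic_heyting_algebra (opens (ms4_alg G))"
  using upset_algebra_opens by (rule upset_algebra.monadic_heyting_algebra)

lemma contravariant_functor_mipc_alg: "contravariant_functor DF_MIPC MHA mipc_alg mipc_alg_arr"
proof (rule contravariant_functor_preimage[OF concrete_categories(3,1), where S = "\<lambda>F. topspace (mipc_space F)"])
  show "mipc_alg F \<in> Ob MHA" if "F \<in> Ob DF_MIPC" for F :: "'a mipc_frame"
    using that descriptive_mipc_frame.mha_mipc_alg by (simp add: DF_MIPC_def MHA_def)
  show "mipc_alg_arr f \<in> Arr MHA" if "f \<in> Arr DF_MIPC" for f :: "('a mipc_frame, 'a mipc_frame, 'a, 'a) arrow"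
    using that descriptive_mipc_frame.mha_mipc_alg
      mha_hom_preimage[OF descriptive_mipc_frame.upset_algebra_mipc_alg descriptive_mipc_frame.upset_algebra_mipc_alg]
    by (auto simp: DF_MIPC_def MHA_def mipc_alg_arr_def mipc_frame_arrows_def mha_arrows_def)
  show "app f ` topspace (mipc_space (src f)) \<subseteq> topspace (mipc_space (tgt f))"
    if "f \<in> Arr DF_MIPC" for f :: "('a mipc_frame, 'a mipc_frame, 'a, 'a) arrow"
    using that concrete_categories(3) by (auto simp: concrete_def DF_MIPC_def)
  show "U \<subseteq> topspace (mipc_space F)" if "U \<in> Und MHA (mipc_alg F)" for U and F :: "'a mipc_frame"
    using that by (simp add: MHA_def mipc_alg_def Let_def clopen_upset_def clopen_in_subset)
qed (simp_all add: mipc_alg_arr_def MHA_def DF_MIPC_def)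

lemma opens_arr_ms4_alg_arr: "(opens_arr \<circ> ms4_alg_arr) f =
  \<lparr>src = (opens \<circ> ms4_alg) (tgt f), tgt = (opens \<circ> ms4_alg) (src f),
   app = (\<lambda>U\<in>carrier ((opens \<circ> ms4_alg) (tgt f)). app f -` U \<inter> topspace (ms4_space (src f)))\<rparr>"
  by (auto simp: opens_arr_def ms4_alg_arr_def opens_def intro!: restrict_ext)

lemma contravariant_functor_opens_ms4_alg:
  "contravariant_functor DF_MS4 MHA (opens \<circ> ms4_alg) (opens_arr \<circ> ms4_alg_arr)"
proof (rule contravariant_functor_preimage[OF concrete_categories(4,1), where S = "\<lambda>F. topspace (ms4_space F)"])
  show "(opens \<circ> ms4_alg) G \<in> Ob MHA" if "G \<in> Ob DF_MS4" for G :: "'a ms4_frame"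
    using that descriptive_ms4_frame.mha_opens_ms4_alg by (simp add: DF_MS4_def MHA_def)
  show "(opens_arr \<circ> ms4_alg_arr) f \<in> Arr MHA" if "f \<in> Arr DF_MS4" for f :: "('a ms4_frame, 'a ms4_frame, 'a, 'a) arrow"
  proof -
    have f: "descriptive_ms4_frame (src f)" "descriptive_ms4_frame (tgt f)" "ms4_mor (src f) (tgt f) (app f)"
      using that by (auto simp: DF_MS4_def ms4_frame_arrows_def)
    note upset = descriptive_ms4_frame.upset_algebra_opens
    have "mha_hom (opens (ms4_alg (tgt f))) (opens (ms4_alg (src f)))
        (\<lambda>U\<in>carrier (opens (ms4_alg (tgt f))). app f -` U \<inter> topspace (ms4_space (src f)))"
      using mha_hom_preimage[OF upset[OF f(1)] upset[OF f(2)] ms4_mor_unreduced[OF f]] by simp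
    then show ?thesis
      using f unfolding opens_arr_ms4_alg_arr
      by (simp add: MHA_def mha_arrows_def descriptive_ms4_frame.mha_opens_ms4_alg)
  qed
  show "app f ` topspace (ms4_space (src f)) \<subseteq> topspace (ms4_space (tgt f))"
    if "f \<in> Arr DF_MS4" for f :: "('a ms4_frame, 'a ms4_frame, 'a, 'a) arrow"
    using that concrete_categories(4) by (auto simp: concrete_def DF_MS4_def)
  show "U \<subseteq> topspace (ms4_space F)" if "U \<in> Und MHA ((opens \<circ> ms4_alg) F)" for U and F :: "'a ms4_frame"
    using that by (simp add: MHA_def opens_def ms4_alg_def Let_def clopen_in_subset)
  show "(opens_arr \<circ> ms4_alg_arr) f = \<lparr>src = (opens \<circ> ms4_alg) (tgt f), tgt = (opens \<circ> ms4_alg) (src f),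
      app = (\<lambda>U\<in>Und MHA ((opens \<circ> ms4_alg) (tgt f)). app f -` U \<inter> topspace (ms4_space (src f)))\<rparr>"
    for f :: "('a ms4_frame, 'a ms4_frame, 'a, 'a) arrow"
    by (simp only: opens_arr_ms4_alg_arr) (simp add: MHA_def)
qed (simp_all add: DF_MS4_def)

text \<open>
  The component at \<open>G\<close> of the natural isomorphism from \<open>(-)\<^sup>* \<circ> \<rho>\<close> to \<open>\<O> \<circ> (-)\<^sup>*\<close>.
\<close>

definition skel_pullback :: "'y ms4_frame \<Rightarrow> ('y set set mha, 'y set mha, 'y set set, 'y set) arrow" where
  "skel_pullback G = \<lparr>src = mipc_alg (skel G), tgt = opens (ms4_alg G),
    app = (\<lambda>U\<in>carrier (mipc_alg (skel G)). skel_proj G -` U \<inter> topspace (ms4_space G))\<rparr>"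

text \<open>
  The projection is a morphism from the unreduced frame, so taking preimages is a homomorphism. Its inverse
  takes images, since upsets are saturated, and the inverse of a bijective homomorphism is one.
\<close>

lemma (in descriptive_ms4_frame) skel_pullback_isomorphism:
  "skel_pullback G \<in> isomorphisms carrier carrier mha_arrows mha_arrows"
proof -
  interpret p: mipc_quotient "unreduced G" "skel G" "skel_proj G" by (rule mipc_quotient_skel)
  interpret S: upset_algebra "skel G" "mipc_alg (skel G)"
    by (rule descriptive_mipc_frame.upset_algebra_mipc_alg[OF p.descriptive])
  interpret O: upset_algebra "unreduced G" "opens (ms4_alg G)" by (rule upset_algebra_opens)
  let ?S = "carrier (mipc_alg (skel G))" and ?O = "carrier (opens (ms4_alg G))"
  let ?f = "app (skel_pullback G)" and ?g = "\<lambda>V\<in>?O. skel_proj G ` V"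
  have f: "?f U = p.pre U" if "U \<in> ?S" for U using that by (auto simp: skel_pullback_def)
  have fO: "?f U \<in> ?O" if "U \<in> ?S" for U
    using that unfolding f[OF that] S.carrier O.carrier by (simp add: p.clopen_upset'_iff)
  have gS: "?g V \<in> ?S" if "V \<in> ?O" for V
    using that p.p_image_clopen_upset unfolding S.carrier O.carrier by simp
  have gf: "?g (?f U) = U" if "U \<in> ?S" for U
    using that fO[OF that] p.p_image_pre[OF S.carrier_subset[OF that]] by (simp add: f)
  have fg: "?f (?g V) = V" if "V \<in> ?O" for V
    using that gS[OF that] p.pre_p_image unfolding O.carrier by (simp add: f)
  have "restrict (skel_proj G) Y -` U \<inter> Y = skel_proj G -` U \<inter> Y" for U by auto
  then have "mha_hom (mipc_alg (skel G)) (opens (ms4_alg G)) ?f"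
    using mha_hom_preimage[OF O.upset_algebra_axioms S.upset_algebra_axioms p.morphism]
    by (simp add: skel_pullback_def)
  moreover have "mha_hom (opens (ms4_alg G)) (mipc_alg (skel G)) ?g"
    by (rule mha_hom_inverse[OF S.monadic_heyting_algebra calculation]) (use gS gf fg in auto)
  ultimately show ?thesis
    unfolding isomorphisms_def mem_Collect_eq
  proof (intro conjI bexI)
    let ?G = "\<lparr>src = opens (ms4_alg G), tgt = mipc_alg (skel G), app = ?g\<rparr>"
    show "comp_arr carrier ?G (skel_pullback G) = id_arr carrier (src (skel_pullback G))"
      using gf by (simp add: comp_arr_def id_arr_def compose_def skel_pullback_def cong: restrict_cong)
    show "comp_arr carrier (skel_pullback G) ?G = id_arr carrier (tgt (skel_pullback G))"
      using fg by (simp add: comp_arr_def id_arr_def compose_def skel_pullback_def cong: restrict_cong)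
  qed (use S.monadic_heyting_algebra O.monadic_heyting_algebra in
      \<open>auto simp: mha_arrows_def skel_pullback_def\<close>)
qed

lemma skel_pullback_natural:
  fixes f :: "('y ms4_frame, 'y ms4_frame, 'y, 'y) arrow"
  assumes f: "f \<in> ms4_frame_arrows"
  shows "comp_arr carrier (skel_pullback (src f)) ((mipc_alg_arr \<circ> skel_arr) f) =
    comp_arr carrier ((opens_arr \<circ> ms4_alg_arr) f) (skel_pullback (tgt f))"
proof -
  interpret G1: descriptive_ms4_frame "src f" using f by (simp add: ms4_frame_arrows_def)
  interpret G2: descriptive_ms4_frame "tgt f" using f by (simp add: ms4_frame_arrows_def)
  have fY: "app f x \<in> G2.Y" if "x \<in> G1.Y" for x
    using that f by (auto simp: ms4_frame_arrows_def ms4_mor_def continuous_map_def)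
  have "app (mipc_alg_arr (skel_arr f)) U \<in> carrier (mipc_alg (skel (src f)))"
    if "U \<in> carrier (mipc_alg (skel (tgt f)))" for U
  proof -
    have "mipc_alg_arr (skel_arr f) \<in> Arr MHA"
      by (intro contravariant_functor_arr[OF contravariant_functor_mipc_alg]
        covariant_functor_arr[OF covariant_functor_skel]) (simp add: DF_MS4_def f)
    from concreteD[OF concrete_categories(1) this]
    have "app (mipc_alg_arr (skel_arr f)) \<in> carrier (mipc_alg (skel (tgt f))) \<rightarrow> carrier (mipc_alg (skel (src f)))"
      by (simp add: MHA_def mipc_alg_arr_def skel_arr_def)
    then show ?thesis using that by (rule funcset_mem)
  qed
  moreover have "skel_pullback (tgt f) \<in> mha_arrows"
    using G2.skel_pullback_isomorphism by (simp add: isomorphisms_def)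
  then have "app (skel_pullback (tgt f)) U \<in> carrier (opens (ms4_alg (tgt f)))"
    if "U \<in> carrier (mipc_alg (skel (tgt f)))" for U
    using that by (auto simp: mha_arrows_def mha_hom_def lattice_hom_def skel_pullback_def)
  moreover have "skel_proj (src f) -` (app (skel_arr f) -` U \<inter> skel_proj (src f) ` G1.Y) \<inter> G1.Y =
      app f -` (skel_proj (tgt f) -` U \<inter> G2.Y) \<inter> G1.Y" for U
    using skel_arr_app[OF f] fY by auto
  ultimately show ?thesis
    unfolding comp_arr_def comp_apply opens_arr_ms4_alg_arr[unfolded comp_apply]
    by (auto simp: mipc_alg_arr_def skel_pullback_def compose_def skel_arr_def[of f] G1.topspace_skel intro!: restrict_ext)
qed

theorem skel_natural_isomorphism:
  "naturally_isomorphic DF_MS4 MHA MHA mha_arrows mha_arrows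
    (mipc_alg \<circ> skel) (mipc_alg_arr \<circ> skel_arr) (opens \<circ> ms4_alg) (opens_arr \<circ> ms4_alg_arr)"
  unfolding naturally_isomorphic_def
proof (intro conjI exI ballI)
  show "contravariant_functor DF_MS4 MHA (mipc_alg \<circ> skel) (mipc_alg_arr \<circ> skel_arr)"
    using covariant_functor_skel contravariant_functor_mipc_alg by (rule contravariant_comp_covariant)
  show "contravariant_functor DF_MS4 MHA (opens \<circ> ms4_alg) (opens_arr \<circ> ms4_alg_arr)"
    by (rule contravariant_functor_opens_ms4_alg)
  fix G :: "'a ms4_frame" assume "G \<in> Ob DF_MS4"
  then interpret descriptive_ms4_frame G by (simp add: DF_MS4_def)
  show "skel_pullback G \<in> isomorphisms (Und MHA) (Und MHA) mha_arrows mha_arrows"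
    using skel_pullback_isomorphism by (simp add: MHA_def)
next
  fix G :: "'a ms4_frame"
  show "src (skel_pullback G) = (mipc_alg \<circ> skel) G" "tgt (skel_pullback G) = (opens \<circ> ms4_alg) G"
    by (simp_all add: skel_pullback_def)
next
  fix f :: "('a ms4_frame, 'a ms4_frame, 'a, 'a) arrow" assume "f \<in> Arr DF_MS4"
  then show "comp_arr (Und MHA) (skel_pullback (src f)) ((mipc_alg_arr \<circ> skel_arr) f) =
      comp_arr (Und MHA) ((opens_arr \<circ> ms4_alg_arr) f) (skel_pullback (tgt f))"
    using skel_pullback_natural by (simp add: DF_MS4_def MHA_def)
qed

section \<open>Ultrafilters of boolean algebras\<close>

lemma lattice_filterD:
  assumes "lattice_filter L F"
  shows "F \<subseteq> carrier L" "\<top>\<^bsub>L\<^esub> \<in> F"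
    "a \<in> F \<Longrightarrow> b \<in> F \<Longrightarrow> a \<sqinter>\<^bsub>L\<^esub> b \<in> F"
    "a \<in> F \<Longrightarrow> b \<in> carrier L \<Longrightarrow> a \<sqsubseteq>\<^bsub>L\<^esub> b \<Longrightarrow> b \<in> F"
  using assms by (auto simp: lattice_filter_def)

context boolean_alg
begin

lemma proper_filter_iff: "proper_filter B F \<longleftrightarrow> lattice_filter B F \<and> \<bottom> \<notin> F"
proof -
  have "F = carrier B" if "lattice_filter B F" "\<bottom> \<in> F"
    using lattice_filterD(1)[OF that(1)] lattice_filterD(4)[OF that] by blast
  then show ?thesis by (auto simp: proper_filter_def)
qed

lemma ultrafilter_extension:
  assumes F: "proper_filter B F"
  obtains x where "ultrafilter B x" "F \<subseteq> x"
proof -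
  let ?A = "{G. proper_filter B G \<and> F \<subseteq> G}"
  have "\<exists>M\<in>?A. \<forall>X\<in>?A. M \<subseteq> X \<longrightarrow> X = M"
  proof (rule subset_Zorn_nonempty)
    show "?A \<noteq> {}" using F by blast
    fix C assume ne: "C \<noteq> {}" and chain: "subset.chain ?A C"
    have C: "lattice_filter B G" "\<bottom> \<notin> G" "F \<subseteq> G" if "G \<in> C" for G
      using chain that by (auto simp: subset.chain_def proper_filter_iff)
    have "lattice_filter B (\<Union>C)"
      unfolding lattice_filter_def
    proof (intro conjI ballI impI)
      show "\<Union>C \<subseteq> carrier B" using lattice_filterD(1)[OF C(1)] by blast
      show "\<top> \<in> \<Union>C" using ne lattice_filterD(2)[OF C(1)] by blast
      fix a assume "a \<in> \<Union>C"
      then obtain G where G: "G \<in> C" "a \<in> G" by blast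
      show "b \<in> \<Union>C" if "b \<in> carrier B" "a \<sqsubseteq> b" for b
        using lattice_filterD(4)[OF C(1)[OF G(1)] G(2) that] G(1) by blast
      fix b assume "b \<in> \<Union>C"
      then obtain G' where G': "G' \<in> C" "b \<in> G'" by blast
      have "G \<subseteq> G' \<or> G' \<subseteq> G" using subset.chain_total[OF chain G(1) G'(1)] by blast
      then obtain K where "K \<in> C" "a \<in> K" "b \<in> K" using G G' by blast
      then show "a \<sqinter> b \<in> \<Union>C" using lattice_filterD(3)[OF C(1)] by blast
    qed
    moreover have "\<bottom> \<notin> \<Union>C" "F \<subseteq> \<Union>C" using C(2,3) ne by blast+
    ultimately show "\<Union>C \<in> ?A" by (simp add: proper_filter_iff)
  qed
  then obtain x where "x \<in> ?A" "\<forall>X\<in>?A. x \<subseteq> X \<longrightarrow> X = x" by blast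
  then show thesis using that[of x] by (auto simp: ultrafilter_def)
qed

context
  fixes x assumes x: "ultrafilter B x"
begin

lemma ultrafilter_filter: "lattice_filter B x" and bottom_notin_ultrafilter: "\<bottom> \<notin> x"
  using x by (auto simp: ultrafilter_def proper_filter_iff)

lemma ultrafilter_carrier: "a \<in> x \<Longrightarrow> a \<in> carrier B"
  and top_in_ultrafilter: "\<top> \<in> x"
  and ultrafilter_mono: "\<lbrakk>a \<in> x; a \<sqsubseteq> b; b \<in> carrier B\<rbrakk> \<Longrightarrow> b \<in> x"
  using lattice_filterD[OF ultrafilter_filter] by blast+

lemma meet_in_ultrafilter:
  assumes "a \<in> carrier B" "b \<in> carrier B"
  shows "a \<sqinter> b \<in> x \<longleftrightarrow> a \<in> x \<and> b \<in> x"
proof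
  assume ab: "a \<sqinter> b \<in> x"
  show "a \<in> x \<and> b \<in> x"
    using ultrafilter_mono[OF ab meet_left[OF assms]] ultrafilter_mono[OF ab meet_right[OF assms]] assms by simp
qed (use lattice_filterD(3)[OF ultrafilter_filter] in simp)

text \<open>
  If \<open>a \<notin> x\<close>, the filter generated by \<open>x\<close> and \<open>a\<close> is improper by maximality. So \<open>d \<sqinter> a = \<bottom>\<close> for some \<open>d \<in> x\<close>,
  and then \<open>d\<close> lies below the complement of \<open>a\<close>.
\<close>

lemma neg_in_ultrafilter:
  assumes a: "a \<in> carrier B"
  shows "neg B a \<in> x \<longleftrightarrow> a \<notin> x"
proof
  assume "neg B a \<in> x"
  then show "a \<notin> x"
    using meet_in_ultrafilter[OF a neg_closed[OF a]] meet_neg[OF a] bottom_notin_ultrafilter by auto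
next
  assume ax: "a \<notin> x"
  let ?G = "{c \<in> carrier B. \<exists>d\<in>x. d \<sqinter> a \<sqsubseteq> c}"
  have "lattice_filter B ?G"
    unfolding lattice_filter_def
  proof (intro conjI ballI impI)
    show "\<top> \<in> ?G" using top_in_ultrafilter top_higher[OF meet_closed[OF top_closed a]] by blast
    fix b assume "b \<in> ?G"
    then obtain d where d: "d \<in> x" "d \<sqinter> a \<sqsubseteq> b" "b \<in> carrier B" by blast
    then have dc: "d \<in> carrier B" using ultrafilter_carrier by blast
    show "c \<in> ?G" if "c \<in> carrier B" "b \<sqsubseteq> c" for c
      using that d dc a le_trans[of "d \<sqinter> a" b c] by auto
    fix c assume "c \<in> ?G"
    then obtain e where e: "e \<in> x" "e \<sqinter> a \<sqsubseteq> c" "c \<in> carrier B" by blast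
    then have ec: "e \<in> carrier B" using ultrafilter_carrier by blast
    let ?w = "(d \<sqinter> e) \<sqinter> a"
    have w: "?w \<in> carrier B" using dc ec a by simp
    have "?w \<sqsubseteq> a" "?w \<sqsubseteq> d \<sqinter> e" using dc ec a meet_left meet_right by simp_all
    then have "?w \<sqsubseteq> d" "?w \<sqsubseteq> e"
      using dc ec a w meet_left[OF dc ec] meet_right[OF dc ec] by (meson le_trans meet_closed)+
    then have "?w \<sqsubseteq> d \<sqinter> a" "?w \<sqsubseteq> e \<sqinter> a" using \<open>?w \<sqsubseteq> a\<close> dc ec a w meet_le by simp_all
    then have "?w \<sqsubseteq> b" "?w \<sqsubseteq> c" using d(2,3) e(2,3) dc ec a w by (meson le_trans meet_closed)+
    then have "?w \<sqsubseteq> b \<sqinter> c" using d e w meet_le by simp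
    moreover have "d \<sqinter> e \<in> x" using d e dc ec meet_in_ultrafilter by simp
    ultimately show "b \<sqinter> c \<in> ?G" using d e by auto
  qed blast
  moreover have "x \<subseteq> ?G" using ultrafilter_carrier a meet_left by blast
  moreover have "a \<in> ?G" using a top_in_ultrafilter meet_right by blast
  ultimately have "\<not> proper_filter B ?G"
    using x ax unfolding ultrafilter_def by blast
  then have "\<bottom> \<in> ?G" using \<open>lattice_filter B ?G\<close> proper_filter_iff by blast
  then obtain d where d: "d \<in> x" "d \<sqinter> a \<sqsubseteq> \<bottom>" by blast
  then have dc: "d \<in> carrier B" using ultrafilter_carrier by blast
  have n: "neg B a \<in> carrier B" using a by (rule neg_closed)
  have "d = d \<sqinter> \<top>" using le_iff_join[OF dc top_closed] top_higher[OF dc] by simp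
  also have "\<dots> = (d \<sqinter> a) \<squnion> (d \<sqinter> neg B a)" using distrib[OF dc a n] join_neg[OF a] by simp
  also have "\<dots> \<sqsubseteq> neg B a"
  proof (rule join_le)
    show "d \<sqinter> a \<sqsubseteq> neg B a" using le_trans[OF d(2) bottom_lower[OF n]] dc a n by simp
  qed (use dc a n meet_right in simp_all)
  finally show "neg B a \<in> x" using ultrafilter_mono d(1) n by blast
qed

lemma join_in_ultrafilter:
  assumes a: "a \<in> carrier B" and b: "b \<in> carrier B"
  shows "a \<squnion> b \<in> x \<longleftrightarrow> a \<in> x \<or> b \<in> x"
proof
  assume ab: "a \<squnion> b \<in> x"
  show "a \<in> x \<or> b \<in> x"
  proof (rule ccontr)
    assume "\<not> (a \<in> x \<or> b \<in> x)"
    then have "neg B a \<in> x" using a neg_in_ultrafilter by blast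
    then have "neg B a \<sqinter> (a \<squnion> b) \<in> x"
      using ab a b neg_closed meet_in_ultrafilter by simp
    moreover have "neg B a \<sqinter> (a \<squnion> b) = (neg B a \<sqinter> a) \<squnion> (neg B a \<sqinter> b)"
      using a b neg_closed distrib by simp
    moreover have "\<dots> \<sqsubseteq> b"
      using a b neg_closed meet_neg[OF a] meet_right by (intro join_le) (simp_all add: meet_comm[of B "neg B a" a])
    ultimately have "b \<in> x" using ultrafilter_mono[OF _ _ b] by simp
    then show False using \<open>\<not> (a \<in> x \<or> b \<in> x)\<close> by blast
  qed
qed (use a b ultrafilter_mono join_left join_right in auto)

end

lemma ultrafilterI:
  assumes "proper_filter B F" and "\<And>a. a \<in> carrier B \<Longrightarrow> a \<in> F \<or> neg B a \<in> F"
  shows "ultrafilter B F"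
  unfolding ultrafilter_def
proof (intro conjI allI impI assms(1))
  fix G assume G: "proper_filter B G" and FG: "F \<subseteq> G"
  have "a \<in> F" if "a \<in> G" for a
  proof (rule ccontr)
    assume "a \<notin> F"
    have a: "a \<in> carrier B" using G that by (auto simp: proper_filter_def lattice_filter_def)
    then have "neg B a \<in> G" using assms(2) FG \<open>a \<notin> F\<close> by blast
    then have "\<bottom> \<in> G" using G that meet_neg[OF a] lattice_filterD(3)[of B G a "neg B a"]
      by (simp add: proper_filter_def)
    then show False using G by (simp add: proper_filter_iff)
  qed
  then show "G = F" using FG by blast
qed

lemma ultrafilter_subset_eq:
  "ultrafilter B x \<Longrightarrow> ultrafilter B y \<Longrightarrow> x \<subseteq> y \<Longrightarrow> x = y"
  by (auto simp: ultrafilter_def)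

text \<open>
  The elements \<open>c\<close> with \<open>c \<squnion> i \<in> F\<close> for some \<open>i \<in> I\<close> form the filter generated by \<open>F\<close> and the complements
  of the elements of \<open>I\<close>. It is proper as \<open>F\<close> misses \<open>I\<close>, and an ultrafilter above it contains
  the complement of each element of \<open>I\<close>.
\<close>

lemma ultrafilter_avoiding:
  assumes F: "lattice_filter B F" and I: "I \<subseteq> carrier B" "I \<noteq> {}"
    and join: "\<And>a b. a \<in> I \<Longrightarrow> b \<in> I \<Longrightarrow> a \<squnion> b \<in> I"
    and disjoint: "F \<inter> I = {}"
  obtains x where "ultrafilter B x" "F \<subseteq> x" "x \<inter> I = {}"
proof -
  let ?G = "{c \<in> carrier B. \<exists>i\<in>I. c \<squnion> i \<in> F}"
  note FD = lattice_filterD[OF F]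
  have "lattice_filter B ?G"
    unfolding lattice_filter_def
  proof (intro conjI ballI impI)
    obtain i where "i \<in> I" using I by blast
    then show "\<top> \<in> ?G" using I FD(4)[OF FD(2), of "\<top> \<squnion> i"] join_left by auto
    fix c assume "c \<in> ?G"
    then obtain i where i: "i \<in> I" "c \<squnion> i \<in> F" "c \<in> carrier B" "i \<in> carrier B" using I by blast
    show "d \<in> ?G" if d: "d \<in> carrier B" "c \<sqsubseteq> d" for d
    proof -
      have "c \<sqsubseteq> d \<squnion> i" using le_trans[OF d(2) join_left] d i by simp
      then have "c \<squnion> i \<sqsubseteq> d \<squnion> i" using i d join_right by (intro join_le) simp_all
      then show ?thesis using FD(4)[OF i(2), of "d \<squnion> i"] i d by auto
    qed
    fix d assume "d \<in> ?G"
    then obtain j where j: "j \<in> I" "d \<squnion> j \<in> F" "d \<in> carrier B" "j \<in> carrier B" using I by blast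
    let ?k = "i \<squnion> j"
    have k: "?k \<in> carrier B" "?k \<in> I" using i j join by simp_all
    let ?w = "c \<sqinter> d \<squnion> ?k" and ?m = "(c \<squnion> i) \<sqinter> (d \<squnion> j)"
    have w: "?w \<in> carrier B" using i j k by simp
    have ci: "c \<squnion> i \<in> carrier B" using i by simp
    have kw: "?k \<sqsubseteq> ?w" "c \<sqinter> d \<sqsubseteq> ?w" using i j k join_left join_right by simp_all
    have iw: "i \<sqsubseteq> ?w" "j \<sqsubseteq> ?w"
      using kw(1) join_left[OF i(4) j(4)] join_right[OF i(4) j(4)] i j k w by (meson le_trans)+
    have "?m = (c \<squnion> i) \<sqinter> d \<squnion> (c \<squnion> i) \<sqinter> j" using distrib[OF ci] j by simp
    also have "(c \<squnion> i) \<sqinter> d = d \<sqinter> c \<squnion> d \<sqinter> i"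
      using distrib[of d c i] i j meet_comm[of B d "c \<squnion> i"] by simp
    finally have m: "?m = (d \<sqinter> c \<squnion> d \<sqinter> i) \<squnion> (c \<squnion> i) \<sqinter> j" .
    have "?m \<sqsubseteq> ?w"
      unfolding m
    proof (intro join_le)
      show "d \<sqinter> c \<sqsubseteq> ?w" using kw by (simp add: meet_comm[of B d c])
      show "d \<sqinter> i \<sqsubseteq> ?w" using le_trans[OF meet_right iw(1)] i j w by simp
      show "(c \<squnion> i) \<sqinter> j \<sqsubseteq> ?w" using le_trans[OF meet_right iw(2)] i j w by simp
    qed (use i j k in simp_all)
    moreover have "?m \<in> F" using FD(3) i j by simp
    ultimately have "?w \<in> F" using FD(4) w by blast
    then show "c \<sqinter> d \<in> ?G" using k i j by auto
  qed blast
  moreover have "\<bottom> \<notin> ?G"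
  proof
    assume "\<bottom> \<in> ?G"
    then obtain i where i: "i \<in> I" "\<bottom> \<squnion> i \<in> F" by blast
    then have "i \<in> carrier B" using I by blast
    then have "\<bottom> \<squnion> i \<sqsubseteq> i" by (intro join_le) simp_all
    then have "i \<in> F" using FD(4)[OF i(2)] \<open>i \<in> carrier B\<close> by simp
    then show False using i disjoint by blast
  qed
  ultimately have "proper_filter B ?G" using proper_filter_iff by blast
  then obtain x where x: "ultrafilter B x" "?G \<subseteq> x" by (rule ultrafilter_extension)
  show thesis
  proof
    show "ultrafilter B x" by (rule x)
    obtain i where i: "i \<in> I" using I by blast
    show "F \<subseteq> x"
    proof
      fix a assume a: "a \<in> F"
      then have "a \<in> carrier B" "i \<in> carrier B" using FD(1) I i by blast+
      then have "a \<squnion> i \<in> F" using FD(4)[OF a] join_left by simp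
      then show "a \<in> x" using x i \<open>a \<in> carrier B\<close> by blast
    qed
    show "x \<inter> I = {}"
    proof (rule ccontr)
      assume "x \<inter> I \<noteq> {}"
      then obtain j where j: "j \<in> x" "j \<in> I" by blast
      then have jc: "j \<in> carrier B" using I by blast
      have "neg B j \<squnion> j = \<top>" using join_neg[OF jc] by (simp add: join_comm[of B _ j])
      then have "neg B j \<squnion> j \<in> F" using FD(2) by simp
      then have "neg B j \<in> ?G" using j jc neg_closed by blast
      then have "neg B j \<in> x" using x(2) by blast
      then show False using neg_in_ultrafilter[OF x(1) jc] j by blast
    qed
  qed
qed

text \<open>
  Both \<open>\<box>\<close> and \<open>\<forall>\<close> are operators of this kind, and both relations of the dual frame have the form
  \<open>dual_relation\<close>, so that their continuity and their behaviour under homomorphisms are proved once.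
\<close>

definition normal_operator :: "('a \<Rightarrow> 'a) \<Rightarrow> bool" where
  "normal_operator m \<longleftrightarrow> m \<in> carrier B \<rightarrow> carrier B \<and> m \<top> = \<top> \<and>
    (\<forall>a\<in>carrier B. \<forall>b\<in>carrier B. m (a \<sqinter> b) = m a \<sqinter> m b)"

lemma normal_operator_mono:
  assumes m: "normal_operator m" and ab: "a \<in> carrier B" "b \<in> carrier B" "a \<sqsubseteq> b"
  shows "m a \<sqsubseteq> m b"
proof -
  have c: "m a \<in> carrier B" "m b \<in> carrier B" using m ab by (auto simp: normal_operator_def)
  have "m a = m (a \<sqinter> b)" using le_iff_join ab by simp
  also have "\<dots> = m a \<sqinter> m b" using m ab by (simp add: normal_operator_def)
  finally show ?thesis using meet_right[OF c] by simp
qed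

definition dual_relation :: "('a \<Rightarrow> 'a) \<Rightarrow> ('a set \<times> 'a set) set" where
  "dual_relation m = {(x, y). ultrafilter B x \<and> ultrafilter B y \<and> m -` x \<inter> carrier B \<subseteq> y}"

lemma normal_operator_filter:
  assumes m: "normal_operator m" and x: "ultrafilter B x"
  shows "lattice_filter B (m -` x \<inter> carrier B)"
  unfolding lattice_filter_def
proof (intro conjI ballI impI)
  have mc: "m a \<in> carrier B" if "a \<in> carrier B" for a using m that by (auto simp: normal_operator_def)
  show "\<top> \<in> m -` x \<inter> carrier B"
    using m top_in_ultrafilter[OF x] by (simp add: normal_operator_def)
  fix a assume a: "a \<in> m -` x \<inter> carrier B"
  show "b \<in> m -` x \<inter> carrier B" if "b \<in> carrier B" "a \<sqsubseteq> b" for b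
    using a that normal_operator_mono[OF m] ultrafilter_mono[OF x] mc by auto
  fix b assume b: "b \<in> m -` x \<inter> carrier B"
  then show "a \<sqinter> b \<in> m -` x \<inter> carrier B"
    using a m meet_in_ultrafilter[OF x] mc by (simp add: normal_operator_def)
qed blast

text \<open>
  The existence half of the duality: \<open>x\<close> has a successor avoiding \<open>I\<close> as soon as no element of \<open>I\<close> is
  necessary at \<open>x\<close>.
\<close>

lemma dual_relation_avoiding:
  assumes m: "normal_operator m" and x: "ultrafilter B x"
    and I: "I \<subseteq> carrier B" "I \<noteq> {}" "\<And>a b. a \<in> I \<Longrightarrow> b \<in> I \<Longrightarrow> a \<squnion> b \<in> I"
    and disjoint: "\<And>a. a \<in> I \<Longrightarrow> m a \<notin> x"
  obtains y where "(x, y) \<in> dual_relation m" "y \<inter> I = {}"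
proof -
  have "(m -` x \<inter> carrier B) \<inter> I = {}" using disjoint by blast
  then obtain y where "ultrafilter B y" "m -` x \<inter> carrier B \<subseteq> y" "y \<inter> I = {}"
    using ultrafilter_avoiding[OF normal_operator_filter[OF m x] I] by metis
  then show thesis using that x by (auto simp: dual_relation_def)
qed

lemma dual_relation_possibility:
  assumes m: "normal_operator m" and a: "a \<in> carrier B" and x: "ultrafilter B x"
  shows "(\<exists>y. (x, y) \<in> dual_relation m \<and> a \<in> y) \<longleftrightarrow> neg B (m (neg B a)) \<in> x"
proof -
  have n: "neg B a \<in> carrier B" "m (neg B a) \<in> carrier B"
    using a m neg_closed by (auto simp: normal_operator_def)
  show ?thesis
  proof
    assume "\<exists>y. (x, y) \<in> dual_relation m \<and> a \<in> y"
    then obtain y where y: "(x, y) \<in> dual_relation m" "a \<in> y" by blast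
    then have "m (neg B a) \<notin> x"
      using neg_in_ultrafilter[OF _ a, of y] n by (auto simp: dual_relation_def)
    then show "neg B (m (neg B a)) \<in> x" using neg_in_ultrafilter[OF x n(2)] by blast
  next
    assume "neg B (m (neg B a)) \<in> x"
    then have nx: "m (neg B a) \<notin> x" using neg_in_ultrafilter[OF x n(2)] by blast
    have "neg B a \<squnion> neg B a = neg B a" using le_iff_meet[OF n(1) n(1)] n by simp
    then obtain y where "(x, y) \<in> dual_relation m" "y \<inter> {neg B a} = {}"
      using dual_relation_avoiding[OF m x, of "{neg B a}"] n nx by auto
    moreover from this have "a \<in> y" using neg_in_ultrafilter[OF _ a, of y] by (auto simp: dual_relation_def)
    ultimately show "\<exists>y. (x, y) \<in> dual_relation m \<and> a \<in> y" by blast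
  qed
qed

end

section \<open>The dual frame of an MS4-algebra\<close>

locale ms4_duality = ms4_algebra B for B :: "'a ms4" (structure)
begin

abbreviation "T \<equiv> ms4_space (ms4_dual B)"

lemma in_ultrafilters_of: "x \<in> ultrafilters_of B a \<longleftrightarrow> ultrafilter B x \<and> a \<in> x"
  by (simp add: ultrafilters_of_def)

lemma topspace_dual: "topspace T = {x. ultrafilter B x}"
proof -
  have "topspace T = \<Union>(ultrafilters_of B ` carrier B)" by (simp add: ms4_dual_def)
  also have "\<dots> = {x. ultrafilter B x}"
    using top_in_ultrafilter by (auto simp: in_ultrafilters_of)
  finally show ?thesis .
qed

lemma ultrafilters_of_meet: "\<lbrakk>a \<in> carrier B; b \<in> carrier B\<rbrakk> \<Longrightarrow>
    ultrafilters_of B (a \<sqinter> b) = ultrafilters_of B a \<inter> ultrafilters_of B b"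
  and ultrafilters_of_join: "\<lbrakk>a \<in> carrier B; b \<in> carrier B\<rbrakk> \<Longrightarrow>
    ultrafilters_of B (a \<squnion> b) = ultrafilters_of B a \<union> ultrafilters_of B b"
  and ultrafilters_of_neg: "a \<in> carrier B \<Longrightarrow>
    ultrafilters_of B (neg B a) = topspace T - ultrafilters_of B a"
  and ultrafilters_of_bottom: "ultrafilters_of B \<bottom> = {}"
  by (auto simp: in_ultrafilters_of topspace_dual meet_in_ultrafilter join_in_ultrafilter
      neg_in_ultrafilter bottom_notin_ultrafilter)

lemma clopen_ultrafilters_of: "a \<in> carrier B \<Longrightarrow> clopen_in T (ultrafilters_of B a)"
proof -
  have o: "openin T (ultrafilters_of B b)" if "b \<in> carrier B" for b
    using that by (auto simp: ms4_dual_def intro: topology_generated_by_Basis)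
  assume a: "a \<in> carrier B"
  have "ultrafilters_of B a \<subseteq> topspace T" by (auto simp: topspace_dual in_ultrafilters_of)
  then have "closedin T (ultrafilters_of B a)"
    using o[OF neg_closed[OF a]] by (simp add: closedin_def ultrafilters_of_neg[OF a])
  then show ?thesis using o[OF a] by (simp add: clopen_in_def)
qed

lemma openin_dual_basis:
  assumes "openin T U" "x \<in> U"
  shows "\<exists>a\<in>carrier B. x \<in> ultrafilters_of B a \<and> ultrafilters_of B a \<subseteq> U"
proof -
  have "generate_topology_on (ultrafilters_of B ` carrier B) U"
    using assms(1) by (simp add: ms4_dual_def openin_topology_generated_by_iff)
  then show ?thesis using assms(2)
  proof (induction U arbitrary: x)
    case (Int U V)
    then obtain a b where a: "a \<in> carrier B" "x \<in> ultrafilters_of B a" "ultrafilters_of B a \<subseteq> U"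
      and b: "b \<in> carrier B" "x \<in> ultrafilters_of B b" "ultrafilters_of B b \<subseteq> V"
      by (metis IntD1 IntD2)
    then show ?case
      by (intro bexI[of _ "a \<sqinter> b"]) (auto simp: ultrafilters_of_meet)
  next
    case (UN K)
    then obtain k where k: "k \<in> K" "x \<in> k" by blast
    then obtain a where "a \<in> carrier B" "x \<in> ultrafilters_of B a" "ultrafilters_of B a \<subseteq> k"
      using UN.IH by blast
    then show ?case using k by blast
  qed auto
qed

text \<open>
  The elements \<open>a\<close> whose clopen set is covered by a finite part of \<open>K\<close> are closed under joins. If there
  were no finite subcover, \<open>\<top>\<close> would not be among them, and an ultrafilter avoiding all of them would lie
  in no member of \<open>K\<close>.
\<close>

lemma cover_finite_subcover:
  assumes "\<And>U. U \<in> K \<Longrightarrow> openin T U" "topspace T \<subseteq> \<Union>K"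
  shows "\<exists>K'. finite K' \<and> K' \<subseteq> K \<and> topspace T \<subseteq> \<Union>K'"
proof (rule ccontr)
  assume no_subcover: "\<not> ?thesis"
  let ?I = "{a \<in> carrier B. \<exists>K'. finite K' \<and> K' \<subseteq> K \<and> ultrafilters_of B a \<subseteq> \<Union>K'}"
  have "\<top> \<sqinter> \<top> = \<top>" using le_iff_join[OF top_closed top_closed] by simp
  then have "lattice_filter B {\<top>}"
    using top_higher by (auto simp: lattice_filter_def intro: le_antisym)
  moreover have "?I \<subseteq> carrier B" by blast
  moreover have "\<bottom> \<in> ?I" using ultrafilters_of_bottom by auto
  then have "?I \<noteq> {}" by blast
  moreover have "a \<squnion> b \<in> ?I" if a: "a \<in> ?I" and b: "b \<in> ?I" for a b
  proof -
    obtain K1 K2 where "finite K1" "K1 \<subseteq> K" "ultrafilters_of B a \<subseteq> \<Union>K1"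
      "finite K2" "K2 \<subseteq> K" "ultrafilters_of B b \<subseteq> \<Union>K2" using a b by blast
    then have "finite (K1 \<union> K2) \<and> K1 \<union> K2 \<subseteq> K \<and> ultrafilters_of B (a \<squnion> b) \<subseteq> \<Union>(K1 \<union> K2)"
      using a b by (auto simp: ultrafilters_of_join)
    then show ?thesis using a b join_closed by blast
  qed
  moreover have "ultrafilters_of B \<top> = topspace T"
    using top_in_ultrafilter by (auto simp: in_ultrafilters_of topspace_dual)
  then have "{\<top>} \<inter> ?I = {}" using no_subcover by auto
  ultimately obtain x where x: "ultrafilter B x" "x \<inter> ?I = {}"
    by (rule ultrafilter_avoiding) 
  then obtain U where U: "U \<in> K" "x \<in> U" using assms(2) topspace_dual by blast
  then obtain a where a: "a \<in> carrier B" "x \<in> ultrafilters_of B a" "ultrafilters_of B a \<subseteq> U"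
    using openin_dual_basis[OF assms(1)] by blast
  then have "ultrafilters_of B a \<subseteq> \<Union>{U}" "finite {U}" "{U} \<subseteq> K" using U by auto
  then have "a \<in> ?I" using a(1) by blast
  then show False using x a by (auto simp: in_ultrafilters_of)
qed

lemma compact_dual: "compact_space T"
  unfolding compact_space_alt using cover_finite_subcover by blast

lemma Stone_dual: "Stone_space T"
proof (rule Stone_space_if_clopens_separate[OF compact_dual])
  fix x y assume "x \<in> topspace T" "y \<in> topspace T" "x \<noteq> y"
  then have xy: "ultrafilter B x" "ultrafilter B y" "\<not> x \<subseteq> y"
    using ultrafilter_subset_eq by (auto simp: topspace_dual)
  then obtain a where a: "a \<in> x" "a \<notin> y" by blast
  then have "a \<in> carrier B" using ultrafilter_carrier[OF xy(1)] by blast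
  then show "\<exists>U. clopen_in T U \<and> x \<in> U \<and> y \<notin> U"
    using clopen_ultrafilters_of a xy by (intro exI[of _ "ultrafilters_of B a"]) (auto simp: in_ultrafilters_of)
qed

text \<open>
  By compactness a clopen set is a finite union of basic ones, and the basic ones are closed under
  finite unions.
\<close>

lemma clopen_dualE:
  assumes "clopen_in T U"
  obtains a where "a \<in> carrier B" "U = ultrafilters_of B a"
proof -
  have "compactin T U" using assms compact_dual by (simp add: clopen_in_def closedin_compact_space)
  moreover let ?K = "{ultrafilters_of B a |a. a \<in> carrier B \<and> ultrafilters_of B a \<subseteq> U}"
  have "U \<subseteq> \<Union>?K" using openin_dual_basis[of U] assms by (auto simp: clopen_in_def) blast
  moreover have "openin T V" if "V \<in> ?K" for V
    using that clopen_ultrafilters_of by (auto simp: clopen_in_def)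
  ultimately obtain K where K: "finite K" "K \<subseteq> ?K" "U \<subseteq> \<Union>K"
    by (metis (no_types, lifting) compactinD)
  from K(1,2) have "\<exists>a\<in>carrier B. \<Union>K = ultrafilters_of B a"
  proof (induction K rule: finite_induct)
    case empty
    show ?case using ultrafilters_of_bottom by (auto intro!: bexI[of _ \<bottom>])
  next
    case (insert V K)
    then obtain a b where "a \<in> carrier B" "\<Union>K = ultrafilters_of B a" "b \<in> carrier B" "V = ultrafilters_of B b"
      by auto
    then show ?case by (intro bexI[of _ "b \<squnion> a"]) (auto simp: ultrafilters_of_join)
  qed
  moreover have "\<Union>K = U" using K by blast
  ultimately show thesis using that by blast
qed

lemma dual_relation_continuous:
  assumes m: "normal_operator m"
  shows "continuous_relation T (dual_relation m)"
  unfolding continuous_relation_def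
proof (intro conjI ballI allI impI)
  show "dual_relation m \<subseteq> topspace T \<times> topspace T" by (auto simp: dual_relation_def topspace_dual)
next
  fix x assume "x \<in> topspace T"
  then have x: "ultrafilter B x" by (simp add: topspace_dual)
  let ?K = "{ultrafilters_of B a |a. a \<in> carrier B \<and> m a \<in> x}"
  have "\<top> \<in> carrier B \<and> m \<top> \<in> x" using m top_in_ultrafilter[OF x] by (simp add: normal_operator_def)
  then have ne: "?K \<noteq> {}" by blast
  have "dual_relation m `` {x} = \<Inter>?K"
  proof
    show "dual_relation m `` {x} \<subseteq> \<Inter>?K" by (auto simp: dual_relation_def in_ultrafilters_of)
    show "\<Inter>?K \<subseteq> dual_relation m `` {x}"
    proof
      fix y assume y: "y \<in> \<Inter>?K"
      then have "ultrafilter B y" using ne by (auto simp: in_ultrafilters_of)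
      moreover have "a \<in> y" if "a \<in> carrier B" "m a \<in> x" for a
        using y that by (auto simp: in_ultrafilters_of)
      ultimately show "y \<in> dual_relation m `` {x}" using x by (auto simp: dual_relation_def)
    qed
  qed
  moreover have "closedin T (\<Inter>?K)"
    using ne clopen_ultrafilters_of by (intro closedin_Inter) (auto simp: clopen_in_def)
  ultimately show "closedin T (dual_relation m `` {x})" by simp
next
  fix U assume "clopen_in T U"
  then obtain a where a: "a \<in> carrier B" "U = ultrafilters_of B a" by (rule clopen_dualE)
  have "(dual_relation m)\<inverse> `` U = {x. ultrafilter B x \<and> (\<exists>y. (x, y) \<in> dual_relation m \<and> a \<in> y)}"
    by (auto simp: a(2) in_ultrafilters_of dual_relation_def)
  also have "\<dots> = ultrafilters_of B (neg B (m (neg B a)))"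
    using dual_relation_possibility[OF m a(1)] unfolding in_ultrafilters_of[symmetric]
    by (intro Set.set_eqI) (simp add: in_ultrafilters_of cong: conj_cong)
  finally have *: "(dual_relation m)\<inverse> `` U = ultrafilters_of B (neg B (m (neg B a)))" .
  have "m (neg B a) \<in> carrier B" using neg_closed[OF a(1)] m by (auto simp: normal_operator_def)
  then show "clopen_in T ((dual_relation m)\<inverse> `` U)"
    unfolding * by (intro clopen_ultrafilters_of neg_closed)
qed

lemma normal_box: "normal_operator (box B)" and normal_all: "normal_operator (ms4_all B)"
  using box_closed box_top box_meet all_closed all_top all_meet by (auto simp: normal_operator_def)

lemma all_idem: "a \<in> carrier B \<Longrightarrow> ms4_all B (ms4_all B a) = ms4_all B a"
  using all_trans all_decr all_closed by (intro le_antisym) simp_all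

lemma box_idem: "a \<in> carrier B \<Longrightarrow> box B (box B a) = box B a"
  using box_trans box_decr box_closed by (intro le_antisym) simp_all

text \<open>
  The subalgebra \<open>B\<^sub>0\<close> of elements of the form \<open>\<forall>a\<close>. It is closed under complements, joins and \<open>\<box>\<close>.
\<close>

definition all_fixpoints :: "'a set" where
  "all_fixpoints = {a \<in> carrier B. ms4_all B a = a}"

lemma range_all: "ms4_all B ` carrier B = all_fixpoints"
  using all_closed all_idem by (force simp: all_fixpoints_def)

lemma all_fixpoints_carrier: "a \<in> all_fixpoints \<Longrightarrow> a \<in> carrier B"
  by (simp add: all_fixpoints_def)

lemma all_fixpoints_neg:
  assumes "a \<in> all_fixpoints"
  shows "neg B a \<in> all_fixpoints"
  using assms all_sym[of a] all_decr[of "neg B a"] all_closed neg_closed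
  by (auto simp: all_fixpoints_def intro!: le_antisym)

lemma all_fixpoints_join:
  assumes a: "a \<in> all_fixpoints" and b: "b \<in> all_fixpoints"
  shows "a \<squnion> b \<in> all_fixpoints"
proof -
  have c: "a \<in> carrier B" "b \<in> carrier B" using a b by (auto simp: all_fixpoints_def)
  have "a \<sqsubseteq> ms4_all B (a \<squnion> b)" "b \<sqsubseteq> ms4_all B (a \<squnion> b)"
    using normal_operator_mono[OF normal_all, of a "a \<squnion> b"] normal_operator_mono[OF normal_all, of b "a \<squnion> b"]
      a b c join_left join_right by (auto simp: all_fixpoints_def)
  then have "a \<squnion> b \<sqsubseteq> ms4_all B (a \<squnion> b)" using c all_closed by (intro join_le) simp_all
  then show ?thesis using c all_closed all_decr by (auto simp: all_fixpoints_def intro: le_antisym)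
qed

lemma all_fixpoints_box:
  assumes "a \<in> all_fixpoints"
  shows "box B a \<in> all_fixpoints"
  using assms box_all[of a] all_decr[of "box B a"] box_closed all_closed
  by (auto simp: all_fixpoints_def intro!: le_antisym)

lemma all_fixpoints_bottom: "\<bottom> \<in> all_fixpoints"
  using all_decr[of \<bottom>] bottom_lower[of "ms4_all B \<bottom>"] all_closed
  by (auto simp: all_fixpoints_def intro!: le_antisym)

text \<open>
  One inclusion is enough because \<open>B\<^sub>0\<close> is closed under complements.
\<close>

lemma all_fixpoints_eqI:
  assumes x: "ultrafilter B x" and y: "ultrafilter B y" and sub: "x \<inter> all_fixpoints \<subseteq> y"
  shows "x \<inter> all_fixpoints = y \<inter> all_fixpoints"
proof -
  have "a \<in> x" if "a \<in> y" "a \<in> all_fixpoints" for a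
  proof (rule ccontr)
    assume "a \<notin> x"
    then have "neg B a \<in> x \<inter> all_fixpoints"
      using that all_fixpoints_neg neg_in_ultrafilter[OF x] all_fixpoints_carrier by blast
    then show False using sub that neg_in_ultrafilter[OF y] all_fixpoints_carrier by blast
  qed
  then show ?thesis using sub by blast
qed

lemma dual_R: "ms4_R (ms4_dual B) = dual_relation (box B)"
  by (simp add: ms4_dual_def dual_relation_def)

lemma dual_E_iff: "(x, y) \<in> ms4_E (ms4_dual B) \<longleftrightarrow>
    ultrafilter B x \<and> ultrafilter B y \<and> x \<inter> all_fixpoints = y \<inter> all_fixpoints"
  by (simp add: ms4_dual_def range_all)

text \<open>
  An element \<open>a\<close> of \<open>B\<^sub>0\<close> equals \<open>\<forall>a\<close>, so agreeing on \<open>B\<^sub>0\<close> is the same as \<open>\<forall>a \<in> x\<close> implying \<open>a \<in> y\<close>.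
\<close>

lemma dual_E: "ms4_E (ms4_dual B) = dual_relation (ms4_all B)"
proof (intro Set.set_eqI, clarify)
  fix x y
  show "(x, y) \<in> ms4_E (ms4_dual B) \<longleftrightarrow> (x, y) \<in> dual_relation (ms4_all B)"
  proof
    assume "(x, y) \<in> ms4_E (ms4_dual B)"
    then have xy: "ultrafilter B x" "ultrafilter B y" "x \<inter> all_fixpoints = y \<inter> all_fixpoints"
      by (simp_all add: dual_E_iff)
    have "a \<in> y" if a: "a \<in> carrier B" "ms4_all B a \<in> x" for a
    proof -
      have "ms4_all B a \<in> y" using a xy range_all by blast
      then show ?thesis using ultrafilter_mono[OF xy(2) _ all_decr] a by blast
    qed
    then show "(x, y) \<in> dual_relation (ms4_all B)" using xy by (auto simp: dual_relation_def)
  next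
    assume "(x, y) \<in> dual_relation (ms4_all B)"
    then have xy: "ultrafilter B x" "ultrafilter B y" "x \<inter> all_fixpoints \<subseteq> y"
      by (auto simp: dual_relation_def all_fixpoints_def)
    then show "(x, y) \<in> ms4_E (ms4_dual B)" using all_fixpoints_eqI[OF xy] by (simp only: dual_E_iff simp_thms)
  qed
qed

text \<open>
  A point \<open>y\<close> with \<open>x R y\<close> and \<open>y E z\<close> is a successor of \<open>x\<close> avoiding the elements of \<open>B\<^sub>0\<close> outside \<open>z\<close>.
  This criterion yields both the commutation condition of the dual frame and the description of \<open>Q\<close>
  on the prime filters of open elements.
\<close>

lemma R_E_iff:
  assumes x: "ultrafilter B x" and z: "ultrafilter B z"
  shows "(x, z) \<in> ms4_R (ms4_dual B) O ms4_E (ms4_dual B) \<longleftrightarrow> (\<forall>a\<in>all_fixpoints. box B a \<in> x \<longrightarrow> a \<in> z)"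
proof
  assume "(x, z) \<in> ms4_R (ms4_dual B) O ms4_E (ms4_dual B)"
  then obtain y where y: "(x, y) \<in> dual_relation (box B)" "y \<inter> all_fixpoints = z \<inter> all_fixpoints"
    by (auto simp: dual_R dual_E_iff)
  then show "\<forall>a\<in>all_fixpoints. box B a \<in> x \<longrightarrow> a \<in> z" by (auto simp: dual_relation_def all_fixpoints_def)
next
  assume *: "\<forall>a\<in>all_fixpoints. box B a \<in> x \<longrightarrow> a \<in> z"
  obtain y where y: "(x, y) \<in> dual_relation (box B)" "y \<inter> (all_fixpoints - z) = {}"
  proof (rule dual_relation_avoiding[OF normal_box x])
    show "all_fixpoints - z \<subseteq> carrier B" using all_fixpoints_carrier by blast
    show "all_fixpoints - z \<noteq> {}" using all_fixpoints_bottom bottom_notin_ultrafilter[OF z] by blast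
    show "a \<squnion> b \<in> all_fixpoints - z" if "a \<in> all_fixpoints - z" "b \<in> all_fixpoints - z" for a b
      using that all_fixpoints_join join_in_ultrafilter[OF z] all_fixpoints_carrier by auto
    show "box B a \<notin> x" if "a \<in> all_fixpoints - z" for a using that * by blast
  qed
  then have "(y, z) \<in> ms4_E (ms4_dual B)"
    using z all_fixpoints_eqI[of y z] by (auto simp: dual_E_iff dual_relation_def)
  then show "(x, z) \<in> ms4_R (ms4_dual B) O ms4_E (ms4_dual B)" using y by (auto simp: dual_R)
qed

theorem descriptive_ms4_dual: "descriptive_ms4_frame (ms4_dual B)"
proof
  show "Stone_space T" by (rule Stone_dual)
  show "continuous_relation T (ms4_R (ms4_dual B))" "continuous_relation T (ms4_E (ms4_dual B))"
    unfolding dual_R dual_E using normal_box normal_all by (simp_all add: dual_relation_continuous)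
  have "refl_on (topspace T) (ms4_R (ms4_dual B))"
    using ultrafilter_mono box_decr by (auto simp: refl_on_def dual_R dual_relation_def topspace_dual)
  moreover have "trans (ms4_R (ms4_dual B))"
  proof (rule transI)
    fix x y z assume "(x, y) \<in> ms4_R (ms4_dual B)" "(y, z) \<in> ms4_R (ms4_dual B)"
    then have xyz: "(x, y) \<in> dual_relation (box B)" "(y, z) \<in> dual_relation (box B)" by (simp_all add: dual_R)
    have "a \<in> z" if a: "a \<in> carrier B" "box B a \<in> x" for a
    proof -
      have "box B a \<in> y" using xyz(1) a box_closed by (auto simp: dual_relation_def box_idem)
      then show ?thesis using xyz(2) a by (auto simp: dual_relation_def)
    qed
    then show "(x, z) \<in> ms4_R (ms4_dual B)" using xyz by (auto simp: dual_R dual_relation_def)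
  qed
  ultimately show "preorder_on (topspace T) (ms4_R (ms4_dual B))"
    unfolding preorder_on_def by (auto simp: dual_R dual_relation_def topspace_dual)
  show "equiv (topspace T) (ms4_E (ms4_dual B))"
    by (rule equivI) (auto simp: topspace_dual dual_E_iff refl_on_def intro!: symI transI)
  show "\<exists>u. (x, u) \<in> ms4_R (ms4_dual B) \<and> (u, z) \<in> ms4_E (ms4_dual B)"
    if xy: "(x, y) \<in> ms4_E (ms4_dual B)" and yz: "(y, z) \<in> ms4_R (ms4_dual B)" for x y z
  proof -
    have uf: "ultrafilter B x" "ultrafilter B z" using xy yz by (auto simp: dual_E_iff dual_R dual_relation_def)
    have "a \<in> z" if a: "a \<in> all_fixpoints" "box B a \<in> x" for a
    proof -
      have "box B a \<in> y" using a all_fixpoints_box xy by (auto simp: dual_E_iff)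
      then show ?thesis using yz a all_fixpoints_carrier by (auto simp: dual_R dual_relation_def)
    qed
    then show ?thesis using R_E_iff[OF uf] by blast
  qed
qed

end

section \<open>Duals of homomorphisms\<close>

locale ms4_homomorphism = A: ms4_duality A + B: ms4_duality B for A :: "'a ms4" and B :: "'b ms4" +
  fixes h :: "'a \<Rightarrow> 'b"
  assumes hom: "ms4_hom A B h"
begin

lemma h_closed: "a \<in> carrier A \<Longrightarrow> h a \<in> carrier B"
  and h_bottom: "h \<bottom>\<^bsub>A\<^esub> = \<bottom>\<^bsub>B\<^esub>" and h_top: "h \<top>\<^bsub>A\<^esub> = \<top>\<^bsub>B\<^esub>"
  and h_meet: "\<lbrakk>a \<in> carrier A; b \<in> carrier A\<rbrakk> \<Longrightarrow> h (a \<sqinter>\<^bsub>A\<^esub> b) = h a \<sqinter>\<^bsub>B\<^esub> h b"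
  and h_join: "\<lbrakk>a \<in> carrier A; b \<in> carrier A\<rbrakk> \<Longrightarrow> h (a \<squnion>\<^bsub>A\<^esub> b) = h a \<squnion>\<^bsub>B\<^esub> h b"
  and h_neg: "a \<in> carrier A \<Longrightarrow> h (neg A a) = neg B (h a)"
  and h_box: "a \<in> carrier A \<Longrightarrow> h (box A a) = box B (h a)"
  and h_all: "a \<in> carrier A \<Longrightarrow> h (ms4_all A a) = ms4_all B (h a)"
  using hom by (auto simp: ms4_hom_def lattice_hom_def)

lemma h_mono:
  assumes "a \<in> carrier A" "b \<in> carrier A" "a \<sqsubseteq>\<^bsub>A\<^esub> b"
  shows "h a \<sqsubseteq>\<^bsub>B\<^esub> h b"
proof -
  have "h a = h a \<sqinter>\<^bsub>B\<^esub> h b" using A.le_iff_join assms h_meet by metis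
  then show ?thesis using B.le_iff_join[OF h_closed h_closed] assms by blast
qed

abbreviation "hinv x \<equiv> h -` x \<inter> carrier A"

lemma preimage_ultrafilter:
  assumes x: "ultrafilter B x"
  shows "ultrafilter A (hinv x)"
proof (rule A.ultrafilterI)
  show "proper_filter A (hinv x)"
    unfolding A.proper_filter_iff lattice_filter_def
    using B.top_in_ultrafilter[OF x] B.bottom_notin_ultrafilter[OF x] B.meet_in_ultrafilter[OF x]
      B.ultrafilter_mono[OF x] h_closed h_mono
    by (auto simp: h_top h_bottom h_meet)
  show "a \<in> hinv x \<or> neg A a \<in> hinv x" if "a \<in> carrier A" for a
    using that B.neg_in_ultrafilter[OF x] h_closed A.neg_closed by (auto simp: h_neg)
qed

text \<open>
  The back condition: a successor \<open>z\<close> of the preimage of \<open>x\<close> lifts to a successor \<open>y\<close> of \<open>x\<close> that avoids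
  the image of the complement of \<open>z\<close>. Then the preimage of \<open>y\<close> is contained in \<open>z\<close>, and ultrafilters
  are maximal.
\<close>

lemma dual_relation_image:
  assumes m: "A.normal_operator m" and n: "B.normal_operator n"
    and hm: "\<And>a. a \<in> carrier A \<Longrightarrow> h (m a) = n (h a)"
    and x: "ultrafilter B x"
  shows "A.dual_relation m `` {hinv x} = hinv ` (B.dual_relation n `` {x})"
proof
  show "hinv ` (B.dual_relation n `` {x}) \<subseteq> A.dual_relation m `` {hinv x}"
    using x preimage_ultrafilter hm h_closed by (auto simp: A.dual_relation_def B.dual_relation_def)
  show "A.dual_relation m `` {hinv x} \<subseteq> hinv ` (B.dual_relation n `` {x})"
  proof
    fix z assume "z \<in> A.dual_relation m `` {hinv x}"
    then have z: "ultrafilter A z" "m -` hinv x \<inter> carrier A \<subseteq> z" by (auto simp: A.dual_relation_def)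
    obtain y where y: "(x, y) \<in> B.dual_relation n" "y \<inter> h ` (carrier A - z) = {}"
    proof (rule B.dual_relation_avoiding[OF n x])
      show "h ` (carrier A - z) \<subseteq> carrier B" using h_closed by blast
      show "h ` (carrier A - z) \<noteq> {}" using A.bottom_notin_ultrafilter[OF z(1)] A.bottom_closed by blast
      show "a \<squnion>\<^bsub>B\<^esub> b \<in> h ` (carrier A - z)"
        if ab: "a \<in> h ` (carrier A - z)" "b \<in> h ` (carrier A - z)" for a b
      proof -
        obtain c d where "a = h c" "b = h d" "c \<in> carrier A - z" "d \<in> carrier A - z" using ab by blast
        then show ?thesis
          using A.join_in_ultrafilter[OF z(1)] h_join by (intro image_eqI[of _ _ "c \<squnion>\<^bsub>A\<^esub> d"]) auto
      qed
      show "n a \<notin> x" if a: "a \<in> h ` (carrier A - z)" for a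
      proof
        assume "n a \<in> x"
        obtain c where c: "a = h c" "c \<in> carrier A" "c \<notin> z" using a by blast
        then have "c \<in> m -` hinv x \<inter> carrier A"
          using \<open>n a \<in> x\<close> hm m by (auto simp: A.normal_operator_def)
        then show False using z(2) c by blast
      qed
    qed
    have uy: "ultrafilter B y" using y by (auto simp: B.dual_relation_def)
    have "hinv y \<subseteq> z" using y(2) by blast
    then have "hinv y = z" using A.ultrafilter_subset_eq[OF preimage_ultrafilter[OF uy] z(1)] by blast
    then show "z \<in> hinv ` (B.dual_relation n `` {x})" using y(1) by blast
  qed
qed

lemma preimage_ms4_mor: "ms4_mor (ms4_dual B) (ms4_dual A) (\<lambda>x\<in>topspace B.T. hinv x)"
  unfolding ms4_mor_def
proof (intro conjI ballI)
  show "continuous_map B.T A.T (\<lambda>x\<in>topspace B.T. hinv x)"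
  proof (unfold continuous_map, intro conjI allI impI)
    show "(\<lambda>x\<in>topspace B.T. hinv x) ` topspace B.T \<subseteq> topspace A.T"
      using preimage_ultrafilter by (auto simp: A.topspace_dual B.topspace_dual)
    fix U assume U: "openin A.T U"
    show "openin B.T {x \<in> topspace B.T. (\<lambda>x\<in>topspace B.T. hinv x) x \<in> U}"
    proof (subst openin_subopen, safe)
      fix x assume x: "x \<in> topspace B.T" and xU: "(\<lambda>x\<in>topspace B.T. hinv x) x \<in> U"
      then obtain a where a: "a \<in> carrier A" "hinv x \<in> ultrafilters_of A a" "ultrafilters_of A a \<subseteq> U"
        using A.openin_dual_basis[OF U, of "hinv x"] by auto
      have sub: "ultrafilters_of B (h a) \<subseteq> {x \<in> topspace B.T. (\<lambda>x\<in>topspace B.T. hinv x) x \<in> U}"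
      proof
        fix y assume "y \<in> ultrafilters_of B (h a)"
        then have y: "ultrafilter B y" "h a \<in> y" by (auto simp: B.in_ultrafilters_of)
        then have "hinv y \<in> ultrafilters_of A a"
          using preimage_ultrafilter a by (simp add: A.in_ultrafilters_of)
        then show "y \<in> {x \<in> topspace B.T. (\<lambda>x\<in>topspace B.T. hinv x) x \<in> U}"
          using a(3) y by (auto simp: B.topspace_dual)
      qed
      show "\<exists>V. openin B.T V \<and> x \<in> V \<and> V \<subseteq> {x \<in> topspace B.T. (\<lambda>x\<in>topspace B.T. hinv x) x \<in> U}"
        using sub a x B.clopen_ultrafilters_of[OF h_closed[OF a(1)]]
        by (intro exI[of _ "ultrafilters_of B (h a)"])
          (auto simp: clopen_in_def B.in_ultrafilters_of A.in_ultrafilters_of B.topspace_dual)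
    qed
  qed
  fix x assume "x \<in> topspace B.T"
  then have x: "ultrafilter B x" by (simp add: B.topspace_dual)
  have r: "(\<lambda>x\<in>topspace B.T. hinv x) ` (B.dual_relation n `` {x}) = hinv ` (B.dual_relation n `` {x})" for n
    by (rule image_cong) (auto simp: B.dual_relation_def B.topspace_dual)
  show "ms4_R (ms4_dual A) `` {(\<lambda>x\<in>topspace B.T. hinv x) x} =
      (\<lambda>x\<in>topspace B.T. hinv x) ` (ms4_R (ms4_dual B) `` {x})"
    using dual_relation_image[OF A.normal_box B.normal_box h_box x] x
    by (simp only: A.dual_R B.dual_R r) (simp add: B.topspace_dual)
  show "ms4_E (ms4_dual A) `` {(\<lambda>x\<in>topspace B.T. hinv x) x} =
      (\<lambda>x\<in>topspace B.T. hinv x) ` (ms4_E (ms4_dual B) `` {x})"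
    using dual_relation_image[OF A.normal_all B.normal_all h_all x] x
    by (simp only: A.dual_E B.dual_E r) (simp add: B.topspace_dual)
qed simp

end

lemma ms4_arrowD:
  assumes "h \<in> ms4_arrows"
  shows "ms4_homomorphism (src h) (tgt h) (app h)"
  using assms by (simp add: ms4_arrows_def ms4_homomorphism_def ms4_duality_def ms4_homomorphism_axioms_def)

lemma ms4_dual_arr_in_ms4_frame_arrows:
  assumes h: "h \<in> ms4_arrows"
  shows "ms4_dual_arr h \<in> ms4_frame_arrows"
proof -
  interpret ms4_homomorphism "src h" "tgt h" "app h" using h by (rule ms4_arrowD)
  show ?thesis
    using A.descriptive_ms4_dual B.descriptive_ms4_dual preimage_ms4_mor
    by (simp add: ms4_frame_arrows_def ms4_dual_arr_def)
qed

theorem contravariant_functor_ms4_dual: "contravariant_functor MS4 DF_MS4 ms4_dual ms4_dual_arr"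
proof (rule contravariant_functor_preimage[OF concrete_categories(2,4), where S = carrier])
  show "ms4_dual B \<in> Ob DF_MS4" if "B \<in> Ob MS4" for B :: "'a ms4"
    using that ms4_duality.descriptive_ms4_dual by (simp add: MS4_def DF_MS4_def ms4_duality_def)
  show "ms4_dual_arr h \<in> Arr DF_MS4" if "h \<in> Arr MS4" for h :: "('a ms4, 'a ms4, 'a, 'a) arrow"
    using that ms4_dual_arr_in_ms4_frame_arrows by (simp add: MS4_def DF_MS4_def)
  show "app h ` carrier (src h) \<subseteq> carrier (tgt h)" if "h \<in> Arr MS4" for h :: "('a ms4, 'a ms4, 'a, 'a) arrow"
    using concreteD[OF concrete_categories(2) that] by (auto simp: MS4_def)
  show "x \<subseteq> carrier B" if "B \<in> Ob MS4" "x \<in> Und DF_MS4 (ms4_dual B)" for B :: "'a ms4" and x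
  proof -
    interpret ms4_duality B using that(1) by (simp add: MS4_def ms4_duality_def)
    show ?thesis using that(2) ultrafilter_carrier by (auto simp: DF_MS4_def topspace_dual)
  qed
qed (simp_all add: ms4_dual_arr_def DF_MS4_def MS4_def)

section \<open>Prime filters of the algebra of open elements\<close>

context ms4_duality
begin

abbreviation "H \<equiv> carrier (opens B)"

lemma open_iff: "a \<in> H \<longleftrightarrow> a \<in> carrier B \<and> box B a = a"
  by (simp add: opens_def)

lemma open_carrier: "a \<in> H \<Longrightarrow> a \<in> carrier B"
  by (simp add: open_iff)

lemma le_opens: "le (opens B) = le B"
  by (simp add: opens_def)

lemma box_open: "a \<in> carrier B \<Longrightarrow> box B a \<in> H"
  by (simp add: open_iff box_closed box_idem)

lemma top_open: "\<top> \<in> H"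
  by (simp add: open_iff box_top)

lemma bottom_open: "\<bottom> \<in> H"
  using box_decr[of \<bottom>] bottom_lower[of "box B \<bottom>"] box_closed
  by (auto simp: open_iff intro!: le_antisym)

lemma meet_open: "a \<in> H \<Longrightarrow> b \<in> H \<Longrightarrow> a \<sqinter> b \<in> H"
  by (simp add: open_iff box_meet)

lemma join_open:
  assumes a: "a \<in> H" and b: "b \<in> H"
  shows "a \<squnion> b \<in> H"
proof -
  have c: "a \<in> carrier B" "b \<in> carrier B" using a b by (simp_all add: open_iff)
  have "a \<sqsubseteq> box B (a \<squnion> b)" "b \<sqsubseteq> box B (a \<squnion> b)"
    using normal_operator_mono[OF normal_box, of a "a \<squnion> b"] normal_operator_mono[OF normal_box, of b "a \<squnion> b"]
      a b c join_left join_right by (auto simp: open_iff)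
  then have "a \<squnion> b \<sqsubseteq> box B (a \<squnion> b)" using c box_closed by (intro join_le) simp_all
  then show ?thesis using c box_closed box_decr by (auto simp: open_iff intro!: le_antisym)
qed

lemma partial_order_opens: "partial_order (opens B)"
  by unfold_locales (auto simp: opens_def intro: le_trans)

lemma opens_top: "\<top>\<^bsub>opens B\<^esub> = \<top>"
  by (rule partial_order.top_eqI[OF partial_order_opens])
    (auto simp: greatest_def le_opens top_open open_carrier)

lemma opens_meet:
  assumes a: "a \<in> H" and b: "b \<in> H"
  shows "a \<sqinter>\<^bsub>opens B\<^esub> b = a \<sqinter> b"
proof (rule partial_order.meet_eqI[OF partial_order_opens], unfold greatest_def, intro conjI ballI)
  show "Lower (opens B) {a, b} \<subseteq> H" by simp
  show "a \<sqinter> b \<in> Lower (opens B) {a, b}"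
    using a b meet_left meet_right by (auto simp: Lower_def le_opens meet_open open_carrier)
  fix c assume "c \<in> Lower (opens B) {a, b}"
  then have "c \<in> H" "c \<sqsubseteq> a" "c \<sqsubseteq> b" using a b by (simp_all add: Lower_def le_opens)
  then show "c \<sqsubseteq>\<^bsub>opens B\<^esub> a \<sqinter> b" using a b by (simp add: le_opens meet_le open_carrier)
qed

lemma opens_join:
  assumes a: "a \<in> H" and b: "b \<in> H"
  shows "a \<squnion>\<^bsub>opens B\<^esub> b = a \<squnion> b"
proof (rule partial_order.join_eqI[OF partial_order_opens], unfold least_def, intro conjI ballI)
  show "Upper (opens B) {a, b} \<subseteq> H" by simp
  show "a \<squnion> b \<in> Upper (opens B) {a, b}"
    using a b join_left join_right by (auto simp: Upper_def le_opens join_open open_carrier)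
  fix c assume "c \<in> Upper (opens B) {a, b}"
  then have "c \<in> H" "a \<sqsubseteq> c" "b \<sqsubseteq> c" using a b by (simp_all add: Upper_def le_opens)
  then show "a \<squnion> b \<sqsubseteq>\<^bsub>opens B\<^esub> c" using a b by (simp add: le_opens join_le open_carrier)
qed

lemma prime_filterD:
  assumes "prime_filter (opens B) x"
  shows "x \<subseteq> H" "\<top> \<in> x" "\<bottom> \<notin> x"
    "a \<in> x \<Longrightarrow> b \<in> x \<Longrightarrow> a \<sqinter> b \<in> x"
    "a \<in> x \<Longrightarrow> b \<in> H \<Longrightarrow> a \<sqsubseteq> b \<Longrightarrow> b \<in> x"
    "a \<in> H \<Longrightarrow> b \<in> H \<Longrightarrow> a \<squnion> b \<in> x \<Longrightarrow> a \<in> x \<or> b \<in> x"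
proof -
  have F: "lattice_filter (opens B) x" and proper: "x \<noteq> H"
    using assms by (auto simp: prime_filter_def proper_filter_def)
  note FD = lattice_filterD[OF F]
  show sub: "x \<subseteq> H" "\<top> \<in> x" using FD(1,2) by (simp_all add: opens_top)
  show "a \<sqinter> b \<in> x" if "a \<in> x" "b \<in> x"
    using FD(3)[OF that] opens_meet[of a b] subsetD[OF sub(1) that(1)] subsetD[OF sub(1) that(2)] by simp
  show up: "a \<in> x \<Longrightarrow> b \<in> H \<Longrightarrow> a \<sqsubseteq> b \<Longrightarrow> b \<in> x" for a b using FD(4)[of a b] by (simp add: le_opens)
  show "\<bottom> \<notin> x"
  proof
    assume "\<bottom> \<in> x"
    then have "b \<in> x" if "b \<in> H" for b using up[OF _ that] bottom_lower open_carrier that by blast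
    then show False using proper sub by blast
  qed
  show "a \<in> H \<Longrightarrow> b \<in> H \<Longrightarrow> a \<squnion> b \<in> x \<Longrightarrow> a \<in> x \<or> b \<in> x"
    using assms opens_join[of a b] by (auto simp: prime_filter_def)
qed

lemma ultrafilter_trace:
  assumes y: "ultrafilter B y"
  shows "prime_filter (opens B) (y \<inter> H)"
  unfolding prime_filter_def proper_filter_def lattice_filter_def
proof (intro conjI ballI impI)
  show "y \<inter> H \<subseteq> H" by blast
  show "\<top>\<^bsub>opens B\<^esub> \<in> y \<inter> H" using top_in_ultrafilter[OF y] top_open by (simp add: opens_top)
  show "y \<inter> H \<noteq> H" using bottom_notin_ultrafilter[OF y] bottom_open by blast
  fix a assume a: "a \<in> y \<inter> H"
  show "a \<sqinter>\<^bsub>opens B\<^esub> b \<in> y \<inter> H" if b: "b \<in> y \<inter> H" for b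
    using a b meet_in_ultrafilter[OF y] meet_open by (simp add: opens_meet open_carrier)
  show "b \<in> y \<inter> H" if "b \<in> H" "a \<sqsubseteq>\<^bsub>opens B\<^esub> b" for b
    using a that ultrafilter_mono[OF y, of a b] open_carrier by (simp add: le_opens)
next
  fix a b assume "a \<in> H" "b \<in> H" "a \<squnion>\<^bsub>opens B\<^esub> b \<in> y \<inter> H"
  then show "a \<in> y \<inter> H \<or> b \<in> y \<inter> H"
    using join_in_ultrafilter[OF y] by (simp add: opens_join open_carrier)
qed

text \<open>
  Extend the upward closure of \<open>x\<close> to an ultrafilter avoiding the open elements outside \<open>x\<close>; these
  are closed under joins because \<open>x\<close> is prime.
\<close>

lemma prime_filter_is_trace:
  assumes x: "prime_filter (opens B) x"
  obtains y where "ultrafilter B y" "y \<inter> H = x"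
proof -
  note xD = prime_filterD[OF x]
  let ?F = "{c \<in> carrier B. \<exists>a\<in>x. a \<sqsubseteq> c}"
  have xc: "a \<in> carrier B" if "a \<in> x" for a using that xD(1) open_carrier by blast
  have "lattice_filter B ?F"
    unfolding lattice_filter_def
  proof (intro conjI ballI impI)
    show "\<top> \<in> ?F" using xD(2) by auto
    fix c assume "c \<in> ?F"
    then obtain a where a: "a \<in> x" "a \<sqsubseteq> c" "c \<in> carrier B" by blast
    show "d \<in> ?F" if "d \<in> carrier B" "c \<sqsubseteq> d" for d
      using that a xc le_trans[OF a(2) that(2)] by blast
    fix d assume "d \<in> ?F"
    then obtain b where b: "b \<in> x" "b \<sqsubseteq> d" "d \<in> carrier B" by blast
    note ac = xc[OF a(1)] and bc = xc[OF b(1)]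
    have "a \<sqinter> b \<sqsubseteq> c \<sqinter> d"
      using le_trans[OF meet_left[OF ac bc] a(2)] le_trans[OF meet_right[OF ac bc] b(2)] ac bc a(3) b(3)
      by (intro meet_le) simp_all
    then show "c \<sqinter> d \<in> ?F" using xD(4)[OF a(1) b(1)] a b by auto
  qed blast
  moreover have "H - x \<subseteq> carrier B" using open_carrier by blast
  moreover have "H - x \<noteq> {}" using bottom_open xD(3) by blast
  moreover have "a \<squnion> b \<in> H - x" if "a \<in> H - x" "b \<in> H - x" for a b
    using that xD(6)[of a b] join_open by blast
  moreover have "?F \<inter> (H - x) = {}" using xD(5) by blast
  ultimately obtain y where y: "ultrafilter B y" "?F \<subseteq> y" "y \<inter> (H - x) = {}"
    by (rule ultrafilter_avoiding)
  have "x \<subseteq> ?F" using xc le_refl by blast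
  then have "y \<inter> H = x" using y xD(1) by blast
  then show thesis using that y(1) by blast
qed

lemma trace_R_iff:
  assumes y: "ultrafilter B y" and z: "ultrafilter B z"
  shows "y \<inter> H \<subseteq> z \<inter> H \<longleftrightarrow> (y, z) \<in> ms4_R (ms4_dual B)"
proof
  assume sub: "y \<inter> H \<subseteq> z \<inter> H"
  have "a \<in> z" if "a \<in> carrier B" "box B a \<in> y" for a
  proof -
    have "box B a \<in> z" using sub that box_open by blast
    then show ?thesis using ultrafilter_mono[OF z _ box_decr] that by blast
  qed
  then show "(y, z) \<in> ms4_R (ms4_dual B)" using y z by (auto simp: dual_R dual_relation_def)
next
  assume "(y, z) \<in> ms4_R (ms4_dual B)"
  then have "a \<in> z" if "a \<in> carrier B" "box B a \<in> y" for a using that by (auto simp: dual_R dual_relation_def)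
  then show "y \<inter> H \<subseteq> z \<inter> H" by (auto simp: open_iff)
qed

text \<open>
  The set \<open>H\<^sub>0 = {\<box>\<forall>a | a \<in> H}\<close> consists of the open elements of \<open>B\<^sub>0\<close>, since \<open>\<box>\<close> maps \<open>B\<^sub>0\<close> into itself.
\<close>

lemma range_all_opens: "mha_all (opens B) ` H = H \<inter> all_fixpoints"
proof
  show "mha_all (opens B) ` H \<subseteq> H \<inter> all_fixpoints"
  proof
    fix b assume "b \<in> mha_all (opens B) ` H"
    then obtain a where a: "a \<in> carrier B" "b = box B (ms4_all B a)" by (auto simp: opens_def)
    have "ms4_all B a \<in> all_fixpoints" using a(1) range_all by blast
    then show "b \<in> H \<inter> all_fixpoints"
      using a all_fixpoints_box box_open[OF all_closed] by blast
  qed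
  show "H \<inter> all_fixpoints \<subseteq> mha_all (opens B) ` H"
  proof
    fix a assume a: "a \<in> H \<inter> all_fixpoints"
    then have "mha_all (opens B) a = a" by (simp add: opens_def all_fixpoints_def)
    then show "a \<in> mha_all (opens B) ` H" using a by (metis Int_iff image_eqI)
  qed
qed

lemma trace_Q_iff:
  assumes y: "ultrafilter B y" and z: "ultrafilter B z"
  shows "y \<inter> H \<inter> mha_all (opens B) ` H \<subseteq> z \<inter> H \<longleftrightarrow> (y, z) \<in> ms4_R (ms4_dual B) O ms4_E (ms4_dual B)"
  unfolding R_E_iff[OF y z] range_all_opens
proof
  assume sub: "y \<inter> H \<inter> (H \<inter> all_fixpoints) \<subseteq> z \<inter> H"
  show "\<forall>a\<in>all_fixpoints. box B a \<in> y \<longrightarrow> a \<in> z"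
  proof (intro ballI impI)
    fix a assume a: "a \<in> all_fixpoints" "box B a \<in> y"
    have ac: "a \<in> carrier B" using a(1) by (rule all_fixpoints_carrier)
    have "box B a \<in> y \<inter> H \<inter> (H \<inter> all_fixpoints)"
      using a(2) box_open[OF ac] all_fixpoints_box[OF a(1)] by simp
    then have "box B a \<in> z" using sub by blast
    then show "a \<in> z" by (rule ultrafilter_mono[OF z _ box_decr[OF ac] ac])
  qed
next
  assume "\<forall>a\<in>all_fixpoints. box B a \<in> y \<longrightarrow> a \<in> z"
  then show "y \<inter> H \<inter> (H \<inter> all_fixpoints) \<subseteq> z \<inter> H" by (auto simp: open_iff)
qed

abbreviation "D \<equiv> mha_dual (opens B)"

lemma topspace_mha_dual: "topspace (mipc_space D) = {x. prime_filter (opens B) x}"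
proof -
  have "topspace (mipc_space D) =
      \<Union>{prime_filters_of (opens B) a - prime_filters_of (opens B) b |a b. a \<in> H \<and> b \<in> H}"
    by (simp add: mha_dual_def)
  also have "\<dots> = {x. prime_filter (opens B) x}"
  proof
    show "{x. prime_filter (opens B) x} \<subseteq>
        \<Union>{prime_filters_of (opens B) a - prime_filters_of (opens B) b |a b. a \<in> H \<and> b \<in> H}"
    proof
      fix x assume "x \<in> {x. prime_filter (opens B) x}"
      then have "x \<in> prime_filters_of (opens B) \<top> - prime_filters_of (opens B) \<bottom>"
        using prime_filterD by (simp add: prime_filters_of_def)
      then show "x \<in> \<Union>{prime_filters_of (opens B) a - prime_filters_of (opens B) b |a b. a \<in> H \<and> b \<in> H}"
        using top_open bottom_open by blast
    qed
  qed (auto simp: prime_filters_of_def)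
  finally show ?thesis .
qed

lemma openin_mha_dual:
  "a \<in> H \<Longrightarrow> b \<in> H \<Longrightarrow> openin (mipc_space D) (prime_filters_of (opens B) a - prime_filters_of (opens B) b)"
  by (auto simp: mha_dual_def intro!: topology_generated_by_Basis)

lemma Hausdorff_mha_dual: "Hausdorff_space (mipc_space D)"
proof -
  have sep: "\<exists>U V. openin (mipc_space D) U \<and> openin (mipc_space D) V \<and> x \<in> U \<and> y \<in> V \<and> disjnt U V"
    if xy: "prime_filter (opens B) x" "prime_filter (opens B) y" "a \<in> x" "a \<notin> y" for x y a
  proof -
    let ?s = "prime_filters_of (opens B)"
    have a: "a \<in> H" using xy prime_filterD(1) by blast
    show ?thesis
      using openin_mha_dual[OF a bottom_open] openin_mha_dual[OF top_open a] xy prime_filterD(2,3)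
      by (intro exI[of _ "?s a - ?s \<bottom>"] exI[of _ "?s \<top> - ?s a"])
        (auto simp: disjnt_def prime_filters_of_def)
  qed
  show ?thesis
    unfolding Hausdorff_space_def topspace_mha_dual
  proof (intro allI impI)
    fix x y assume xy: "x \<in> {x. prime_filter (opens B) x} \<and> y \<in> {x. prime_filter (opens B) x} \<and> x \<noteq> y"
    then consider a where "a \<in> x" "a \<notin> y" | a where "a \<in> y" "a \<notin> x" by blast
    then show "\<exists>U V. openin (mipc_space D) U \<and> openin (mipc_space D) V \<and> x \<in> U \<and> y \<in> V \<and> disjnt U V"
    proof cases
      case 1
      then show ?thesis using sep xy by blast
    next
      case (2 a)
      then have "\<exists>U V. openin (mipc_space D) U \<and> openin (mipc_space D) V \<and> y \<in> U \<and> x \<in> V \<and> disjnt U V"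
        using sep xy by blast
      then show ?thesis using disjnt_sym by blast
    qed
  qed
qed

text \<open>
  A continuous surjection from a compact space onto a Hausdorff space is a quotient map. Surjectivity
  is the extension of prime filters to ultrafilters.
\<close>

lemma quotient_map_trace: "quotient_map T (mipc_space D) (\<lambda>y. y \<inter> H)"
proof (rule continuous_imp_quotient_map[OF _ compact_dual Hausdorff_mha_dual])
  let ?S = "{prime_filters_of (opens B) a - prime_filters_of (opens B) b |a b. a \<in> H \<and> b \<in> H}"
  have D: "mipc_space D = topology_generated_by ?S" by (simp add: mha_dual_def)
  show surj: "(\<lambda>y. y \<inter> H) ` topspace T = topspace (mipc_space D)"
    unfolding topspace_dual topspace_mha_dual
    using ultrafilter_trace by (auto elim!: prime_filter_is_trace)
  show "continuous_map T (mipc_space D) (\<lambda>y. y \<inter> H)"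
    unfolding D continuous_on_generated_topo_iff
  proof (intro conjI allI impI)
    show "(\<lambda>y. y \<inter> H) ` topspace T \<subseteq> \<Union>?S"
      using surj unfolding D by simp
    fix U assume "U \<in> ?S"
    then obtain a b where ab: "a \<in> H" "b \<in> H" "U = prime_filters_of (opens B) a - prime_filters_of (opens B) b" by blast
    have "(\<lambda>y. y \<inter> H) -` U \<inter> topspace T = ultrafilters_of B a - ultrafilters_of B b"
      using ab ultrafilter_trace by (auto simp: topspace_dual in_ultrafilters_of prime_filters_of_def)
    then show "openin T ((\<lambda>y. y \<inter> H) -` U \<inter> topspace T)"
      using clopen_in_Diff[OF clopen_ultrafilters_of clopen_ultrafilters_of] ab open_carrier
      by (simp add: clopen_in_def)
  qed
qed

theorem mipc_quotient_trace: "mipc_quotient (unreduced (ms4_dual B)) D (\<lambda>y. y \<inter> H)"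
proof -
  have R: "mipc_R D = {(x, y). prime_filter (opens B) x \<and> prime_filter (opens B) y \<and> x \<subseteq> y}"
    and Q: "mipc_Q D = {(x, y). prime_filter (opens B) x \<and> prime_filter (opens B) y \<and>
      x \<inter> mha_all (opens B) ` H \<subseteq> y}"
    by (simp_all add: mha_dual_def)
  show ?thesis
  proof (rule mipc_quotient.intro, rule descriptive_ms4_frame.quasi_mipc_frame_unreduced[OF descriptive_ms4_dual],
      unfold_locales, unfold unreduced_simps)
    show "quotient_map T (mipc_space D) (\<lambda>y. y \<inter> H)" by (rule quotient_map_trace)
    show "mipc_R D \<subseteq> topspace (mipc_space D) \<times> topspace (mipc_space D)"
      "mipc_Q D \<subseteq> topspace (mipc_space D) \<times> topspace (mipc_space D)"
      by (auto simp: R Q topspace_mha_dual)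
  next
    fix y z assume "y \<in> topspace T" "z \<in> topspace T"
    then have yz: "ultrafilter B y" "ultrafilter B z" by (simp_all add: topspace_dual)
    show "(y \<inter> H, z \<inter> H) \<in> mipc_R D \<longleftrightarrow> (y, z) \<in> ms4_R (ms4_dual B)"
      using trace_R_iff[OF yz] ultrafilter_trace yz by (simp only: R mem_Collect_eq case_prod_conv simp_thms)
    show "(y \<inter> H, z \<inter> H) \<in> mipc_Q D \<longleftrightarrow> (y, z) \<in> ms4_R (ms4_dual B) O ms4_E (ms4_dual B)"
      using trace_Q_iff[OF yz] ultrafilter_trace yz by (simp only: Q mem_Collect_eq case_prod_conv simp_thms)
  next
    fix y z assume yz: "(y, z) \<in> ms4_R (ms4_dual B)" "(z, y) \<in> ms4_R (ms4_dual B)"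
    then have "ultrafilter B y" "ultrafilter B z" by (auto simp: dual_R dual_relation_def)
    then show "y \<inter> H = z \<inter> H" using trace_R_iff yz by blast
  qed
qed

end

text \<open>
  The component at \<open>B\<close> of the natural isomorphism from \<open>\<rho> \<circ> (-)\<^sub>*\<close> to \<open>(-)\<^sub>* \<circ> \<O>\<close>. All ultrafilters in one class
  have the same trace on the open elements, so the union of the class has that trace as well.
\<close>

definition skel_dual_iso :: "'a ms4 \<Rightarrow> ('a set set mipc_frame, 'a set mipc_frame, 'a set set, 'a set) arrow" where
  "skel_dual_iso B = \<lparr>src = skel (ms4_dual B), tgt = mha_dual (opens B),
    app = (\<lambda>c\<in>topspace (mipc_space (skel (ms4_dual B))). \<Union>c \<inter> carrier (opens B))\<rparr>"

context ms4_duality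
begin

lemma skel_dual_iso_app:
  assumes y: "y \<in> topspace T"
  shows "app (skel_dual_iso B) (skel_proj (ms4_dual B) y) = y \<inter> H"
proof -
  interpret G: descriptive_ms4_frame "ms4_dual B" by (rule descriptive_ms4_dual)
  have "z \<inter> H = y \<inter> H" if "z \<in> skel_proj (ms4_dual B) y" for z
  proof -
    have *: "(y, z) \<in> ms4_R (ms4_dual B)" "(z, y) \<in> ms4_R (ms4_dual B)"
      using that by (auto simp: skel_proj_def sym_part_def)
    then have "ultrafilter B y" "ultrafilter B z" by (auto simp: dual_R dual_relation_def)
    then show ?thesis using * trace_R_iff by blast
  qed
  then have "\<Union>(skel_proj (ms4_dual B) y) \<inter> H = y \<inter> H"
    using G.skel_proj_self[OF y] by blast
  then show ?thesis using y by (simp add: skel_dual_iso_def G.topspace_skel)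
qed

lemma skel_dual_iso_isomorphism:
  "skel_dual_iso B \<in> isomorphisms (Und DF_MIPC) (Und DF_MIPC) mipc_frame_arrows mipc_frame_arrows"
proof -
  interpret G: descriptive_ms4_frame "ms4_dual B" by (rule descriptive_ms4_dual)
  let ?S = "skel (ms4_dual B)" and ?p = "skel_proj (ms4_dual B)"
  let ?f = "app (skel_dual_iso B)"
  \<comment> \<open>The class of an ultrafilter consists of all ultrafilters with the same trace.\<close>
  let ?g = "\<lambda>x\<in>topspace (mipc_space D). {y. ultrafilter B y \<and> y \<inter> H = x}"
  have g: "?g (y \<inter> H) = ?p y" if y: "y \<in> G.Y" for y
  proof -
    have uy: "ultrafilter B y" using y by (simp add: topspace_dual)
    have "ultrafilter B z \<and> z \<inter> H = y \<inter> H \<longleftrightarrow> (y, z) \<in> sym_part (ms4_R (ms4_dual B))" for z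
    proof (cases "ultrafilter B z")
      case True
      then show ?thesis
        using trace_R_iff[OF uy True] trace_R_iff[OF True uy] unfolding sym_part_def by blast
    qed (auto simp: sym_part_def dual_R dual_relation_def)
    then have "{z. ultrafilter B z \<and> z \<inter> H = y \<inter> H} = ?p y" by (auto simp: skel_proj_def)
    then show ?thesis using ultrafilter_trace[OF uy] by (simp add: topspace_mha_dual)
  qed
  note id = quasi_mipc_frame_id_mor[OF G.quasi_mipc_frame_unreduced]
  have f_mor: "mipc_mor ?S D ?f"
    by (rule mipc_mor_descends[OF G.mipc_quotient_skel mipc_quotient_trace id])
      (simp add: skel_dual_iso_def, simp add: skel_dual_iso_app)
  have g_mor: "mipc_mor D ?S ?g"
  proof (rule mipc_mor_descends[OF mipc_quotient_trace G.mipc_quotient_skel id])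
    fix y assume "y \<in> topspace (mipc_space (unreduced (ms4_dual B)))"
    then show "?g (y \<inter> H) = ?p ((\<lambda>y\<in>topspace (mipc_space (unreduced (ms4_dual B))). y) y)"
      using g[of y] unfolding restrict_apply by simp
  qed simp
  have gf: "?g (?f c) = c" if c: "c \<in> topspace (mipc_space ?S)" for c
  proof -
    obtain y where y: "y \<in> G.Y" "c = ?p y" using c by (auto simp: G.topspace_skel)
    show ?thesis unfolding y(2) skel_dual_iso_app[OF y(1)] by (rule g[OF y(1)])
  qed
  have fg: "?f (?g x) = x" if x: "x \<in> topspace (mipc_space D)" for x
  proof -
    obtain y where y: "ultrafilter B y" "y \<inter> H = x"
      using x prime_filter_is_trace by (auto simp: topspace_mha_dual)
    then have yY: "y \<in> G.Y" by (simp add: topspace_dual)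
    show ?thesis unfolding y(2)[symmetric] g[OF yY] by (rule skel_dual_iso_app[OF yY])
  qed
  have D: "descriptive_mipc_frame D" "descriptive_mipc_frame ?S"
    using mipc_quotient.descriptive[OF mipc_quotient_trace] mipc_quotient.descriptive[OF G.mipc_quotient_skel] .
  let ?G = "\<lparr>src = D, tgt = ?S, app = ?g\<rparr>"
  have "skel_dual_iso B \<in> mipc_frame_arrows" "?G \<in> mipc_frame_arrows"
    using f_mor g_mor D by (simp_all add: mipc_frame_arrows_def) (simp_all add: skel_dual_iso_def)
  moreover have "comp_arr (Und DF_MIPC) ?G (skel_dual_iso B) = id_arr (Und DF_MIPC) ?S"
    by (rule comp_arr_eq_idI) (simp add: skel_dual_iso_def, simp, simp only: arrow.simps DF_MIPC_def concrete_category.simps gf)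
  moreover have "comp_arr (Und DF_MIPC) (skel_dual_iso B) ?G = id_arr (Und DF_MIPC) D"
    by (rule comp_arr_eq_idI) (simp, simp add: skel_dual_iso_def, simp only: arrow.simps DF_MIPC_def concrete_category.simps fg)
  ultimately show ?thesis
    unfolding isomorphisms_def mem_Collect_eq
    by (intro conjI bexI[of _ ?G]) (simp_all add: skel_dual_iso_def)
qed

end

section \<open>The natural isomorphism on duals of algebras\<close>

lemma mha_dual_arr_opens_arr: "(mha_dual_arr \<circ> opens_arr) h =
  \<lparr>src = (mha_dual \<circ> opens) (tgt h), tgt = (mha_dual \<circ> opens) (src h),
   app = (\<lambda>x\<in>topspace (mipc_space ((mha_dual \<circ> opens) (tgt h))). app h -` x \<inter> carrier (opens (src h)))\<rparr>"
  by (auto simp: mha_dual_arr_def opens_arr_def intro!: restrict_ext)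

lemma opens_arr_closed:
  assumes "h \<in> ms4_arrows" "a \<in> carrier (opens (src h))"
  shows "app h a \<in> carrier (opens (tgt h))"
proof -
  interpret ms4_homomorphism "src h" "tgt h" "app h" using assms(1) by (rule ms4_arrowD)
  show ?thesis using assms(2) h_closed h_box[of a] by (auto simp: A.open_iff B.open_iff)
qed

lemma trace_natural:
  assumes h: "h \<in> ms4_arrows" and y: "y \<in> topspace (ms4_space (ms4_dual (tgt h)))"
  shows "app (ms4_dual_arr h) y \<inter> carrier (opens (src h)) =
    app ((mha_dual_arr \<circ> opens_arr) h) (y \<inter> carrier (opens (tgt h)))"
proof -
  interpret ms4_homomorphism "src h" "tgt h" "app h" using h by (rule ms4_arrowD)
  have "y \<inter> B.H \<in> topspace (mipc_space B.D)"
    using y B.ultrafilter_trace by (simp add: B.topspace_dual B.topspace_mha_dual)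
  then show ?thesis
    using y opens_arr_closed[OF h] A.open_carrier
    unfolding mha_dual_arr_opens_arr by (auto simp: ms4_dual_arr_def)
qed

text \<open>
  The dual of \<open>\<O>(h)\<close> is what the dual of \<open>h\<close> induces on the quotients by the trace maps, so it is a morphism
  of MIPC-frames.
\<close>

lemma contravariant_functor_mha_dual_opens:
  "contravariant_functor MS4 DF_MIPC (mha_dual \<circ> opens) (mha_dual_arr \<circ> opens_arr)"
proof (rule contravariant_functor_preimage[OF concrete_categories(2,3), where S = "\<lambda>B. carrier (opens B)"])
  show descr: "(mha_dual \<circ> opens) B \<in> Ob DF_MIPC" if "B \<in> Ob MS4" for B :: "'a ms4"
    using that mipc_quotient.descriptive[OF ms4_duality.mipc_quotient_trace]
    by (simp add: MS4_def DF_MIPC_def ms4_duality_def)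
  show "(mha_dual_arr \<circ> opens_arr) h \<in> Arr DF_MIPC" if "h \<in> Arr MS4" for h :: "('a ms4, 'a ms4, 'a, 'a) arrow"
  proof -
    have h: "h \<in> ms4_arrows" using that by (simp add: MS4_def)
    interpret ms4_homomorphism "src h" "tgt h" "app h" using h by (rule ms4_arrowD)
    have "mipc_mor B.D A.D (app ((mha_dual_arr \<circ> opens_arr) h))"
    proof (rule mipc_mor_descends[OF B.mipc_quotient_trace A.mipc_quotient_trace])
      show "mipc_mor (unreduced (ms4_dual (tgt h))) (unreduced (ms4_dual (src h))) (app (ms4_dual_arr h))"
        using ms4_mor_unreduced[OF B.descriptive_ms4_dual A.descriptive_ms4_dual preimage_ms4_mor]
        by (simp add: ms4_dual_arr_def)
      show "app ((mha_dual_arr \<circ> opens_arr) h) \<in> extensional (topspace (mipc_space B.D))"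
        unfolding mha_dual_arr_opens_arr by simp
      fix y assume "y \<in> topspace (mipc_space (unreduced (ms4_dual (tgt h))))"
      then show "app ((mha_dual_arr \<circ> opens_arr) h) (y \<inter> B.H) = app (ms4_dual_arr h) y \<inter> A.H"
        using trace_natural[OF h] by simp
    qed
    then show ?thesis
      using mipc_quotient.descriptive[OF A.mipc_quotient_trace] mipc_quotient.descriptive[OF B.mipc_quotient_trace]
      unfolding mha_dual_arr_opens_arr by (simp add: DF_MIPC_def mipc_frame_arrows_def)
  qed
  show "carrier (opens B) \<subseteq> Und MS4 B" for B :: "'a ms4"
    by (auto simp: MS4_def opens_def)
  show "app h ` carrier (opens (src h)) \<subseteq> carrier (opens (tgt h))" if "h \<in> Arr MS4"
    for h :: "('a ms4, 'a ms4, 'a, 'a) arrow"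
    using that opens_arr_closed by (auto simp: MS4_def)
  show "x \<subseteq> carrier (opens B)" if "B \<in> Ob MS4" "x \<in> Und DF_MIPC ((mha_dual \<circ> opens) B)" for B :: "'a ms4" and x
  proof -
    interpret ms4_duality B using that(1) by (simp add: MS4_def ms4_duality_def)
    show ?thesis using that(2) prime_filterD(1) by (auto simp: DF_MIPC_def topspace_mha_dual)
  qed
  show "(mha_dual_arr \<circ> opens_arr) h = \<lparr>src = (mha_dual \<circ> opens) (tgt h), tgt = (mha_dual \<circ> opens) (src h),
      app = (\<lambda>x\<in>Und DF_MIPC ((mha_dual \<circ> opens) (tgt h)). app h -` x \<inter> carrier (opens (src h)))\<rparr>"
    for h :: "('a ms4, 'a ms4, 'a, 'a) arrow"
    by (simp only: mha_dual_arr_opens_arr) (simp add: DF_MIPC_def)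
qed

lemma skel_dual_iso_natural:
  fixes h :: "('a ms4, 'a ms4, 'a, 'a) arrow"
  assumes h: "h \<in> ms4_arrows"
  shows "comp_arr (Und DF_MIPC) (skel_dual_iso (src h)) ((skel_arr \<circ> ms4_dual_arr) h) =
    comp_arr (Und DF_MIPC) ((mha_dual_arr \<circ> opens_arr) h) (skel_dual_iso (tgt h))"
proof -
  interpret ms4_homomorphism "src h" "tgt h" "app h" using h by (rule ms4_arrowD)
  interpret G: descriptive_ms4_frame "ms4_dual (tgt h)" by (rule B.descriptive_ms4_dual)
  have d: "ms4_dual_arr h \<in> ms4_frame_arrows" using h by (rule ms4_dual_arr_in_ms4_frame_arrows)
  have st: "src (ms4_dual_arr h) = ms4_dual (tgt h)" "tgt (ms4_dual_arr h) = ms4_dual (src h)"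
    by (simp_all add: ms4_dual_arr_def)
  show ?thesis
  proof (rule comp_arr_eqI)
    show "src ((skel_arr \<circ> ms4_dual_arr) h) = src (skel_dual_iso (tgt h))"
      "tgt (skel_dual_iso (src h)) = tgt ((mha_dual_arr \<circ> opens_arr) h)"
      by (simp_all add: skel_dual_iso_def skel_arr_def mha_dual_arr_def opens_arr_def st)
    fix c assume "c \<in> Und DF_MIPC (src ((skel_arr \<circ> ms4_dual_arr) h))"
    then have c: "c \<in> topspace (mipc_space (skel (ms4_dual (tgt h))))"
      by (simp add: DF_MIPC_def skel_arr_def st)
    obtain y where y: "y \<in> G.Y" "c = skel_proj (ms4_dual (tgt h)) y" using c by (auto simp: G.topspace_skel)
    have "app (skel_arr (ms4_dual_arr h)) c = skel_proj (ms4_dual (src h)) (app (ms4_dual_arr h) y)"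
      using skel_arr_app[OF d] y by (simp add: st)
    moreover have "app (ms4_dual_arr h) y \<in> topspace A.T"
      using y preimage_ultrafilter by (simp add: ms4_dual_arr_def A.topspace_dual B.topspace_dual)
    ultimately show "app (skel_dual_iso (src h)) (app ((skel_arr \<circ> ms4_dual_arr) h) c) =
        app ((mha_dual_arr \<circ> opens_arr) h) (app (skel_dual_iso (tgt h)) c)"
      using trace_natural[OF h y(1)] A.skel_dual_iso_app B.skel_dual_iso_app[OF y(1)] y(2) by simp
  qed
qed

theorem skel_dual_natural_isomorphism:
  "naturally_isomorphic MS4 DF_MIPC DF_MIPC mipc_frame_arrows mipc_frame_arrows
    (skel \<circ> ms4_dual) (skel_arr \<circ> ms4_dual_arr) (mha_dual \<circ> opens) (mha_dual_arr \<circ> opens_arr)"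
  unfolding naturally_isomorphic_def
proof (intro conjI exI ballI)
  show "contravariant_functor MS4 DF_MIPC (skel \<circ> ms4_dual) (skel_arr \<circ> ms4_dual_arr)"
    using contravariant_functor_ms4_dual covariant_functor_skel by (rule covariant_comp_contravariant)
  show "contravariant_functor MS4 DF_MIPC (mha_dual \<circ> opens) (mha_dual_arr \<circ> opens_arr)"
    by (rule contravariant_functor_mha_dual_opens)
  fix B :: "'a ms4" assume "B \<in> Ob MS4"
  then interpret ms4_duality B by (simp add: MS4_def ms4_duality_def)
  show "skel_dual_iso B \<in> isomorphisms (Und DF_MIPC) (Und DF_MIPC) mipc_frame_arrows mipc_frame_arrows"
    by (rule skel_dual_iso_isomorphism)
next
  fix B :: "'a ms4"
  show "src (skel_dual_iso B) = (skel \<circ> ms4_dual) B" "tgt (skel_dual_iso B) = (mha_dual \<circ> opens) B"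
    by (simp_all add: skel_dual_iso_def)
next
  fix h :: "('a ms4, 'a ms4, 'a, 'a) arrow" assume "h \<in> Arr MS4"
  then show "comp_arr (Und DF_MIPC) (skel_dual_iso (src h)) ((skel_arr \<circ> ms4_dual_arr) h) =
      comp_arr (Und DF_MIPC) ((mha_dual_arr \<circ> opens_arr) h) (skel_dual_iso (tgt h))"
    using skel_dual_iso_natural by (simp add: MS4_def)
qed

theorem theorem5p17:
  shows "naturally_isomorphic (MS4 :: ('a ms4, 'a) concrete_category)
           DF_MIPC DF_MIPC mipc_frame_arrows mipc_frame_arrows
           (skel \<circ> ms4_dual) (skel_arr \<circ> ms4_dual_arr)
           (mha_dual \<circ> opens) (mha_dual_arr \<circ> opens_arr) \<and>
         naturally_isomorphic (DF_MS4 :: ('y ms4_frame, 'y) concrete_category)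
           MHA MHA mha_arrows mha_arrows
           (mipc_alg \<circ> skel) (mipc_alg_arr \<circ> skel_arr)
           (opens \<circ> ms4_alg) (opens_arr \<circ> ms4_alg_arr)"
  using skel_dual_natural_isomorphism skel_natural_isomorphism by (rule conjI)

end
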